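(* Let $p_0=p_{f_0}\in\mathcal{P}$ with $f_0\in\mathcal{F}$, and suppose assumptions (A)–(D) (listed in the context) hold with $\varepsilon=2$. Let $f_{\lambda,n}=-(\hat C+\lambda I)^{-1}\hat\xi$ be constructed from i.i.d. samples $X_1,\dots,X_n$ from $p_0$, with $\lambda=\lambda_n>0$. (i) If $f_0\in\overline{\mathcal{R}(C)}$, then $\|f_{\lambda,n}-f_0\|_{\mathcal{H}}\to0$ in $p_0$-probability as $\lambda\to0$, $\lambda\sqrt n\to\infty$ and $n\to\infty$. (ii) If $f_0\in\mathcal{R}(C^\beta)$ for some $\beta>0$, then for $\lambda=n^{-\max\left\{\frac14,\frac1{2(\beta+1)}\right\}}$, $$\|f_{\lambda,n}-f_0\|_{\mathcal{H}}=O_{p_0}\left(n^{-\min\left\{\frac14,\frac{\beta}{2(\beta+1)}\right\}}\right)\quad\text{as }n\to\infty.$$ (iii) If $\|C^{-1}\|<\infty$, then for $\lambda=n^{-1/2}$, $\|f_{\lambda,n}-f_0\|_{\mathcal{H}}=O_{p_0}(n^{-1/2})$ as $n\to\infty$.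
   Context: Family: $q_0$ is a probability density on $\Omega\subseteq\mathbb{R}^d$; $\mathcal{H}$ is the RKHS on $\Omega$ with reproducing kernel $k$; $A(f):=\log\int_\Omega e^{f}q_0\,dx$; $\mathcal{F}:=\{f\in\mathcal{H}:e^{A(f)}<\infty\}$; $p_f:=e^{f-A(f)}q_0$; $\mathcal{P}:=\{p_f:f\in\mathcal{F}\}$. Derivatives: $[d]=\{1,\dots,d\}$; for $k$ on $\Omega\times\Omega$, $\partial_i$ and $\partial_{i+d}$ denote partial derivatives in the $i$-th coordinate of the first and second argument, respectively; $\partial_ik(x,\cdot)$ and $\partial_i^2k(x,\cdot)$ (derivatives in the first argument) are elements of $\mathcal{H}$; $\partial^{\alpha,\alpha}k:=\partial_1^{\alpha_1}\cdots\partial_d^{\alpha_d}\partial_{1+d}^{\alpha_1}\cdots\partial_{2d}^{\alpha_d}k$. For $u,v\in\mathcal{H}$, $(u\otimes v)w=u\langle v,w\rangle_{\mathcal{H}}$. Operators: $C:=\int_\Omega p_0(x)\sum_{i=1}^d\partial_ik(x,\cdot)\otimes\partial_ik(x,\cdot)\,dx$ (a positive self-adjoint trace-class operator on $\mathcal{H}$); $\hat C:=\frac1n\sum_{a=1}^n\sum_{i=1}^d\partial_ik(X_a,\cdot)\otimes\partial_ik(X_a,\cdot)$; $\hat\xi:=\frac1n\sum_{a=1}^n\sum_{i=1}^d\left(\partial_ik(X_a,\cdot)\,\partial_i\log q_0(X_a)+\partial_i^2k(X_a,\cdot)\right)$. $\mathcal{R}(\cdot)$ denotes the range of an operator, $C^\beta$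 the fractional power; $\|C^{-1}\|<\infty$ means $C$ is invertible with bounded inverse. $O_{p_0}$ is stochastic boundedness under $p_0$. Assumptions: (A) $\Omega$ is a non-empty open subset of $\mathbb{R}^d$ with a piecewise smooth boundary $\partial\Omega:=\overline\Omega\setminus\Omega$. (B) $p_0$ is continuously extendible to $\overline\Omega$; $k$ is twice continuously differentiable on $\Omega\times\Omega$ (i.e. $\partial^{\alpha,\alpha}k$ exists and is continuous for $|\alpha|\le2$) with continuous extension of $\partial^{\alpha,\alpha}k$ to $\overline\Omega\times\overline\Omega$ for $|\alpha|\le2$. (C) For all $i\in[d]$: $\partial_i\partial_{i+d}k(x,x)p_0(x)=0$ for $x\in\partial\Omega$, and $\sqrt{\partial_i\partial_{i+d}k(x,x)}\,p_0(x)=o(\|x\|_2^{1-d})$ as $x\in\Omega$, $\|x\|_2\to\infty$. (D) ($\varepsilon$-integrability) $q_0\in C^1(\Omega)$, and for some $\varepsilon\ge1$ and all $i\in[d]$, the functions $x\mapsto\partial_i\partial_{i+d}k(x,x)$, $\sqrt{\partial_i^2\partial_{i+d}^2k(x,x)}$ and $\sqrt{\partial_i\partial_{i+d}k(x,x)}\,\partial_i\log q_0(x)$ belong to $L^\varepsilon(\Omega,p_0)$. *)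

theory Defs
  imports "HOL-Probability.Probability" "HOL-Library.Landau_Symbols"
begin

section \<open>Iterated partial derivatives\<close>

definition dir_deriv :: "'a::real_vector \<Rightarrow> ('a \<Rightarrow> real) \<Rightarrow> 'a \<Rightarrow> real" where
  "dir_deriv v f x = deriv (\<lambda>t. f (x + t *\<^sub>R v)) 0"

text \<open>The operator of the first list element is applied last, as in
  \<open>\<partial>\<^sub>1 \<partial>\<^sub>2 f = \<partial>\<^sub>1 (\<partial>\<^sub>2 f)\<close>.\<close>

primrec iter_deriv :: "'a::real_vector list \<Rightarrow> ('a \<Rightarrow> real) \<Rightarrow> 'a \<Rightarrow> real" where
  "iter_deriv [] f = f"
| "iter_deriv (v # vs) f = dir_deriv v (iter_deriv vs f)"

primrec iter_deriv_exists :: "'a::real_vector set \<Rightarrow> 'a list \<Rightarrow> ('a \<Rightarrow> real) \<Rightarrow> bool" where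
  "iter_deriv_exists S [] f \<longleftrightarrow> True"
| "iter_deriv_exists S (v # vs) f \<longleftrightarrow> iter_deriv_exists S vs f \<and>
     (\<forall>x\<in>S. (\<lambda>t. iter_deriv vs f (x + t *\<^sub>R v)) field_differentiable (at 0))"

abbreviation partial :: "'d::finite \<Rightarrow> (real^'d \<Rightarrow> real) \<Rightarrow> real^'d \<Rightarrow> real" where
  "partial i \<equiv> dir_deriv (axis i 1)"

text \<open>For a function of two vector arguments, the directions along which the derivatives
  \<open>\<partial>\<^sub>i\<close> (first list) and \<open>\<partial>\<^sub>i\<^sub>+\<^sub>d\<close> (second list) are taken.\<close>

definition kernel_dirs :: "'d::finite list \<Rightarrow> 'd list \<Rightarrow> ((real^'d) \<times> (real^'d)) list" where
  "kernel_dirs is js = map (\<lambda>i. (axis i 1, 0)) is @ map (\<lambda>j. (0, axis j 1)) js"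

definition kderiv ::
  "'d::finite list \<Rightarrow> 'd list \<Rightarrow> ((real^'d) \<times> (real^'d) \<Rightarrow> real) \<Rightarrow> (real^'d) \<times> (real^'d) \<Rightarrow> real" where
  "kderiv is js k = iter_deriv (kernel_dirs is js) k"

definition C1_with_gradient :: "'a::real_inner set \<Rightarrow> ('a \<Rightarrow> real) \<Rightarrow> ('a \<Rightarrow> 'a) \<Rightarrow> bool" where
  "C1_with_gradient S f f' \<longleftrightarrow>
     (\<forall>x\<in>S. (f has_derivative (\<lambda>v. f' x \<bullet> v)) (at x)) \<and> continuous_on S f'"

definition C1_on :: "'a::real_inner set \<Rightarrow> ('a \<Rightarrow> real) \<Rightarrow> bool" where
  "C1_on S f \<longleftrightarrow> (\<exists>f'. C1_with_gradient S f f')"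


section \<open>Continuous extension to the closure\<close>

definition continuously_extendible :: "'a::t2_space set \<Rightarrow> ('a \<Rightarrow> real) \<Rightarrow> bool" where
  "continuously_extendible S f \<longleftrightarrow>
     (\<exists>g. continuous_on (closure S) g \<and> (\<forall>x\<in>S. g x = f x))"

text \<open>On the closure of \<open>S\<close>, this is the (unique) continuous extension whenever \<open>f\<close> is
  continuously extendible.\<close>

definition cont_ext :: "'a::t2_space set \<Rightarrow> ('a \<Rightarrow> real) \<Rightarrow> 'a \<Rightarrow> real" where
  "cont_ext S f x = (if x \<in> S then f x else Lim (at x within S) f)"


section \<open>Piecewise smooth boundary\<close>

text \<open>Sets of \<open>(d - 1)\<close>-dimensional Hausdorff measure zero. The index set \<open>J\<close> may be finite or
  empty; for \<open>d = 1\<close> only the empty set is null.\<close>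

definition codim1_null :: "(real^'d::finite) set \<Rightarrow> bool" where
  "codim1_null N \<longleftrightarrow>
     (\<forall>e>0. \<exists>(J :: nat set) c r.
        N \<subseteq> (\<Union>j\<in>J. ball (c j) (r j)) \<and> (\<forall>j\<in>J. 0 < r j) \<and>
        (\<lambda>j. r j ^ (CARD('d) - 1)) summable_on J \<and>
        (\<Sum>\<^sub>\<infinity>j\<in>J. r j ^ (CARD('d) - 1)) < e)"

text \<open>There is no single agreed definition. The one below is a weak one: apart from a closed
  negligible set of edges, corners and other singular points, the boundary is locally a regular
  level set of a \<open>C\<^sup>1\<close> function. Finite unions of smooth faces meeting along lower-dimensional
  smooth edges satisfy it.\<close>

definition piecewise_smooth_boundary :: "(real^'d::finite) set \<Rightarrow> bool" where
  "piecewise_smooth_boundary \<Omega> \<longleftrightarrow>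
     (\<exists>N. closed N \<and> codim1_null N \<and>
        (\<forall>a \<in> (closure \<Omega> - \<Omega>) - N. \<exists>U g g'. open U \<and> a \<in> U \<and>
           C1_with_gradient U g g' \<and> g' a \<noteq> 0 \<and>
           (closure \<Omega> - \<Omega>) \<inter> U = {x \<in> U. g x = 0}))"


section \<open>Reproducing kernel Hilbert spaces\<close>

text \<open>The Hilbert space is a type \<open>'h\<close>; \<open>\<iota> f\<close> is the function on \<open>\<Omega>\<close> that the element \<open>f\<close>
  stands for, and two elements with the same function on \<open>\<Omega>\<close> are equal.\<close>

definition is_rkhs ::
  "'x set \<Rightarrow> ('h::{real_inner,complete_space} \<Rightarrow> 'x \<Rightarrow> real) \<Rightarrow> ('x \<times> 'x \<Rightarrow> real) \<Rightarrow> bool" where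
  "is_rkhs \<Omega> \<iota> k \<longleftrightarrow>
     (\<forall>x\<in>\<Omega>. linear (\<lambda>f. \<iota> f x)) \<and>
     (\<forall>f g. (\<forall>x\<in>\<Omega>. \<iota> f x = \<iota> g x) \<longrightarrow> f = g) \<and>
     (\<forall>x\<in>\<Omega>. \<exists>h. (\<forall>y\<in>\<Omega>. \<iota> h y = k (x, y)) \<and> (\<forall>f. \<iota> f x = f \<bullet> h))"

text \<open>The element \<open>\<partial>\<^sub>i k(x,\<cdot>)\<close> for \<open>is = [i]\<close>, and \<open>\<partial>\<^sub>i\<^sup>2 k(x,\<cdot>)\<close> for \<open>is = [i, i]\<close>.\<close>

definition kfeat ::
  "(real^'d::finite) set \<Rightarrow> ('h \<Rightarrow> real^'d \<Rightarrow> real) \<Rightarrow> ((real^'d) \<times> (real^'d) \<Rightarrow> real) \<Rightarrow>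
   'd list \<Rightarrow> real^'d \<Rightarrow> 'h" where
  "kfeat \<Omega> \<iota> k is x = (THE h. \<forall>y\<in>\<Omega>. \<iota> h y = kderiv is [] k (x, y))"


section \<open>Operators on a Hilbert space\<close>

definition tensor_op :: "'h::real_inner \<Rightarrow> 'h \<Rightarrow> 'h \<Rightarrow> 'h" where
  "tensor_op u v w = (v \<bullet> w) *\<^sub>R u"

definition orth_proj :: "'h::real_inner set \<Rightarrow> 'h \<Rightarrow> 'h" where
  "orth_proj S f = (THE p. p \<in> S \<and> (\<forall>s\<in>S. (f - p) \<bullet> s = 0))"

text \<open>The power \<open>T\<^sup>\<beta>\<close>, \<open>\<beta> > 0\<close>, of a compact positive self-adjoint operator \<open>T\<close>, from its spectral
  decomposition \<open>T = (\<Sum>\<mu>. \<mu> P\<^sub>\<mu>)\<close> with \<open>P\<^sub>\<mu>\<close> the orthogonal projection onto the eigenspace of \<open>\<mu>\<close>.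
  The sum may run over all \<open>\<mu> > 0\<close>, since \<open>P\<^sub>\<mu> = 0\<close> if \<open>\<mu>\<close> is not an eigenvalue.\<close>

definition op_powr :: "('h::real_inner \<Rightarrow> 'h) \<Rightarrow> real \<Rightarrow> 'h \<Rightarrow> 'h" where
  "op_powr T \<beta> f = (\<Sum>\<^sub>\<infinity>\<mu>\<in>{0<..}. (\<mu> powr \<beta>) *\<^sub>R orth_proj {g. T g = \<mu> *\<^sub>R g} f)"

definition boundedly_invertible :: "('h::real_normed_vector \<Rightarrow> 'h) \<Rightarrow> bool" where
  "boundedly_invertible T \<longleftrightarrow> bij T \<and> bounded_linear (inv T)"


section \<open>The exponential family\<close>

definition prob_density_on :: "('a::euclidean_space) set \<Rightarrow> ('a \<Rightarrow> real) \<Rightarrow> bool" where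
  "prob_density_on \<Omega> q \<longleftrightarrow>
     (\<forall>x\<in>\<Omega>. 0 \<le> q x) \<and> set_integrable lborel \<Omega> q \<and> (LINT x:\<Omega>|lborel. q x) = 1"

definition log_partition ::
  "('a::euclidean_space) set \<Rightarrow> ('a \<Rightarrow> real) \<Rightarrow> ('h \<Rightarrow> 'a \<Rightarrow> real) \<Rightarrow> 'h \<Rightarrow> real" where
  "log_partition \<Omega> q0 \<iota> f = ln (LINT x:\<Omega>|lborel. exp (\<iota> f x) * q0 x)"

definition nat_param_space ::
  "('a::euclidean_space) set \<Rightarrow> ('a \<Rightarrow> real) \<Rightarrow> ('h \<Rightarrow> 'a \<Rightarrow> real) \<Rightarrow> 'h set" where
  "nat_param_space \<Omega> q0 \<iota> = {f. set_integrable lborel \<Omega> (\<lambda>x. exp (\<iota> f x) * q0 x)}"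

definition exp_density ::
  "('a::euclidean_space) set \<Rightarrow> ('a \<Rightarrow> real) \<Rightarrow> ('h \<Rightarrow> 'a \<Rightarrow> real) \<Rightarrow> 'h \<Rightarrow> 'a \<Rightarrow> real" where
  "exp_density \<Omega> q0 \<iota> f x = exp (\<iota> f x - log_partition \<Omega> q0 \<iota> f) * q0 x"


section \<open>The operator C and the estimator\<close>

text \<open>The operator-valued integral is taken pointwise (strongly), as a Bochner integral in \<open>'h\<close>.\<close>

definition score_op ::
  "(real^'d::finite) set \<Rightarrow> ('h::{real_inner,banach,second_countable_topology} \<Rightarrow> real^'d \<Rightarrow> real) \<Rightarrow>
   ((real^'d) \<times> (real^'d) \<Rightarrow> real) \<Rightarrow> (real^'d \<Rightarrow> real) \<Rightarrow> 'h \<Rightarrow> 'h" where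
  "score_op \<Omega> \<iota> k p0 f =
     (LINT x:\<Omega>|lborel. p0 x *\<^sub>R
        (\<Sum>i\<in>UNIV. tensor_op (kfeat \<Omega> \<iota> k [i] x) (kfeat \<Omega> \<iota> k [i] x) f))"

definition emp_score_op ::
  "(real^'d::finite) set \<Rightarrow> ('h::real_inner \<Rightarrow> real^'d \<Rightarrow> real) \<Rightarrow>
   ((real^'d) \<times> (real^'d) \<Rightarrow> real) \<Rightarrow> nat \<Rightarrow> (nat \<Rightarrow> real^'d) \<Rightarrow> 'h \<Rightarrow> 'h" where
  "emp_score_op \<Omega> \<iota> k n X f =
     (1 / real n) *\<^sub>R (\<Sum>a=1..n. \<Sum>i\<in>UNIV.
        tensor_op (kfeat \<Omega> \<iota> k [i] (X a)) (kfeat \<Omega> \<iota> k [i] (X a)) f)"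

definition emp_xi ::
  "(real^'d::finite) set \<Rightarrow> ('h::real_inner \<Rightarrow> real^'d \<Rightarrow> real) \<Rightarrow>
   ((real^'d) \<times> (real^'d) \<Rightarrow> real) \<Rightarrow> (real^'d \<Rightarrow> real) \<Rightarrow> nat \<Rightarrow> (nat \<Rightarrow> real^'d) \<Rightarrow> 'h" where
  "emp_xi \<Omega> \<iota> k q0 n X =
     (1 / real n) *\<^sub>R (\<Sum>a=1..n. \<Sum>i\<in>UNIV.
        partial i (\<lambda>y. ln (q0 y)) (X a) *\<^sub>R kfeat \<Omega> \<iota> k [i] (X a) + kfeat \<Omega> \<iota> k [i, i] (X a))"

definition score_estimator ::
  "(real^'d::finite) set \<Rightarrow> ('h::real_inner \<Rightarrow> real^'d \<Rightarrow> real) \<Rightarrow>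
   ((real^'d) \<times> (real^'d) \<Rightarrow> real) \<Rightarrow> (real^'d \<Rightarrow> real) \<Rightarrow> real \<Rightarrow> nat \<Rightarrow> (nat \<Rightarrow> real^'d) \<Rightarrow> 'h" where
  "score_estimator \<Omega> \<iota> k q0 l n X =
     - inv (\<lambda>g. emp_score_op \<Omega> \<iota> k n X g + l *\<^sub>R g) (emp_xi \<Omega> \<iota> k q0 n X)"


section \<open>The assumptions\<close>

definition assumption_A :: "(real^'d::finite) set \<Rightarrow> bool" where
  "assumption_A \<Omega> \<longleftrightarrow> \<Omega> \<noteq> {} \<and> open \<Omega> \<and> piecewise_smooth_boundary \<Omega>"

text \<open>A multi-index \<open>\<alpha>\<close> with \<open>|\<alpha>| \<le> 2\<close> is the sorted list of length \<open>|\<alpha>|\<close> in which each coordinate \<open>i\<close>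
  occurs \<open>\<alpha>\<^sub>i\<close> times.\<close>

definition assumption_B ::
  "(real, 'd::{finite,linorder}) vec set \<Rightarrow>
   ((real, 'd) vec \<times> (real, 'd) vec \<Rightarrow> real) \<Rightarrow> ((real, 'd) vec \<Rightarrow> real) \<Rightarrow> bool" where
  "assumption_B \<Omega> k p0 \<longleftrightarrow>
     continuously_extendible \<Omega> p0 \<and>
     (\<forall>is. sorted is \<and> length is \<le> 2 \<longrightarrow>
        iter_deriv_exists (\<Omega> \<times> \<Omega>) (kernel_dirs is is) k \<and>
        continuous_on (\<Omega> \<times> \<Omega>) (kderiv is is k) \<and>
        continuously_extendible (\<Omega> \<times> \<Omega>) (kderiv is is k))"

definition assumption_C ::
  "(real^'d::finite) set \<Rightarrow> ((real^'d) \<times> (real^'d) \<Rightarrow> real) \<Rightarrow> (real^'d \<Rightarrow> real) \<Rightarrow> bool" where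
  "assumption_C \<Omega> k p0 \<longleftrightarrow>
     (\<forall>i.
       (\<forall>x \<in> closure \<Omega> - \<Omega>. cont_ext (\<Omega> \<times> \<Omega>) (kderiv [i] [i] k) (x, x) * cont_ext \<Omega> p0 x = 0) \<and>
       (\<lambda>x. sqrt (kderiv [i] [i] k (x, x)) * p0 x)
         \<in> o[inf at_infinity (principal \<Omega>)](\<lambda>x. norm x powr (1 - real CARD('d))))"

definition in_Lp :: "real \<Rightarrow> ('a::euclidean_space) set \<Rightarrow> ('a \<Rightarrow> real) \<Rightarrow> ('a \<Rightarrow> real) \<Rightarrow> bool" where
  "in_Lp \<epsilon> \<Omega> p g \<longleftrightarrow>
     set_borel_measurable lborel \<Omega> g \<and> set_integrable lborel \<Omega> (\<lambda>x. \<bar>g x\<bar> powr \<epsilon> * p x)"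

definition assumption_D ::
  "real \<Rightarrow> (real^'d::finite) set \<Rightarrow> ((real^'d) \<times> (real^'d) \<Rightarrow> real) \<Rightarrow> (real^'d \<Rightarrow> real) \<Rightarrow>
   (real^'d \<Rightarrow> real) \<Rightarrow> bool" where
  "assumption_D \<epsilon> \<Omega> k q0 p0 \<longleftrightarrow>
     C1_on \<Omega> q0 \<and>
     (\<forall>i. in_Lp \<epsilon> \<Omega> p0 (\<lambda>x. kderiv [i] [i] k (x, x)) \<and>
          in_Lp \<epsilon> \<Omega> p0 (\<lambda>x. sqrt (kderiv [i, i] [i, i] k (x, x))) \<and>
          in_Lp \<epsilon> \<Omega> p0 (\<lambda>x. sqrt (kderiv [i] [i] k (x, x)) * partial i (\<lambda>y. ln (q0 y)) x))"


section \<open>Sampling and stochastic convergence\<close>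

text \<open>The sample takes its values in \<open>\<Omega>\<close>, with density \<open>p\<close> with respect to Lebesgue measure
  on \<open>\<Omega>\<close>.\<close>

definition iid_sample ::
  "'w measure \<Rightarrow> ('a::euclidean_space) set \<Rightarrow> ('a \<Rightarrow> real) \<Rightarrow> (nat \<Rightarrow> 'w \<Rightarrow> 'a) \<Rightarrow> bool" where
  "iid_sample M \<Omega> p X \<longleftrightarrow>
     prob_space M \<and>
     prob_space.indep_vars M (\<lambda>_. restrict_space lborel \<Omega>) X {1..} \<and>
     (\<forall>a\<ge>1. distributed M (restrict_space lborel \<Omega>) (X a) (\<lambda>x. ennreal (p x)))"

text \<open>With \<open>outer_measure_of\<close>, which agrees with the measure on measurable sets, a set that is not
  measurable cannot make these conditions hold trivially.\<close>

definition tends_to_0_in_prob :: "'w measure \<Rightarrow> (nat \<Rightarrow> 'w \<Rightarrow> real) \<Rightarrow> bool" where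
  "tends_to_0_in_prob M Y \<longleftrightarrow>
     (\<forall>e>0. (\<lambda>n. outer_measure_of M {\<omega> \<in> space M. e < \<bar>Y n \<omega>\<bar>}) \<longlonglongrightarrow> 0)"

definition bigo_in_prob :: "'w measure \<Rightarrow> (nat \<Rightarrow> 'w \<Rightarrow> real) \<Rightarrow> (nat \<Rightarrow> real) \<Rightarrow> bool" where
  "bigo_in_prob M Y r \<longleftrightarrow>
     (\<forall>\<delta>>0. \<exists>K>0. \<forall>\<^sub>F n in sequentially.
        outer_measure_of M {\<omega> \<in> space M. K * r n < \<bar>Y n \<omega>\<bar>} < ennreal \<delta>)"

end

theory Submission
  imports Defs
begin

text \<open>Write \<open>C\<close> for the population operator, \<open>\<Theta>(x) = \<Sum>\<^sub>i \<partial>\<^sub>ik(x,\<cdot>) \<otimes> \<partial>\<^sub>ik(x,\<cdot>)\<close> for its integrand, and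
\<open>\<zeta>(x) = \<Sum>\<^sub>i (\<partial>\<^sub>i log q\<^sub>0(x) \<partial>\<^sub>ik(x,\<cdot>) + \<partial>\<^sub>i\<^sup>2k(x,\<cdot>)) + \<Theta>(x) f\<^sub>0\<close>. Since \<open>\<langle>f\<^sub>0, \<partial>\<^sub>ik(x,\<cdot>)\<rangle> = \<partial>\<^sub>if\<^sub>0(x)\<close>,
the product \<open>p\<^sub>0(x) \<zeta>(x)\<close> is the divergence of \<open>p\<^sub>0 \<nabla>k(\<cdot>,y)\<close> when it is evaluated at \<open>y\<close>. The field vanishes at the
boundary and at infinity, so \<open>\<zeta>\<close> has mean zero under \<open>p\<^sub>0\<close> (\<open>integral_zeta\<close>). This is the identity
\<open>\<xi> = -C f\<^sub>0\<close> which makes score matching work: without noise, the estimator would be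
\<open>f\<^sub>\<lambda> = (C + \<lambda>)\<^sup>-\<^sup>1 C f\<^sub>0\<close>.

The bias \<open>r = f\<^sub>0 - f\<^sub>\<lambda> = \<lambda>(C + \<lambda>)\<^sup>-\<^sup>1 f\<^sub>0\<close> is deterministic, and elementary algebra gives
\<open>f\<^sub>\<lambda>\<^sub>,\<^sub>n - f\<^sub>\<lambda> = -(C\<^sub>n + \<lambda>)\<^sup>-\<^sup>1 s\<close>, where \<open>C\<^sub>n\<close> is the empirical operator and \<open>s\<close> is the deviation of the sample average of
\<open>\<zeta> - \<Theta> r\<close> from its mean \<open>-C r\<close> (\<open>estimator_error_le\<close>). As \<open>r\<close> is a fixed vector of norm at most \<open>\<parallel>f\<^sub>0\<parallel>\<close>,
the second moment of \<open>s\<close> is \<open>O(1/n)\<close> by independence (\<open>average_deviation\<close>), uniformly in \<open>\<lambda>\<close>, and no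
operator norm has to be estimated. Hence \<open>\<parallel>f\<^sub>\<lambda>\<^sub>,\<^sub>n - f\<^sub>0\<parallel> \<le> \<parallel>r\<parallel> + O\<^sub>p(1 / (\<lambda>\<surd>n))\<close>.

It remains to bound \<open>r\<close>. It tends to zero for \<open>f\<^sub>0\<close> in the closure of the range of \<open>C\<close>
(\<open>tikhonov_resid_tendsto_0\<close>). For \<open>f\<^sub>0 = C\<^sup>\<beta> h\<close> it is \<open>O(\<lambda> powr min 1 \<beta>)\<close> (\<open>norm_tikhonov_resid_powr_le\<close>): distinct eigenspaces are
orthogonal, so Bessel's inequality transfers the scalar bound on \<open>\<lambda>\<mu>\<^sup>\<beta>/(\<mu> + \<lambda>)\<close> to the operator. The
choices of \<open>\<lambda>\<close> in the theorem balance the two terms. If \<open>C\<close> has a bounded inverse, it is bounded below by some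
\<open>c > 0\<close>; being of finite trace, it then lives on a finite-dimensional space, where pointwise convergence on a
basis makes \<open>C\<^sub>n\<close> bounded below by \<open>c/2\<close> with high probability, and the factor \<open>1/\<lambda>\<close> disappears.

Two analytic points need care. The membership of \<open>\<partial>\<^sub>ik(x,\<cdot>)\<close> and \<open>\<partial>\<^sub>i\<^sup>2k(x,\<cdot>)\<close> in the Hilbert space is derived from the
kernel alone: the Gram matrix of the difference quotients converges by the mean value theorem, so the
quotients themselves converge. The divergence theorem is reduced to functions of compact support: the component
\<open>w\<close> of the field is replaced by a truncation of it that is zero wherever \<open>|w|\<close> is small, and the truncation level
tends to zero (\<open>integral_dir_deriv_vanishing_at_boundary\<close>).\<close>

section \<open>Regularised inversion of positive operators\<close>

lemma coercive_lower_bound: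
  fixes T :: "'h::real_inner \<Rightarrow> 'h"
  assumes "0 < c" and "c * (norm x)\<^sup>2 \<le> T x \<bullet> x"
  shows "c * norm x \<le> norm (T x)"
proof (cases "x = 0")
  case False
  have "c * norm x * norm x \<le> norm (T x) * norm x"
    using assms(2) norm_cauchy_schwarz[of "T x" x] by (simp add: power2_eq_square mult.assoc)
  then show ?thesis using False by simp
qed simp

text \<open>Surjectivity is the solvability of \<open>T x = y\<close>: for a small step \<open>\<tau>\<close> the map \<open>x \<mapsto> x - \<tau>(T x - y)\<close> is a
contraction because \<open>T\<close> is coercive and bounded, and its fixed point is a solution.\<close>

lemma coercive_bij:
  fixes T :: "'h::{real_inner,banach} \<Rightarrow> 'h"
  assumes T: "bounded_linear T" and c: "0 < c" and co: "\<And>x. c * (norm x)\<^sup>2 \<le> T x \<bullet> x"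
  shows "bij T"
proof -
  interpret T: bounded_linear T by (fact T)
  have low: "c * norm x \<le> norm (T x)" for x
    by (rule coercive_lower_bound[OF c co])
  have "inj T"
  proof (rule injI)
    fix x y assume "T x = T y"
    then have "c * norm (x - y) \<le> 0" using low[of "x - y"] by (simp add: T.diff)
    then show "x = y" using c by (simp add: mult_le_0_iff)
  qed
  moreover have "\<exists>x. y = T x" for y
  proof -
    obtain L0 where L0: "0 < L0" "\<And>x. norm (T x) \<le> norm x * L0" using T.pos_bounded by blast
    define L where "L = max L0 c"
    have L: "L > 0" "c \<le> L" and TL: "norm (T x) \<le> L * norm x" for x
    proof -
      show "L > 0" "c \<le> L" using L0 c by (auto simp: L_def)
      have "norm x * L0 \<le> norm x * L" by (intro mult_left_mono) (auto simp: L_def)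
      then show "norm (T x) \<le> L * norm x" using L0(2)[of x] by (simp add: mult.commute)
    qed
    \<comment> \<open>The step that minimises the bound \<open>1 - 2\<tau>c + \<tau>\<^sup>2L\<^sup>2\<close> on the squared contraction factor.\<close>
    define \<tau> where "\<tau> = c / L\<^sup>2"
    define q where "q = sqrt (1 - c\<^sup>2 / L\<^sup>2)"
    define g where "g = (\<lambda>x. x - \<tau> *\<^sub>R (T x - y))"
    have c2: "c\<^sup>2 / L\<^sup>2 \<le> 1" "0 < c\<^sup>2 / L\<^sup>2" using c L by (auto simp: power_mono)
    have q: "0 \<le> q" "q < 1" using c2 by (auto simp: q_def intro: real_sqrt_lt_1_iff[THEN iffD2])
    have contr: "norm (x - \<tau> *\<^sub>R T x) \<le> q * norm x" for x
    proof -
      have "(norm (T x))\<^sup>2 \<le> (L * norm x)\<^sup>2" by (rule power_mono[OF TL]) simp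
      then have "\<tau>\<^sup>2 * (norm (T x))\<^sup>2 \<le> \<tau>\<^sup>2 * (L * norm x)\<^sup>2" by (rule mult_left_mono) simp
      also have "\<dots> = c\<^sup>2 / L\<^sup>2 * (norm x)\<^sup>2" using L
        by (simp add: \<tau>_def power_mult_distrib power_divide field_simps eval_nat_numeral)
      finally have a: "\<tau>\<^sup>2 * (norm (T x))\<^sup>2 \<le> c\<^sup>2 / L\<^sup>2 * (norm x)\<^sup>2" .
      have "\<tau> * (c * (norm x)\<^sup>2) \<le> \<tau> * (T x \<bullet> x)" by (rule mult_left_mono[OF co]) (use c in \<open>simp add: \<tau>_def\<close>)
      then have b: "c\<^sup>2 / L\<^sup>2 * (norm x)\<^sup>2 \<le> \<tau> * (T x \<bullet> x)" by (simp add: \<tau>_def power2_eq_square)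
      have "(norm (x - \<tau> *\<^sub>R T x))\<^sup>2 = (norm x)\<^sup>2 - 2 * (\<tau> * (T x \<bullet> x)) + \<tau>\<^sup>2 * (norm (T x))\<^sup>2"
        unfolding power2_norm_eq_inner
        by (simp add: inner_diff_left inner_diff_right inner_commute algebra_simps power2_eq_square)
      also have "\<dots> \<le> (1 - c\<^sup>2 / L\<^sup>2) * (norm x)\<^sup>2" using a b by (simp add: algebra_simps)
      also have "\<dots> = (q * norm x)\<^sup>2" using c2 by (simp add: q_def power_mult_distrib)
      finally show ?thesis by (rule power2_le_imp_le) (use q in simp)
    qed
    have "dist (g x) (g x') \<le> q * dist x x'" for x x'
    proof -
      have "g x - g x' = (x - x') - \<tau> *\<^sub>R T (x - x')"
        by (simp add: g_def T.diff scaleR_diff_right)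
      then show ?thesis using contr[of "x - x'"] by (simp add: dist_norm)
    qed
    then have "\<exists>!x. g x = x" using q by (intro banach_fix_type[of q]) auto
    then obtain x where "g x = x" by auto
    then have "T x = y" using c L by (simp add: g_def \<tau>_def)
    then show "\<exists>x. y = T x" by auto
  qed
  ultimately show ?thesis by (simp add: bij_def surj_def)
qed

lemma coercive_norm_inv_le:
  fixes T :: "'h::{real_inner,banach} \<Rightarrow> 'h"
  assumes T: "bounded_linear T" and c: "0 < c" and co: "\<And>x. c * (norm x)\<^sup>2 \<le> T x \<bullet> x"
  shows "norm (inv T y) \<le> norm y / c"
proof -
  have "T (inv T y) = y" using coercive_bij[OF assms] by (simp add: bij_def surj_f_inv_f)
  then show ?thesis using coercive_lower_bound[of c "inv T y" T, OF c co] c by (simp add: field_simps)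
qed

text \<open>The bias of Tikhonov regularisation: \<open>f - (C + l)\<^sup>-\<^sup>1 C f = l (C + l)\<^sup>-\<^sup>1 f\<close>.\<close>

definition tikhonov_resid :: "('h::real_inner \<Rightarrow> 'h) \<Rightarrow> real \<Rightarrow> 'h \<Rightarrow> 'h" where
  "tikhonov_resid C l f = inv (\<lambda>g. C g + l *\<^sub>R g) (l *\<^sub>R f)"

locale positive_op =
  bounded_linear C for C :: "'h::{real_inner,banach} \<Rightarrow> 'h" +
  assumes positive: "0 \<le> C g \<bullet> g"
begin

lemma regularised:
  assumes "0 < l"
  shows "bounded_linear (\<lambda>g. C g + l *\<^sub>R g)" and "l * (norm g)\<^sup>2 \<le> (C g + l *\<^sub>R g) \<bullet> g"
    and "bij (\<lambda>g. C g + l *\<^sub>R g)" and "norm (inv (\<lambda>g. C g + l *\<^sub>R g) y) \<le> norm y / l"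
proof -
  show 1: "bounded_linear (\<lambda>g. C g + l *\<^sub>R g)"
    by (intro bounded_linear_add bounded_linear_axioms bounded_linear_scaleR_right)
  show 2: "l * (norm g)\<^sup>2 \<le> (C g + l *\<^sub>R g) \<bullet> g" for g
    using positive[of g] by (simp add: inner_add_left power2_norm_eq_inner)
  show "bij (\<lambda>g. C g + l *\<^sub>R g)" "norm (inv (\<lambda>g. C g + l *\<^sub>R g) y) \<le> norm y / l"
    by (rule coercive_bij[OF 1 assms 2], rule coercive_norm_inv_le[OF 1 assms 2])
qed

lemma regularised_inv_eqI:
  assumes "0 < l" and "C g + l *\<^sub>R g = y"
  shows "inv (\<lambda>g. C g + l *\<^sub>R g) y = g"
  using regularised(3)[OF assms(1)] assms(2) by (metis (no_types, lifting) bij_is_inj inv_f_f)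

lemma tikhonov_resid_eq:
  assumes "0 < l" shows "C (tikhonov_resid C l f) + l *\<^sub>R tikhonov_resid C l f = l *\<^sub>R f"
  using surj_f_inv_f[OF bij_is_surj[OF regularised(3)[OF assms]], of "l *\<^sub>R f"]
  by (simp add: tikhonov_resid_def)

lemma tikhonov_resid_eqI:
  assumes "0 < l" and "C g + l *\<^sub>R g = l *\<^sub>R f"
  shows "tikhonov_resid C l f = g"
  unfolding tikhonov_resid_def by (rule regularised_inv_eqI[OF assms])

lemma norm_tikhonov_resid_le:
  assumes "0 < l" shows "norm (tikhonov_resid C l f) \<le> norm f"
  using regularised(4)[OF assms, of "l *\<^sub>R f"] assms by (simp add: tikhonov_resid_def)

lemma bounded_linear_tikhonov_resid:
  assumes "0 < l" shows "bounded_linear (tikhonov_resid C l)"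
proof (rule bounded_linear_intro[where K=1])
  fix f g r
  show "tikhonov_resid C l (f + g) = tikhonov_resid C l f + tikhonov_resid C l g"
  proof (rule tikhonov_resid_eqI[OF assms])
    let ?f = "tikhonov_resid C l f" and ?g = "tikhonov_resid C l g"
    have "C (?f + ?g) + l *\<^sub>R (?f + ?g) = (C ?f + l *\<^sub>R ?f) + (C ?g + l *\<^sub>R ?g)"
      by (simp add: add algebra_simps)
    then show "C (?f + ?g) + l *\<^sub>R (?f + ?g) = l *\<^sub>R (f + g)"
      by (simp only: tikhonov_resid_eq[OF assms] scaleR_add_right)
  qed
  show "tikhonov_resid C l (r *\<^sub>R f) = r *\<^sub>R tikhonov_resid C l f"
    using tikhonov_resid_eq[OF assms, of f]
    by (intro tikhonov_resid_eqI[OF assms]) (simp add: scaleR, metis scaleR_add_right mult.commute scaleR_scaleR)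
  show "norm (tikhonov_resid C l f) \<le> norm f * 1" using norm_tikhonov_resid_le[OF assms] by simp
qed

text \<open>On the range of \<open>C\<close> the inverse of \<open>C + l\<close> is undone: \<open>l (C + l)\<^sup>-\<^sup>1 C h = l (h - l (C + l)\<^sup>-\<^sup>1 h)\<close>, and
\<open>l (C + l)\<^sup>-\<^sup>1\<close> is a contraction.\<close>

lemma norm_tikhonov_resid_range_le:
  assumes "0 < l" shows "norm (tikhonov_resid C l (C h)) \<le> 2 * l * norm h"
proof -
  let ?r = "tikhonov_resid C l h"
  have "tikhonov_resid C l (C h) = l *\<^sub>R (h - ?r)"
    using arg_cong[OF tikhonov_resid_eq[OF assms, of h], of "\<lambda>x. l *\<^sub>R x"]
    by (intro tikhonov_resid_eqI[OF assms]) (simp add: scaleR diff algebra_simps)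
  moreover have "norm (h - ?r) \<le> 2 * norm h"
    using norm_triangle_ineq4[of h ?r] norm_tikhonov_resid_le[OF assms, of h] by simp
  ultimately show ?thesis using assms by simp
qed

text \<open>The residual operators are contractions and tend to zero on the range of \<open>C\<close>, hence also on its closure.\<close>

lemma tikhonov_resid_tendsto_0:
  assumes f: "f \<in> closure (range C)"
    and ls: "\<And>n::nat. 0 < ls n" "ls \<longlonglongrightarrow> 0"
  shows "(\<lambda>n. tikhonov_resid C (ls n) f) \<longlonglongrightarrow> 0"
proof (rule tendstoI)
  fix e :: real assume e: "0 < e"
  obtain h where h: "dist (C h) f < e / 2"
    using f e unfolding closure_approachable by (metis half_gt_zero rangeE)
  have "(\<lambda>n. 2 * ls n * norm h) \<longlonglongrightarrow> 2 * 0 * norm h" by (intro tendsto_intros ls)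
  then have "\<forall>\<^sub>F n in sequentially. 2 * ls n * norm h < e / 2"
    by (rule order_tendstoD) (use e in simp)
  then show "\<forall>\<^sub>F n in sequentially. dist (tikhonov_resid C (ls n) f) 0 < e"
  proof eventually_elim
    case (elim n)
    interpret R: bounded_linear "tikhonov_resid C (ls n)" by (rule bounded_linear_tikhonov_resid[OF ls(1)])
    have "tikhonov_resid C (ls n) f = tikhonov_resid C (ls n) (f - C h) + tikhonov_resid C (ls n) (C h)"
      by (simp flip: R.add)
    then have "norm (tikhonov_resid C (ls n) f) \<le> norm (f - C h) + 2 * ls n * norm h"
      by (metis add_mono norm_tikhonov_resid_le norm_tikhonov_resid_range_le norm_triangle_mono ls(1))
    then show ?case using elim h by (simp add: dist_norm norm_minus_commute)
  qed
qed

end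

text \<open>A minimising sequence for the distance from \<open>f\<close> to \<open>S\<close> is Cauchy by the parallelogram identity, since midpoints stay
in \<open>S\<close>; minimality of the limit forces orthogonality.\<close>

lemma orth_proj_exists:
  fixes S :: "'h::{real_inner,banach} set"
  assumes S: "subspace S" "closed S"
  shows "\<exists>!p. p \<in> S \<and> (\<forall>s\<in>S. (f - p) \<bullet> s = 0)"
proof -
  define d where "d = Inf ((\<lambda>s. (norm (f - s))\<^sup>2) ` S)"
  have bdd: "bdd_below ((\<lambda>s. (norm (f - s))\<^sup>2) ` S)" by (rule bdd_belowI[of _ 0]) auto
  have ne: "(\<lambda>s. (norm (f - s))\<^sup>2) ` S \<noteq> {}" using subspace_0[OF S(1)] by auto
  have d_le: "d \<le> (norm (f - s))\<^sup>2" if "s \<in> S" for s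
    unfolding d_def by (rule cInf_lower[OF _ bdd]) (use that in auto)
  have "\<exists>s\<in>S. (norm (f - s))\<^sup>2 < d + 1 / real (Suc n)" for n
    using cInf_lessD[OF ne, of "d + 1 / real (Suc n)"] by (auto simp: d_def)
  then obtain s where s: "\<And>n. s n \<in> S" "\<And>n. (norm (f - s n))\<^sup>2 < d + 1 / real (Suc n)" by metis
  have para: "(norm (s n - s m))\<^sup>2 \<le> 2 / real (Suc n) + 2 / real (Suc m)" for n m
  proof -
    have "(1/2) *\<^sub>R (s n + s m) \<in> S" using S(1) s by (intro subspace_scale subspace_add) auto
    then have "d \<le> (norm (f - (1/2) *\<^sub>R (s n + s m)))\<^sup>2" by (rule d_le)
    moreover have "(norm (s n - s m))\<^sup>2 = 2 * (norm (f - s n))\<^sup>2 + 2 * (norm (f - s m))\<^sup>2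
        - 4 * (norm (f - (1/2) *\<^sub>R (s n + s m)))\<^sup>2"
      by (simp add: power2_norm_eq_inner inner_diff_left inner_diff_right inner_add_left
          inner_add_right inner_commute algebra_simps)
    ultimately show ?thesis using s(2)[of n] s(2)[of m] by simp
  qed
  have "Cauchy s"
  proof (rule metric_CauchyI)
    fix e :: real assume "0 < e"
    then obtain N where N: "inverse (real (Suc N)) < e\<^sup>2 / 4" using reals_Archimedean[of "e\<^sup>2/4"] by auto
    have "dist (s m) (s n) < e" if "m \<ge> N" "n \<ge> N" for m n
    proof -
      have "1 / real (Suc m) \<le> inverse (real (Suc N))" "1 / real (Suc n) \<le> inverse (real (Suc N))"
        using that by (auto simp: field_simps)
      then have "(norm (s m - s n))\<^sup>2 < e\<^sup>2" using para[of m n] N by simp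
      then show ?thesis unfolding dist_norm using \<open>0 < e\<close> by (auto intro: power2_less_imp_less)
    qed
    then show "\<exists>N. \<forall>m\<ge>N. \<forall>n\<ge>N. dist (s m) (s n) < e" by blast
  qed
  then obtain p where p: "s \<longlonglongrightarrow> p" using Cauchy_convergent_iff convergent_def by blast
  have pS: "p \<in> S" using closed_sequentially[OF S(2) _ p] s by auto
  have "(norm (f - p))\<^sup>2 \<le> d"
  proof (rule LIMSEQ_le)
    show "(\<lambda>n. (norm (f - s n))\<^sup>2) \<longlonglongrightarrow> (norm (f - p))\<^sup>2" by (intro tendsto_intros p)
    show "(\<lambda>n. d + 1 / real (Suc n)) \<longlonglongrightarrow> d"
      using tendsto_add[OF tendsto_const LIMSEQ_inverse_real_of_nat, of d] by (simp add: inverse_eq_divide)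
    show "\<exists>N. \<forall>n\<ge>N. (norm (f - s n))\<^sup>2 \<le> d + 1 / real (Suc n)" using s(2) less_imp_le by blast
  qed
  then have min: "(norm (f - p))\<^sup>2 \<le> (norm (f - x))\<^sup>2" if "x \<in> S" for x by (rule order_trans[OF _ d_le[OF that]])
  have orth: "(f - p) \<bullet> x = 0" if x: "x \<in> S" for x
  proof (cases "x = 0")
    case False
    define t where "t = ((f - p) \<bullet> x) / (x \<bullet> x)"
    have "p + t *\<^sub>R x \<in> S" using S(1) x pS by (intro subspace_scale subspace_add) auto
    then have "(norm (f - p))\<^sup>2 \<le> (norm ((f - p) - t *\<^sub>R x))\<^sup>2"
      using min by (metis diff_diff_add)
    also have "\<dots> = (norm (f - p))\<^sup>2 - 2 * t * ((f - p) \<bullet> x) + t\<^sup>2 * (x \<bullet> x)"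
      unfolding power2_norm_eq_inner
      by (simp add: inner_diff_left[of _ "t *\<^sub>R x"] inner_diff_right[of _ _ "t *\<^sub>R x"] inner_commute
          power2_eq_square algebra_simps)
    also have "t\<^sup>2 * (x \<bullet> x) = t * ((f - p) \<bullet> x)" using False by (simp add: t_def power2_eq_square)
    finally have "t * ((f - p) \<bullet> x) \<le> 0" by simp
    then have "((f - p) \<bullet> x)\<^sup>2 / (x \<bullet> x) \<le> 0" by (simp add: t_def power2_eq_square)
    moreover have "x \<bullet> x > 0" using False by simp
    ultimately show ?thesis by (simp add: divide_le_0_iff)
  qed simp
  show ?thesis
  proof (rule ex1I[of _ p])
    show "p \<in> S \<and> (\<forall>s\<in>S. (f - p) \<bullet> s = 0)" using pS orth by auto
    fix q assume q: "q \<in> S \<and> (\<forall>s\<in>S. (f - q) \<bullet> s = 0)"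
    then have "p - q \<in> S" using pS S(1) by (auto intro: subspace_diff)
    then have "(f - p) \<bullet> (p - q) = 0" "(f - q) \<bullet> (p - q) = 0" using orth q by auto
    then have "(p - q) \<bullet> (p - q) = 0" by (simp add: inner_diff_left)
    then show "q = p" by simp
  qed
qed

lemma orth_proj:
  fixes S :: "'h::{real_inner,banach} set"
  assumes "subspace S" "closed S"
  shows "orth_proj S f \<in> S" and "s \<in> S \<Longrightarrow> (f - orth_proj S f) \<bullet> s = 0"
  using theI'[OF orth_proj_exists[OF assms, of f]] by (auto simp: orth_proj_def)

lemma norm_sum_orthogonal:
  fixes v :: "'i \<Rightarrow> 'h::real_inner"
  assumes "finite F" and "\<And>i j. i \<in> F \<Longrightarrow> j \<in> F \<Longrightarrow> i \<noteq> j \<Longrightarrow> v i \<bullet> v j = 0"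
  shows "(norm (\<Sum>i\<in>F. v i))\<^sup>2 = (\<Sum>i\<in>F. (norm (v i))\<^sup>2)"
proof -
  have "(norm (\<Sum>i\<in>F. v i))\<^sup>2 = (\<Sum>i\<in>F. \<Sum>j\<in>F. v i \<bullet> v j)"
    by (simp add: power2_norm_eq_inner inner_sum_left inner_sum_right) (rule sum.swap)
  also have "\<dots> = (\<Sum>i\<in>F. \<Sum>j\<in>F. if i = j then v i \<bullet> v i else 0)"
    by (intro sum.cong refl) (auto simp: assms)
  also have "\<dots> = (\<Sum>i\<in>F. (norm (v i))\<^sup>2)" using assms(1) by (simp add: power2_norm_eq_inner)
  finally show ?thesis .
qed

lemma bessel_ineq:
  fixes v :: "'i \<Rightarrow> 'h::real_inner"
  assumes F: "finite F" and orth: "\<And>i j. i \<in> F \<Longrightarrow> j \<in> F \<Longrightarrow> i \<noteq> j \<Longrightarrow> v i \<bullet> v j = 0"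
    and proj: "\<And>i. i \<in> F \<Longrightarrow> h \<bullet> v i = (norm (v i))\<^sup>2"
  shows "(\<Sum>i\<in>F. (norm (v i))\<^sup>2) \<le> (norm h)\<^sup>2"
proof -
  let ?s = "\<Sum>i\<in>F. v i"
  have "h \<bullet> ?s = (norm ?s)\<^sup>2" by (simp add: inner_sum_right proj norm_sum_orthogonal[OF F orth])
  then have "(norm (h - ?s))\<^sup>2 = (norm h)\<^sup>2 - (norm ?s)\<^sup>2"
    by (simp add: power2_norm_eq_inner inner_diff_left inner_diff_right inner_commute)
  then have "(norm ?s)\<^sup>2 \<le> (norm h)\<^sup>2" using zero_le_power2[of "norm (h - ?s)"] by linarith
  then show ?thesis by (simp add: norm_sum_orthogonal[OF F orth])
qed

text \<open>For \<open>\<beta> \<le> 1\<close> use \<open>\<mu>\<^sup>\<beta> l\<^sup>1\<^sup>-\<^sup>\<beta> \<le> \<mu> + l\<close>. For \<open>\<beta> > 1\<close> the saturated rate \<open>l\<close> remains, and \<open>\<mu>\<^sup>\<beta>\<^sup>-\<^sup>1\<close> is bounded because the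
eigenvalues are.\<close>

lemma tikhonov_filter_le:
  fixes l \<mu> \<beta> B :: real
  assumes l: "0 < l" and mu: "0 < \<mu>" "\<mu> \<le> B" and b: "0 < \<beta>"
  shows "l / (\<mu> + l) * \<mu> powr \<beta> \<le> max 1 (B powr (\<beta> - 1)) * l powr (min 1 \<beta>)"
proof (cases "\<beta> \<le> 1")
  case True
  have "\<mu> powr \<beta> * l powr (1 - \<beta>) \<le> (\<mu> + l) powr \<beta> * (\<mu> + l) powr (1 - \<beta>)"
    using l mu b True by (intro mult_mono powr_mono2) auto
  also have "\<dots> = \<mu> + l" using l mu by (simp flip: powr_add)
  finally have "l powr \<beta> * (\<mu> powr \<beta> * l powr (1 - \<beta>)) \<le> l powr \<beta> * (\<mu> + l)" by (rule mult_left_mono) simp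
  moreover have "l powr \<beta> * (\<mu> powr \<beta> * l powr (1 - \<beta>)) = l * \<mu> powr \<beta>"
    using l by (simp add: powr_add[symmetric] algebra_simps flip: mult.assoc)
  ultimately have "l / (\<mu> + l) * \<mu> powr \<beta> \<le> 1 * l powr \<beta>" using l mu by (simp add: field_simps)
  also have "\<dots> \<le> max 1 (B powr (\<beta> - 1)) * l powr \<beta>" by (rule mult_right_mono) auto
  finally show ?thesis using True by (simp add: min_def)
next
  case False
  have "l / (\<mu> + l) * \<mu> powr \<beta> \<le> l / \<mu> * \<mu> powr \<beta>"
    using l mu by (intro mult_right_mono divide_left_mono) auto
  also have "\<dots> = l * \<mu> powr (\<beta> - 1)" using mu by (simp add: powr_diff)
  also have "\<dots> \<le> l * max 1 (B powr (\<beta> - 1))"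
    using l mu False powr_mono2[of "\<beta> - 1" \<mu> B] by (intro mult_left_mono) auto
  finally show ?thesis using False l by (simp add: min_def mult.commute)
qed

locale selfadjoint_positive_op = positive_op C for C :: "'h::{real_inner,banach} \<Rightarrow> 'h" +
  assumes selfadjoint: "C g \<bullet> h = g \<bullet> C h"
begin

abbreviation eigenspace :: "real \<Rightarrow> 'h set" where "eigenspace \<mu> \<equiv> {g. C g = \<mu> *\<^sub>R g}"

lemma eigenspace_closed_subspace: "subspace (eigenspace \<mu>)" "closed (eigenspace \<mu>)"
proof -
  show "subspace (eigenspace \<mu>)"
    by (auto simp: subspace_def zero add scaleR algebra_simps)
  show "closed (eigenspace \<mu>)"
    by (intro closed_Collect_eq continuous_intros continuous_on)
qed

lemma eigenspaces_orthogonal: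
  assumes "C g = \<mu> *\<^sub>R g" "C h = \<nu> *\<^sub>R h" "\<mu> \<noteq> \<nu>" shows "g \<bullet> h = 0"
proof -
  have "\<mu> * (g \<bullet> h) = \<nu> * (g \<bullet> h)" using selfadjoint[of g h] assms by simp
  then show ?thesis using assms(3) by simp
qed

text \<open>On the eigenspace of \<open>\<mu>\<close> the residual operator is multiplication by \<open>l/(\<mu> + l)\<close>. The summands
\<open>\<mu>\<^sup>\<beta> P\<^sub>\<mu> h\<close> of \<open>C\<^sup>\<beta> h\<close> are mutually orthogonal and \<open>\<Sum> \<parallel>P\<^sub>\<mu> h\<parallel>\<^sup>2 \<le> \<parallel>h\<parallel>\<^sup>2\<close>, so a bound on the scalar filter carries over to
every finite partial sum and to the limit.\<close>

lemma norm_tikhonov_resid_powr_le: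
  assumes b: "0 < \<beta>" and f: "f \<in> range (op_powr C \<beta>)"
  obtains D where "0 < D" "\<And>l. 0 < l \<Longrightarrow> norm (tikhonov_resid C l f) \<le> D * l powr (min 1 \<beta>)"
proof -
  obtain h where h: "f = op_powr C \<beta> h" using f by auto
  define P where "P \<mu> = orth_proj (eigenspace \<mu>) h" for \<mu>
  have CP: "C (P \<mu>) = \<mu> *\<^sub>R P \<mu>" for \<mu>
    using orth_proj(1)[OF eigenspace_closed_subspace, of \<mu> h] by (simp add: P_def)
  have hP: "h \<bullet> P \<mu> = (norm (P \<mu>))\<^sup>2" for \<mu>
    using orth_proj(2)[OF eigenspace_closed_subspace, of "P \<mu>" \<mu> h] CP
    by (simp add: P_def inner_diff_left power2_norm_eq_inner)
  have orth: "P \<mu> \<bullet> P \<nu> = 0" if "\<mu> \<noteq> \<nu>" for \<mu> \<nu>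
    by (rule eigenspaces_orthogonal[OF CP CP that])
  obtain B where B: "0 < B" "\<And>x. norm (C x) \<le> norm x * B" using pos_bounded by blast
  have muB: "\<mu> \<le> B" if "P \<mu> \<noteq> 0" "0 < \<mu>" for \<mu>
    using B(2)[of "P \<mu>"] that by (simp add: CP mult.commute)
  define D where "D = max 1 (B powr (\<beta> - 1)) * norm h + 1"
  have "norm (tikhonov_resid C l f) \<le> D * l powr (min 1 \<beta>)" if l: "0 < l" for l
  proof -
    define m where "m = max 1 (B powr (\<beta> - 1)) * l powr (min 1 \<beta>)"
    have m0: "0 \<le> m" by (simp add: m_def)
    have "norm (tikhonov_resid C l f) \<le> m * norm h"
    \<comment> \<open>An infinite sum that does not converge has the value \<open>0\<close> by convention.\<close>
    proof (cases "(\<lambda>\<mu>. \<mu> powr \<beta> *\<^sub>R P \<mu>) summable_on {0<..}")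
      case False
      then have "f = 0" by (simp add: h op_powr_def P_def infsum_not_exists)
      then show ?thesis using norm_tikhonov_resid_le[OF l, of f] m0 by simp
    next
      case True
      interpret R: bounded_linear "tikhonov_resid C l" by (rule bounded_linear_tikhonov_resid[OF l])
      have RP: "tikhonov_resid C l (\<mu> powr \<beta> *\<^sub>R P \<mu>) = (l / (\<mu> + l) * \<mu> powr \<beta>) *\<^sub>R P \<mu>" if "0 < \<mu>" for \<mu>
      proof (rule tikhonov_resid_eqI[OF l])
        let ?a = "l / (\<mu> + l) * \<mu> powr \<beta>"
        have "?a * \<mu> + l * ?a = ?a * (\<mu> + l)" by (simp only: distrib_left mult.commute[of l])
        also have "\<dots> = l * \<mu> powr \<beta>" using l that by simp
        finally show "C ((l / (\<mu> + l) * \<mu> powr \<beta>) *\<^sub>R P \<mu>) + l *\<^sub>R (l / (\<mu> + l) * \<mu> powr \<beta>) *\<^sub>R P \<mu> = l *\<^sub>R \<mu> powr \<beta> *\<^sub>R P \<mu>"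
          unfolding scaleR CP scaleR_scaleR by (simp flip: scaleR_add_left)
      qed
      have "((\<lambda>\<mu>. \<mu> powr \<beta> *\<^sub>R P \<mu>) has_sum f) {0<..}"
        using True by (simp add: h op_powr_def P_def)
      then have "((\<lambda>\<mu>. tikhonov_resid C l (\<mu> powr \<beta> *\<^sub>R P \<mu>)) has_sum tikhonov_resid C l f) {0<..}"
        by (rule has_sum_bounded_linear[OF R.bounded_linear_axioms])
      then have lim: "((\<lambda>F. norm (\<Sum>\<mu>\<in>F. tikhonov_resid C l (\<mu> powr \<beta> *\<^sub>R P \<mu>))) \<longlongrightarrow> norm (tikhonov_resid C l f))
          (finite_subsets_at_top {0<..})"
        unfolding has_sum_def by (rule tendsto_norm)
      have "norm (\<Sum>\<mu>\<in>F. tikhonov_resid C l (\<mu> powr \<beta> *\<^sub>R P \<mu>)) \<le> m * norm h"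
        if F: "finite F" "F \<subseteq> {0<..}" for F
      proof -
        have "norm (tikhonov_resid C l (\<mu> powr \<beta> *\<^sub>R P \<mu>)) \<le> m * norm (P \<mu>)" if "\<mu> \<in> F" for \<mu>
        proof (cases "P \<mu> = 0")
          case False
          have mu: "0 < \<mu>" using that F by auto
          have "norm (tikhonov_resid C l (\<mu> powr \<beta> *\<^sub>R P \<mu>)) = l / (\<mu> + l) * \<mu> powr \<beta> * norm (P \<mu>)"
            unfolding RP[OF mu] norm_scaleR using mu l by simp
          then show ?thesis
            unfolding m_def using mult_right_mono[OF tikhonov_filter_le[OF l mu muB[OF False mu] b] norm_ge_zero]
            by simp
        qed (simp add: R.zero)
        then have "(norm (tikhonov_resid C l (\<mu> powr \<beta> *\<^sub>R P \<mu>)))\<^sup>2 \<le> m\<^sup>2 * (norm (P \<mu>))\<^sup>2" if "\<mu> \<in> F" for \<mu>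
          using power_mono[of _ "m * norm (P \<mu>)" 2] that by (simp add: power_mult_distrib)
        moreover have "(norm (\<Sum>\<mu>\<in>F. tikhonov_resid C l (\<mu> powr \<beta> *\<^sub>R P \<mu>)))\<^sup>2 =
            (\<Sum>\<mu>\<in>F. (norm (tikhonov_resid C l (\<mu> powr \<beta> *\<^sub>R P \<mu>)))\<^sup>2)"
        proof (rule norm_sum_orthogonal[OF F(1)])
          fix i j assume ij: "i \<in> F" "j \<in> F" "i \<noteq> j"
          then have "0 < i" "0 < j" using F by auto
          then show "tikhonov_resid C l (i powr \<beta> *\<^sub>R P i) \<bullet> tikhonov_resid C l (j powr \<beta> *\<^sub>R P j) = 0"
            using ij by (simp add: RP orth)
        qed
        ultimately have "(norm (\<Sum>\<mu>\<in>F. tikhonov_resid C l (\<mu> powr \<beta> *\<^sub>R P \<mu>)))\<^sup>2 \<le> (\<Sum>\<mu>\<in>F. m\<^sup>2 * (norm (P \<mu>))\<^sup>2)"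
          by (simp add: sum_mono)
        also have "\<dots> = m\<^sup>2 * (\<Sum>\<mu>\<in>F. (norm (P \<mu>))\<^sup>2)" by (simp add: sum_distrib_left)
        also have "\<dots> \<le> m\<^sup>2 * (norm h)\<^sup>2"
          by (intro mult_left_mono bessel_ineq[OF F(1)] orth hP) simp_all
        finally have "(norm (\<Sum>\<mu>\<in>F. tikhonov_resid C l (\<mu> powr \<beta> *\<^sub>R P \<mu>)))\<^sup>2 \<le> (m * norm h)\<^sup>2"
          by (simp add: power_mult_distrib)
        then show ?thesis by (rule power2_le_imp_le) (simp add: m0)
      qed
      then have "\<forall>\<^sub>F F in finite_subsets_at_top {0<..}. norm (\<Sum>\<mu>\<in>F. tikhonov_resid C l (\<mu> powr \<beta> *\<^sub>R P \<mu>)) \<le> m * norm h"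
        by (rule eventually_finite_subsets_at_top_weakI)
      then show ?thesis by (intro tendsto_upperbound[OF lim]) auto
    qed
    also have "\<dots> \<le> D * l powr (min 1 \<beta>)" by (simp add: m_def D_def algebra_simps)
    finally show ?thesis .
  qed
  moreover have "0 < D" by (simp add: D_def add_nonneg_pos)
  ultimately show thesis using that by blast
qed

text \<open>The discriminant of the nonnegative quadratic \<open>t \<mapsto> \<langle>C(g - t h), g - t h\<rangle>\<close> is not positive.\<close>

lemma form_cauchy_schwarz: "(C g \<bullet> h)\<^sup>2 \<le> (C g \<bullet> g) * (C h \<bullet> h)"
proof -
  have quad: "0 \<le> (C g \<bullet> g) - 2 * t * (C g \<bullet> h) + t\<^sup>2 * (C h \<bullet> h)" for t
  proof -
    have "(C (g - t *\<^sub>R h)) \<bullet> (g - t *\<^sub>R h) = (C g \<bullet> g) - t * (C g \<bullet> h) - t * (C h \<bullet> g) + t\<^sup>2 * (C h \<bullet> h)"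
      by (simp add: diff scaleR inner_diff_left inner_diff_right power2_eq_square algebra_simps)
    moreover have "C h \<bullet> g = C g \<bullet> h" using selfadjoint[of h g] by (simp add: inner_commute)
    ultimately show ?thesis using positive[of "g - t *\<^sub>R h"] by (simp add: algebra_simps)
  qed
  show ?thesis
  proof (cases "C h \<bullet> h = 0")
    case True
    have "C g \<bullet> h = 0"
    proof (rule ccontr)
      assume n: "C g \<bullet> h \<noteq> 0"
      show False using quad[of "((C g \<bullet> g) + 1) / (2 * (C g \<bullet> h))"] n True by simp
    qed
    then show ?thesis using True by simp
  next
    case False
    then have p: "0 < C h \<bullet> h" using positive[of h] by simp
    have "0 \<le> (C g \<bullet> g) - (C g \<bullet> h)\<^sup>2 / (C h \<bullet> h)"
      using quad[of "(C g \<bullet> h) / (C h \<bullet> h)"] False by (simp add: power2_eq_square field_simps)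
    then show ?thesis using p by (simp add: field_simps)
  qed
qed

text \<open>Cauchy-Schwarz for the form of \<open>C\<close>, applied to \<open>g\<close> and \<open>C g\<close>, gives \<open>\<parallel>C g\<parallel>\<^sup>2 \<le> \<parallel>C\<parallel> \<langle>C g, g\<rangle>\<close>, while
\<open>\<parallel>g\<parallel> \<le> \<parallel>C\<^sup>-\<^sup>1\<parallel> \<parallel>C g\<parallel>\<close>.\<close>

lemma boundedly_invertible_coercive:
  assumes "boundedly_invertible C"
  obtains c where "0 < c" "\<And>g. c * (norm g)\<^sup>2 \<le> C g \<bullet> g"
proof -
  have bij: "bij C" and inv: "bounded_linear (inv C)" using assms by (auto simp: boundedly_invertible_def)
  obtain K where K: "0 < K" "\<And>x. norm (inv C x) \<le> norm x * K" using bounded_linear.pos_bounded[OF inv] by blast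
  obtain B where B: "0 < B" "\<And>x. norm (C x) \<le> norm x * B" using pos_bounded by blast
  have "1 / (K\<^sup>2 * B) * (norm g)\<^sup>2 \<le> C g \<bullet> g" for g
  proof -
    have nK: "norm g \<le> norm (C g) * K" using K(2)[of "C g"] bij by (simp add: bij_def)
    have "((norm (C g))\<^sup>2)\<^sup>2 \<le> (C g \<bullet> g) * (C (C g) \<bullet> C g)"
      using form_cauchy_schwarz[of g "C g"] by (simp add: power2_norm_eq_inner)
    also have "\<dots> \<le> (C g \<bullet> g) * (B * (norm (C g))\<^sup>2)"
    proof (intro mult_left_mono positive)
      have "C (C g) \<bullet> C g \<le> norm (C (C g)) * norm (C g)" by (rule norm_cauchy_schwarz)
      also have "\<dots> \<le> norm (C g) * B * norm (C g)" by (intro mult_right_mono B) simp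
      finally show "C (C g) \<bullet> C g \<le> B * (norm (C g))\<^sup>2" by (simp add: power2_eq_square mult_ac)
    qed
    finally have *: "(norm (C g))\<^sup>2 * (norm (C g))\<^sup>2 \<le> ((C g \<bullet> g) * B) * (norm (C g))\<^sup>2"
      by (simp add: power2_eq_square mult_ac)
    have "(norm (C g))\<^sup>2 \<le> (C g \<bullet> g) * B"
    proof (cases "C g = 0")
      case False
      then have "0 < (norm (C g))\<^sup>2" by simp
      with * show ?thesis by (rule mult_right_le_imp_le)
    qed simp
    moreover have "(norm g)\<^sup>2 \<le> (norm (C g))\<^sup>2 * K\<^sup>2"
      using power_mono[OF nK, of 2] by (simp add: power_mult_distrib)
    ultimately have "(norm g)\<^sup>2 \<le> (C g \<bullet> g) * B * K\<^sup>2"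
      by (meson mult_right_mono order_trans zero_le_power2)
    then show ?thesis using K B by (simp add: field_simps)
  qed
  moreover have "0 < 1 / (K\<^sup>2 * B)" using K B by simp
  ultimately show thesis using that by blast
qed

end

definition orthonormal :: "'h::real_inner set \<Rightarrow> bool" where
  "orthonormal E \<longleftrightarrow> (\<forall>e\<in>E. norm e = 1) \<and> (\<forall>e\<in>E. \<forall>e'\<in>E. e \<noteq> e' \<longrightarrow> e \<bullet> e' = 0)"

lemma orthonormal_bessel:
  assumes "finite E" "orthonormal E"
  shows "(\<Sum>e\<in>E. (h \<bullet> e)\<^sup>2) \<le> (norm h)\<^sup>2"
  using bessel_ineq[OF assms(1), of "\<lambda>e. (h \<bullet> e) *\<^sub>R e" h] assms(2)
  by (auto simp: orthonormal_def power2_eq_square)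

text \<open>An orthonormal set of maximal cardinality spans: otherwise the normalised residual of some vector would
extend it.\<close>

lemma finite_orthonormal_basis:
  fixes m :: nat
  assumes bound: "\<And>E :: ('h::real_inner) set. finite E \<Longrightarrow> orthonormal E \<Longrightarrow> card E \<le> m"
  obtains E :: "('h::real_inner) set" where "finite E" "orthonormal E" "\<And>h. h = (\<Sum>e\<in>E. (h \<bullet> e) *\<^sub>R e)"
proof -
  define Q :: "'h set \<Rightarrow> bool" where "Q E \<longleftrightarrow> finite E \<and> orthonormal E" for E
  have "\<forall>E. Q E \<longrightarrow> card E < Suc m" using bound by (auto simp: Q_def less_Suc_eq_le)
  moreover have "Q {}" by (simp add: Q_def orthonormal_def)
  ultimately obtain E where E: "Q E" "\<forall>E'. Q E' \<longrightarrow> card E' \<le> card E"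
    using Lattices_Big.ex_has_greatest_nat[of Q "{}" card "Suc m"] by auto
  have max: "card E' \<le> card E" if "finite E'" "orthonormal E'" for E' :: "'h set" using E(2) that by (simp add: Q_def)
  have E: "finite E" "orthonormal E" using E(1) by (simp_all add: Q_def)
  have "h = (\<Sum>e\<in>E. (h \<bullet> e) *\<^sub>R e)" for h
  proof (rule ccontr)
    define r where "r = h - (\<Sum>e\<in>E. (h \<bullet> e) *\<^sub>R e)"
    assume "h \<noteq> (\<Sum>e\<in>E. (h \<bullet> e) *\<^sub>R e)"
    then have r0: "r \<noteq> 0" by (simp add: r_def)
    have re: "r \<bullet> e = 0" if "e \<in> E" for e
    proof -
      have "(\<Sum>e'\<in>E. (h \<bullet> e') * (e' \<bullet> e)) = (\<Sum>e'\<in>E. if e' = e then h \<bullet> e else 0)"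
        using E(2) that by (intro sum.cong refl) (auto simp: orthonormal_def norm_eq_1)
      then show ?thesis using E(1) that by (simp add: r_def inner_diff_left inner_sum_left)
    qed
    have "sgn r \<notin> E" using re[of "sgn r"] r0 by (auto simp: sgn_div_norm)
    moreover have "orthonormal (insert (sgn r) E)"
      using E(2) re r0 by (auto simp: orthonormal_def norm_sgn sgn_div_norm inner_commute)
    then have "card (insert (sgn r) E) \<le> card E" using E(1) by (intro max) auto
    ultimately show False using E(1) by simp
  qed
  then show thesis using that E by blast
qed


section \<open>Derivative features of a reproducing kernel\<close>

lemma mvt_increment:
  fixes f f' :: "real \<Rightarrow> real"
  assumes der: "\<And>u. \<bar>u\<bar> \<le> \<bar>t\<bar> \<Longrightarrow> ((\<lambda>s. f (a + s)) has_real_derivative f' u) (at u)"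
  shows "\<exists>\<xi>. \<bar>\<xi>\<bar> \<le> \<bar>t\<bar> \<and> f (a + t) - f a = t * f' \<xi>"
proof -
  consider "t = 0" | "0 < t" | "t < 0" by linarith
  then show ?thesis
  proof cases
    case 1 then show ?thesis by auto
  next
    case 2
    have "\<exists>z>0. z < t \<and> f (a + t) - f (a + 0) = (t - 0) * f' z"
      by (rule MVT2[OF 2]) (use 2 in \<open>auto intro!: der\<close>)
    then obtain z where "0 < z" "z < t" "f (a + t) - f a = t * f' z" by auto
    then show ?thesis by (intro exI[of _ z]) auto
  next
    case 3
    have "\<exists>z>t. z < 0 \<and> f (a + 0) - f (a + t) = (0 - t) * f' z"
      by (rule MVT2[OF 3]) (use 3 in \<open>auto intro!: der\<close>)
    then obtain z where "t < z" "z < 0" "f a - f (a + t) = - (t * f' z)" by auto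
    then show ?thesis by (intro exI[of _ z]) auto
  qed
qed

lemma has_real_derivative_shift:
  "((\<lambda>s. f (a + s)) has_real_derivative D) (at u) \<longleftrightarrow> (f has_real_derivative D) (at (a + u))"
  using DERIV_shift[of f D u a] by (simp add: add.commute)

lemma line_derivI:
  fixes x e :: "'x::real_vector"
  assumes "((\<lambda>t. g ((x + s *\<^sub>R e) + t *\<^sub>R e)) has_real_derivative D) (at 0)"
  shows "((\<lambda>t. g (x + t *\<^sub>R e)) has_real_derivative D) (at s)"
proof -
  have "((\<lambda>t. g ((x + s *\<^sub>R e) + (t - s) *\<^sub>R e)) has_real_derivative D * 1) (at s)"
    by (rule DERIV_chain2[where f="\<lambda>t. g ((x + s *\<^sub>R e) + t *\<^sub>R e)" and g="\<lambda>t. t - s"])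
       (use assms in \<open>auto intro!: derivative_eq_intros\<close>)
  moreover have "x + s *\<^sub>R e + (t - s) *\<^sub>R e = x + t *\<^sub>R e" for t by (simp add: algebra_simps)
  ultimately show ?thesis by simp
qed

lemma iter_deriv_line:
  assumes "iter_deriv_exists S (v # vs) f" "z + s *\<^sub>R v \<in> S"
  shows "((\<lambda>t. iter_deriv vs f (z + t *\<^sub>R v)) has_real_derivative iter_deriv (v # vs) f (z + s *\<^sub>R v)) (at s)"
proof (rule line_derivI)
  show "((\<lambda>t. iter_deriv vs f (z + s *\<^sub>R v + t *\<^sub>R v)) has_real_derivative iter_deriv (v # vs) f (z + s *\<^sub>R v)) (at 0)"
    using assms by (simp add: dir_deriv_def DERIV_deriv_iff_field_differentiable)
qed

lemma double_difference_mvt: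
  fixes F :: "real \<Rightarrow> real \<Rightarrow> real"
  assumes Fv: "\<And>u v. \<bar>u\<bar> < r \<Longrightarrow> \<bar>v\<bar> < r \<Longrightarrow> ((\<lambda>v. F u v) has_real_derivative Fv u v) (at v)"
    and Fuv: "\<And>u v. \<bar>u\<bar> < r \<Longrightarrow> \<bar>v\<bar> < r \<Longrightarrow> ((\<lambda>u. Fv u v) has_real_derivative Fuv u v) (at u)"
    and t: "\<bar>t\<bar> < r" and s: "\<bar>s\<bar> < r"
  shows "\<exists>t' s'. \<bar>t'\<bar> \<le> \<bar>t\<bar> \<and> \<bar>s'\<bar> \<le> \<bar>s\<bar> \<and> F t s - F 0 s - (F t 0 - F 0 0) = t * s * Fuv t' s'"
proof -
  have r: "\<bar>0::real\<bar> < r" using t by linarith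
  have "\<exists>\<xi>. \<bar>\<xi>\<bar> \<le> \<bar>s\<bar> \<and> (F t (0 + s) - F 0 (0 + s)) - (F t 0 - F 0 0) = s * (Fv t \<xi> - Fv 0 \<xi>)"
  proof (rule mvt_increment)
    fix v assume "\<bar>v\<bar> \<le> \<bar>s\<bar>"
    then have "\<bar>v\<bar> < r" using s by linarith
    then show "((\<lambda>s. F t (0 + s) - F 0 (0 + s)) has_real_derivative Fv t v - Fv 0 v) (at v)"
      unfolding add_0 by (intro DERIV_diff Fv t r)
  qed
  then obtain s' where s': "\<bar>s'\<bar> \<le> \<bar>s\<bar>"
    "(F t s - F 0 s) - (F t 0 - F 0 0) = s * (Fv t s' - Fv 0 s')" by auto
  have "\<exists>\<xi>. \<bar>\<xi>\<bar> \<le> \<bar>t\<bar> \<and> Fv (0 + t) s' - Fv 0 s' = t * Fuv \<xi> s'"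
  proof (rule mvt_increment)
    fix u assume "\<bar>u\<bar> \<le> \<bar>t\<bar>"
    then show "((\<lambda>u. Fv (0 + u) s') has_real_derivative Fuv u s') (at u)"
      unfolding add_0 using s' s t by (intro Fuv) linarith+
  qed
  then obtain t' where "\<bar>t'\<bar> \<le> \<bar>t\<bar>" "Fv t s' - Fv 0 s' = t * Fuv t' s'" by auto
  then show ?thesis using s' by (metis mult.assoc mult.commute)
qed

text \<open>The second difference is the increment of \<open>s \<mapsto> f(t + s) - f(s)\<close> from \<open>0\<close> to \<open>t\<close>. Only one derivative of \<open>f\<close> enters,
so the lemma also serves where the second derivative is known at a single point.\<close>

lemma second_difference_mvt_gen:
  fixes f f' :: "real \<Rightarrow> real"
  assumes f: "\<And>u. \<bar>u\<bar> \<le> 2 * \<bar>t\<bar> \<Longrightarrow> (f has_real_derivative f' u) (at u)"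
  shows "\<exists>\<xi>. \<bar>\<xi>\<bar> \<le> \<bar>t\<bar> \<and> f (2 * t) - 2 * f t + f 0 = t * (f' (t + \<xi>) - f' \<xi>)"
proof -
  have "\<exists>\<xi>. \<bar>\<xi>\<bar> \<le> \<bar>t\<bar> \<and> (\<lambda>s. f (t + s) - f s) (0 + t) - (\<lambda>s. f (t + s) - f s) 0 = t * (f' (t + \<xi>) - f' \<xi>)"
  proof (rule mvt_increment)
    fix u assume "\<bar>u\<bar> \<le> \<bar>t\<bar>"
    then have "\<bar>t + u\<bar> \<le> 2 * \<bar>t\<bar>" "\<bar>u\<bar> \<le> 2 * \<bar>t\<bar>" by linarith+
    then show "((\<lambda>s. f (t + (0 + s)) - f (0 + s)) has_real_derivative f' (t + u) - f' u) (at u)"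
      unfolding add_0 by (intro DERIV_diff f has_real_derivative_shift[THEN iffD2])
  qed
  then show ?thesis by (simp add: mult_2 algebra_simps)
qed

lemma second_difference_mvt:
  fixes f f' f'' :: "real \<Rightarrow> real"
  assumes f: "\<And>u. \<bar>u\<bar> \<le> 2 * \<bar>t\<bar> \<Longrightarrow> (f has_real_derivative f' u) (at u)"
    and f': "\<And>u. \<bar>u\<bar> \<le> 2 * \<bar>t\<bar> \<Longrightarrow> (f' has_real_derivative f'' u) (at u)"
  shows "\<exists>\<xi>. \<bar>\<xi>\<bar> \<le> 2 * \<bar>t\<bar> \<and> f (2 * t) - 2 * f t + f 0 = t\<^sup>2 * f'' \<xi>"
proof -
  obtain \<xi> where xi: "\<bar>\<xi>\<bar> \<le> \<bar>t\<bar>" "f (2 * t) - 2 * f t + f 0 = t * (f' (t + \<xi>) - f' \<xi>)"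
    using second_difference_mvt_gen[OF f] by blast
  have "\<exists>\<eta>. \<bar>\<eta>\<bar> \<le> \<bar>t\<bar> \<and> f' (\<xi> + t) - f' \<xi> = t * f'' (\<xi> + \<eta>)"
  proof (rule mvt_increment)
    fix u assume "\<bar>u\<bar> \<le> \<bar>t\<bar>"
    then have "\<bar>\<xi> + u\<bar> \<le> 2 * \<bar>t\<bar>" using xi by linarith
    then show "((\<lambda>s. f' (\<xi> + s)) has_real_derivative f'' (\<xi> + u)) (at u)"
      by (intro f' has_real_derivative_shift[THEN iffD2])
  qed
  then obtain \<eta> where eta: "\<bar>\<eta>\<bar> \<le> \<bar>t\<bar>" "f' (t + \<xi>) - f' \<xi> = t * f'' (\<xi> + \<eta>)" by (auto simp: add.commute)
  show ?thesis
    by (rule exI[of _ "\<xi> + \<eta>"]) (use xi eta in \<open>auto simp: power2_eq_square\<close>)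
qed

lemma double_second_difference_mvt:
  fixes F :: "real \<Rightarrow> real \<Rightarrow> real"
  assumes F1: "\<And>u v. \<bar>u\<bar> < r \<Longrightarrow> \<bar>v\<bar> < r \<Longrightarrow> ((\<lambda>v. F u v) has_real_derivative F1 u v) (at v)"
    and F2: "\<And>u v. \<bar>u\<bar> < r \<Longrightarrow> \<bar>v\<bar> < r \<Longrightarrow> ((\<lambda>v. F1 u v) has_real_derivative F2 u v) (at v)"
    and F3: "\<And>u v. \<bar>u\<bar> < r \<Longrightarrow> \<bar>v\<bar> < r \<Longrightarrow> ((\<lambda>u. F2 u v) has_real_derivative F3 u v) (at u)"
    and F4: "\<And>u v. \<bar>u\<bar> < r \<Longrightarrow> \<bar>v\<bar> < r \<Longrightarrow> ((\<lambda>u. F3 u v) has_real_derivative F4 u v) (at u)"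
    and t: "2 * \<bar>t\<bar> < r" and s: "2 * \<bar>s\<bar> < r"
  shows "\<exists>t' s'. \<bar>t'\<bar> \<le> 2 * \<bar>t\<bar> \<and> \<bar>s'\<bar> \<le> 2 * \<bar>s\<bar> \<and>
    (F (2 * t) (2 * s) - 2 * F t (2 * s) + F 0 (2 * s)) - 2 * (F (2 * t) s - 2 * F t s + F 0 s)
     + (F (2 * t) 0 - 2 * F t 0 + F 0 0) = t\<^sup>2 * s\<^sup>2 * F4 t' s'"
proof -
  have r: "\<bar>0::real\<bar> < r" "\<bar>t\<bar> < r" "\<bar>2 * t\<bar> < r" using t by linarith+
  have "\<exists>\<xi>. \<bar>\<xi>\<bar> \<le> 2 * \<bar>s\<bar> \<and> (F (2 * t) (2 * s) - 2 * F t (2 * s) + F 0 (2 * s)) - 2 * (F (2 * t) s - 2 * F t s + F 0 s)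
     + (F (2 * t) 0 - 2 * F t 0 + F 0 0) = s\<^sup>2 * (F2 (2 * t) \<xi> - 2 * F2 t \<xi> + F2 0 \<xi>)"
  proof (rule second_difference_mvt)
    fix v assume "\<bar>v\<bar> \<le> 2 * \<bar>s\<bar>"
    then have "\<bar>v\<bar> < r" using s by linarith
    then show "((\<lambda>v. F (2 * t) v - 2 * F t v + F 0 v) has_real_derivative F1 (2 * t) v - 2 * F1 t v + F1 0 v) (at v)"
      "((\<lambda>v. F1 (2 * t) v - 2 * F1 t v + F1 0 v) has_real_derivative F2 (2 * t) v - 2 * F2 t v + F2 0 v) (at v)"
      by (intro DERIV_add DERIV_diff DERIV_cmult F1 F2 r; assumption)+
  qed
  then obtain s' where s': "\<bar>s'\<bar> \<le> 2 * \<bar>s\<bar>"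
    "(F (2 * t) (2 * s) - 2 * F t (2 * s) + F 0 (2 * s)) - 2 * (F (2 * t) s - 2 * F t s + F 0 s)
     + (F (2 * t) 0 - 2 * F t 0 + F 0 0) = s\<^sup>2 * (F2 (2 * t) s' - 2 * F2 t s' + F2 0 s')" by blast
  have "\<exists>\<xi>. \<bar>\<xi>\<bar> \<le> 2 * \<bar>t\<bar> \<and> F2 (2 * t) s' - 2 * F2 t s' + F2 0 s' = t\<^sup>2 * F4 \<xi> s'"
  proof (rule second_difference_mvt)
    fix u assume "\<bar>u\<bar> \<le> 2 * \<bar>t\<bar>"
    then have "\<bar>u\<bar> < r" "\<bar>s'\<bar> < r" using t s s' by linarith+
    then show "((\<lambda>u. F2 u s') has_real_derivative F3 u s') (at u)"
      "((\<lambda>u. F3 u s') has_real_derivative F4 u s') (at u)" by (rule F3, rule F4)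
  qed
  then obtain t' where "\<bar>t'\<bar> \<le> 2 * \<bar>t\<bar>" "F2 (2 * t) s' - 2 * F2 t s' + F2 0 s' = t\<^sup>2 * F4 t' s'" by blast
  then show ?thesis using s' by (metis mult.assoc mult.commute)
qed

text \<open>The second derivative need only exist at \<open>0\<close>: the difference \<open>f' (t + \<xi>) - f' \<xi>\<close> from the mean value form is
expanded to first order at \<open>0\<close>, with an error that is small relative to \<open>t\<close> because \<open>|\<xi>| \<le> |t|\<close>.\<close>

lemma second_difference_tendsto:
  fixes f f' :: "real \<Rightarrow> real"
  assumes r: "0 < r" and f: "\<And>u. \<bar>u\<bar> < r \<Longrightarrow> (f has_real_derivative f' u) (at u)"
    and f'': "(f' has_real_derivative D) (at 0)"
  shows "((\<lambda>t. (f (2 * t) - 2 * f t + f 0) / t\<^sup>2) \<longlongrightarrow> D) (at 0)"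
proof (rule tendstoI)
  fix e :: real assume e: "0 < e"
  have "((\<lambda>h. (f' h - f' 0) / h) \<longlongrightarrow> D) (at 0)" using f'' by (simp add: DERIV_def)
  then obtain d where d: "0 < d" "\<And>h. h \<noteq> 0 \<Longrightarrow> \<bar>h\<bar> < d \<Longrightarrow> \<bar>(f' h - f' 0) / h - D\<bar> < e / 4"
    using e unfolding tendsto_iff eventually_at by (metis UNIV_I dist_real_def diff_zero divide_pos_pos zero_less_numeral)
  have lin: "\<bar>f' h - f' 0 - D * h\<bar> \<le> e / 4 * \<bar>h\<bar>" if "\<bar>h\<bar> < d" for h
  proof (cases "h = 0")
    case False
    have "f' h - f' 0 - D * h = ((f' h - f' 0) / h - D) * h" using False by (simp add: field_simps)
    then show ?thesis using mult_right_mono[OF less_imp_le[OF d(2)[OF False that]] abs_ge_zero[of h]]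
      by (simp add: abs_mult)
  qed simp
  have "\<bar>(f (2 * t) - 2 * f t + f 0) / t\<^sup>2 - D\<bar> < e" if t: "t \<noteq> 0" "\<bar>t\<bar> < min (d/2) (r/2)" for t
  proof -
    have "\<exists>\<xi>. \<bar>\<xi>\<bar> \<le> \<bar>t\<bar> \<and> f (2 * t) - 2 * f t + f 0 = t * (f' (t + \<xi>) - f' \<xi>)"
      by (rule second_difference_mvt_gen) (use t in \<open>auto intro!: f\<close>)
    then obtain \<xi> where xi: "\<bar>\<xi>\<bar> \<le> \<bar>t\<bar>" "f (2 * t) - 2 * f t + f 0 = t * (f' (t + \<xi>) - f' \<xi>)" by blast
    have "\<bar>f' (t + \<xi>) - f' 0 - D * (t + \<xi>)\<bar> \<le> e / 4 * \<bar>t + \<xi>\<bar>" "\<bar>f' \<xi> - f' 0 - D * \<xi>\<bar> \<le> e / 4 * \<bar>\<xi>\<bar>"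
      by (rule lin; use xi t in linarith)+
    moreover have "e / 4 * \<bar>t + \<xi>\<bar> \<le> e / 4 * (2 * \<bar>t\<bar>)" "e / 4 * \<bar>\<xi>\<bar> \<le> e / 4 * \<bar>t\<bar>"
      using xi(1) e by (auto intro!: mult_left_mono)
    moreover have "D * (t + \<xi>) - D * \<xi> = D * t" by (simp add: algebra_simps)
    ultimately have "\<bar>f' (t + \<xi>) - f' \<xi> - D * t\<bar> \<le> e / 4 * (3 * \<bar>t\<bar>)" by linarith
    also have "\<dots> < e * \<bar>t\<bar>" using e t by simp
    finally have b: "\<bar>f' (t + \<xi>) - f' \<xi> - D * t\<bar> < e * \<bar>t\<bar>" .
    have eq: "(f (2 * t) - 2 * f t + f 0) / t\<^sup>2 - D = (f' (t + \<xi>) - f' \<xi> - D * t) / t"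
      unfolding xi(2) using t by (simp add: power2_eq_square field_simps)
    show ?thesis unfolding eq abs_divide using b t by (simp add: pos_divide_less_eq)
  qed
  then show "\<forall>\<^sub>F t in at 0. dist ((f (2 * t) - 2 * f t + f 0) / t\<^sup>2) D < e"
    unfolding eventually_at dist_real_def using d r by (intro exI[of _ "min (d/2) (r/2)"]) auto
qed

text \<open>Convergence of a family of vectors can be read off its Gram matrix:
\<open>\<parallel>a(t) - a(s)\<parallel>\<^sup>2\<close> is the combination \<open>G(t,t) - 2 G(t,s) + G(s,s)\<close> of entries with a common limit.\<close>

lemma tendsto_of_gram:
  fixes a :: "real \<Rightarrow> 'h::{real_inner,complete_space}"
  assumes G: "\<And>e. 0 < e \<Longrightarrow> \<exists>d>0. \<forall>t s. 0 < \<bar>t\<bar> \<longrightarrow> \<bar>t\<bar> < d \<longrightarrow> 0 < \<bar>s\<bar> \<longrightarrow> \<bar>s\<bar> < d \<longrightarrow> \<bar>a t \<bullet> a s - L\<bar> < e"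
  shows "\<exists>h. (a \<longlongrightarrow> h) (at 0)"
proof -
  have C: "\<exists>d>0. \<forall>t s. 0 < \<bar>t\<bar> \<longrightarrow> \<bar>t\<bar> < d \<longrightarrow> 0 < \<bar>s\<bar> \<longrightarrow> \<bar>s\<bar> < d \<longrightarrow> norm (a t - a s) < e" if e: "0 < e" for e
  proof -
    obtain d where d: "d > 0" "\<And>t s. 0 < \<bar>t\<bar> \<Longrightarrow> \<bar>t\<bar> < d \<Longrightarrow> 0 < \<bar>s\<bar> \<Longrightarrow> \<bar>s\<bar> < d \<Longrightarrow> \<bar>a t \<bullet> a s - L\<bar> < e\<^sup>2 / 4"
      using G[of "e\<^sup>2 / 4"] e by auto
    have "norm (a t - a s) < e" if ts: "0 < \<bar>t\<bar>" "\<bar>t\<bar> < d" "0 < \<bar>s\<bar>" "\<bar>s\<bar> < d" for t s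
    proof -
      have "(norm (a t - a s))\<^sup>2 = a t \<bullet> a t - 2 * (a t \<bullet> a s) + a s \<bullet> a s"
        by (simp add: power2_norm_eq_inner inner_diff_left inner_diff_right inner_commute)
      also have "\<dots> < e\<^sup>2" using d(2)[OF ts(1,2,1,2)] d(2)[OF ts] d(2)[OF ts(3,4,3,4)] by linarith
      finally show ?thesis by (rule power_less_imp_less_base) (use e in simp)
    qed
    then show ?thesis using d(1) by blast
  qed
  define b where "b n = a (inverse (real (Suc n)))" for n
  have lim0: "(\<lambda>n. inverse (real (Suc n))) \<longlonglongrightarrow> 0" by (rule LIMSEQ_inverse_real_of_nat)
  have small: "\<exists>N. \<forall>n\<ge>N. inverse (real (Suc n)) < d" if "0 < d" for d
    using order_tendstoD(2)[OF lim0 that] by (simp add: eventually_sequentially)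
  have "Cauchy b"
  proof (rule metric_CauchyI)
    fix e :: real assume "0 < e"
    then obtain d where d: "d > 0" "\<And>t s. 0 < \<bar>t\<bar> \<Longrightarrow> \<bar>t\<bar> < d \<Longrightarrow> 0 < \<bar>s\<bar> \<Longrightarrow> \<bar>s\<bar> < d \<Longrightarrow> norm (a t - a s) < e"
      using C by blast
    obtain N where "\<forall>n\<ge>N. inverse (real (Suc n)) < d" using small[OF d(1)] by blast
    then show "\<exists>N. \<forall>m\<ge>N. \<forall>n\<ge>N. dist (b m) (b n) < e"
      by (intro exI[of _ N] allI impI) (simp add: b_def dist_norm d(2))
  qed
  then obtain h where h: "b \<longlonglongrightarrow> h" using Cauchy_convergent_iff convergent_def by blast
  have "(a \<longlongrightarrow> h) (at 0)"
  proof (rule tendstoI)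
    fix e :: real assume "0 < e"
    then obtain d where d: "d > 0" "\<And>t s. 0 < \<bar>t\<bar> \<Longrightarrow> \<bar>t\<bar> < d \<Longrightarrow> 0 < \<bar>s\<bar> \<Longrightarrow> \<bar>s\<bar> < d \<Longrightarrow> norm (a t - a s) < e / 2"
      using C[of "e / 2"] by auto
    have "norm (a t - h) \<le> e / 2" if t: "0 < \<bar>t\<bar>" "\<bar>t\<bar> < d" for t
    proof (rule LIMSEQ_le_const2)
      show "(\<lambda>n. norm (a t - b n)) \<longlonglongrightarrow> norm (a t - h)" by (intro tendsto_intros h)
      obtain N where N: "\<forall>n\<ge>N. inverse (real (Suc n)) < d" using small[OF d(1)] by blast
      have "norm (a t - b n) \<le> e / 2" if "n \<ge> N" for n
        unfolding b_def by (rule less_imp_le, rule d(2)[OF t]) (use N that in auto)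
      then show "\<exists>N. \<forall>n\<ge>N. norm (a t - b n) \<le> e / 2" by blast
    qed
    then have "dist (a t) h < e" if "t \<noteq> 0" "dist t 0 < d" for t
      using that \<open>0 < e\<close> by (fastforce simp: dist_norm)
    then show "\<forall>\<^sub>F t in at 0. dist (a t) h < e" unfolding eventually_at using d(1) by auto
  qed
  then show ?thesis by blast
qed

text \<open>The same identity \<open>\<parallel>\<Phi>(y) - \<Phi>(x)\<parallel>\<^sup>2 = G(y,y) - 2 G(y,x) + G(x,x)\<close> gives strong continuity.\<close>

lemma continuous_on_of_gram:
  fixes \<Phi> :: "'a::metric_space \<Rightarrow> 'h::real_inner"
  assumes G: "\<And>x y. x \<in> S \<Longrightarrow> y \<in> S \<Longrightarrow> \<Phi> x \<bullet> \<Phi> y = G (x, y)" and cont: "continuous_on (S \<times> S) G"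
  shows "continuous_on S \<Phi>"
  unfolding continuous_on_def
proof
  fix x assume x: "x \<in> S"
  have "continuous_on S (\<lambda>y. G (y, y))" "continuous_on S (\<lambda>y. G (y, x))"
    by (rule continuous_on_compose2[OF cont], intro continuous_intros, use x in auto)+
  then have "((\<lambda>y. G (y, y) - 2 * G (y, x) + G (x, x)) \<longlongrightarrow> G (x, x) - 2 * G (x, x) + G (x, x)) (at x within S)"
    using x unfolding continuous_on_def by (intro tendsto_intros) auto
  then have lim: "((\<lambda>y. sqrt (G (y, y) - 2 * G (y, x) + G (x, x))) \<longlongrightarrow> sqrt 0) (at x within S)"
    by (intro tendsto_real_sqrt) simp
  have "((\<lambda>y. norm (\<Phi> y - \<Phi> x)) \<longlongrightarrow> 0) (at x within S)"
  proof -
    have "sqrt (G (y, y) - 2 * G (y, x) + G (x, x)) = norm (\<Phi> y - \<Phi> x)" if "y \<in> S" for y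
      using that x by (simp add: norm_eq_sqrt_inner inner_diff_left inner_diff_right inner_commute G[symmetric])
    then have "\<forall>\<^sub>F y in at x within S. sqrt (G (y, y) - 2 * G (y, x) + G (x, x)) = norm (\<Phi> y - \<Phi> x)"
      by (auto simp: eventually_at_filter)
    from Lim_transform_eventually[OF lim this] show ?thesis by simp
  qed
  then show "(\<Phi> \<longlongrightarrow> \<Phi> x) (at x within S)" using Lim_null by (simp add: LIM_zero_iff tendsto_norm_zero_iff)
qed

locale smooth_rkhs =
  fixes \<Omega> :: "(real, 'd::{finite,linorder}) vec set"
    and \<iota> :: "'h::{real_inner,complete_space} \<Rightarrow> (real, 'd) vec \<Rightarrow> real"
    and k :: "(real, 'd) vec \<times> (real, 'd) vec \<Rightarrow> real"
  assumes rkhs: "is_rkhs \<Omega> \<iota> k" and open_Omega: "open \<Omega>"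
    and smooth: "\<And>is. sorted is \<Longrightarrow> length is \<le> 2 \<Longrightarrow>
        iter_deriv_exists (\<Omega> \<times> \<Omega>) (kernel_dirs is is) k \<and> continuous_on (\<Omega> \<times> \<Omega>) (kderiv is is k)"
begin

text \<open>The representer \<open>k(x,\<cdot>)\<close> of evaluation at \<open>x\<close>.\<close>

definition ev :: "(real, 'd) vec \<Rightarrow> 'h" where
  "ev x = (SOME h. (\<forall>y\<in>\<Omega>. \<iota> h y = k (x, y)) \<and> (\<forall>f. \<iota> f x = f \<bullet> h))"

lemma ev: "x \<in> \<Omega> \<Longrightarrow> y \<in> \<Omega> \<Longrightarrow> \<iota> (ev x) y = k (x, y)" "x \<in> \<Omega> \<Longrightarrow> \<iota> f x = f \<bullet> ev x"
proof -
  have "(\<forall>y\<in>\<Omega>. \<iota> (ev x) y = k (x, y)) \<and> (\<forall>f. \<iota> f x = f \<bullet> ev x)" if "x \<in> \<Omega>"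
    unfolding ev_def by (rule someI_ex) (use rkhs that in \<open>auto simp: is_rkhs_def\<close>)
  then show "x \<in> \<Omega> \<Longrightarrow> y \<in> \<Omega> \<Longrightarrow> \<iota> (ev x) y = k (x, y)" "x \<in> \<Omega> \<Longrightarrow> \<iota> f x = f \<bullet> ev x" by auto
qed

lemma ev_inner: "x \<in> \<Omega> \<Longrightarrow> y \<in> \<Omega> \<Longrightarrow> ev x \<bullet> ev y = k (x, y)"
  using ev by metis

lemma kernel_symmetric: "x \<in> \<Omega> \<Longrightarrow> y \<in> \<Omega> \<Longrightarrow> k (x, y) = k (y, x)"
  using ev_inner inner_commute by metis

lemma continuous_on_ev: "continuous_on \<Omega> ev"
  using smooth[of "[]"] by (intro continuous_on_of_gram[where G=k and \<Phi>=ev] ev_inner) (auto simp: kderiv_def kernel_dirs_def)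

lemma continuous_on_element: "continuous_on \<Omega> (\<iota> f)"
proof -
  have "continuous_on \<Omega> (\<lambda>x. f \<bullet> ev x)" by (intro continuous_intros continuous_on_ev)
  then show ?thesis by (rule continuous_on_eq) (simp add: ev(2))
qed

lemma kfeat_eqI:
  assumes "\<And>y. y \<in> \<Omega> \<Longrightarrow> \<iota> h y = kderiv is [] k (x, y)"
  shows "kfeat \<Omega> \<iota> k is x = h"
  unfolding kfeat_def
proof (rule the_equality)
  show "\<forall>y\<in>\<Omega>. \<iota> h y = kderiv is [] k (x, y)" using assms by auto
  fix g assume "\<forall>y\<in>\<Omega>. \<iota> g y = kderiv is [] k (x, y)"
  then have "\<forall>y\<in>\<Omega>. \<iota> g y = \<iota> h y" using assms by simp
  then show "g = h" using rkhs by (auto simp: is_rkhs_def)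
qed

lemma continuous_along_lines:
  assumes G: "continuous_on (\<Omega> \<times> \<Omega>) (G :: _ \<Rightarrow> real)" and xy: "x \<in> \<Omega>" "y \<in> \<Omega>" and e: "norm e = 1" and "0 < \<epsilon>"
  obtains r where "0 < r" "\<And>u v. \<bar>u\<bar> < r \<Longrightarrow> \<bar>v\<bar> < r \<Longrightarrow>
    x + u *\<^sub>R e \<in> \<Omega> \<and> y + v *\<^sub>R e \<in> \<Omega> \<and> \<bar>G (x + u *\<^sub>R e, y + v *\<^sub>R e) - G (x, y)\<bar> < \<epsilon>"
proof -
  have op: "open (\<Omega> \<times> \<Omega>)" by (intro open_Times open_Omega)
  have "isCont G (x, y)" using G op xy by (simp add: continuous_on_eq_continuous_at)
  then obtain d where d: "0 < d" "\<And>z. dist z (x, y) < d \<Longrightarrow> \<bar>G z - G (x, y)\<bar> < \<epsilon>"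
    using \<open>0 < \<epsilon>\<close> unfolding continuous_at_eps_delta dist_real_def by blast
  obtain d' where d': "0 < d'" "ball (x, y) d' \<subseteq> \<Omega> \<times> \<Omega>"
    using op xy open_contains_ball by (metis mem_Sigma_iff)
  show thesis
  proof (rule that[of "min (d/2) (d'/2)"])
    fix u v assume uv: "\<bar>u\<bar> < min (d/2) (d'/2)" "\<bar>v\<bar> < min (d/2) (d'/2)"
    have "dist (x + u *\<^sub>R e, y + v *\<^sub>R e) (x, y) \<le> dist (x + u *\<^sub>R e) x + dist (y + v *\<^sub>R e) y"
      unfolding dist_Pair_Pair by (rule sqrt_sum_squares_le_sum) auto
    also have "\<dots> = \<bar>u\<bar> + \<bar>v\<bar>" using e by (simp add: dist_norm)
    finally have "dist (x + u *\<^sub>R e, y + v *\<^sub>R e) (x, y) < min d d'" using uv by linarith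
    then have "(x + u *\<^sub>R e, y + v *\<^sub>R e) \<in> ball (x, y) d'" "dist (x + u *\<^sub>R e, y + v *\<^sub>R e) (x, y) < d"
      by (auto simp: dist_commute)
    then show "x + u *\<^sub>R e \<in> \<Omega> \<and> y + v *\<^sub>R e \<in> \<Omega> \<and> \<bar>G (x + u *\<^sub>R e, y + v *\<^sub>R e) - G (x, y)\<bar> < \<epsilon>"
      using d(2) d'(2) by blast
  qed (use d d' in auto)
qed

context
  fixes i :: 'd
begin

lemma norm_axis_1: "norm (axis i (1::real)) = 1" by (simp add: norm_eq_1 inner_axis_axis)

text \<open>The existence hypotheses on the iterated derivatives of \<open>k\<close>, read along coordinate lines. In the names,
\<open>u\<close> and \<open>v\<close> stand for the \<open>i\<close>-th coordinate of the first and of the second argument; the rightmost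
derivative is taken first.\<close>

lemma kernel_deriv_v:
  assumes "x \<in> \<Omega>" "y + s *\<^sub>R axis i 1 \<in> \<Omega>"
  shows "((\<lambda>t. k (x, y + t *\<^sub>R axis i 1)) has_real_derivative kderiv [] [i] k (x, y + s *\<^sub>R axis i 1)) (at s)"
  using iter_deriv_line[of "\<Omega> \<times> \<Omega>" "(0, axis i 1)" "[]" k "(x, y)" s] smooth[of "[i]"] assms
  by (simp add: kernel_dirs_def kderiv_def)

lemma kernel_deriv_uv:
  assumes "x + s *\<^sub>R axis i 1 \<in> \<Omega>" "y \<in> \<Omega>"
  shows "((\<lambda>t. kderiv [] [i] k (x + t *\<^sub>R axis i 1, y)) has_real_derivative kderiv [i] [i] k (x + s *\<^sub>R axis i 1, y)) (at s)"
  using iter_deriv_line[of "\<Omega> \<times> \<Omega>" "(axis i 1, 0)" "[(0, axis i 1)]" k "(x, y)" s] smooth[of "[i]"] assms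
  by (simp add: kernel_dirs_def kderiv_def)

lemma kernel_deriv_vv:
  assumes "x \<in> \<Omega>" "y + s *\<^sub>R axis i 1 \<in> \<Omega>"
  shows "((\<lambda>t. kderiv [] [i] k (x, y + t *\<^sub>R axis i 1)) has_real_derivative kderiv [] [i,i] k (x, y + s *\<^sub>R axis i 1)) (at s)"
  using iter_deriv_line[of "\<Omega> \<times> \<Omega>" "(0, axis i 1)" "[(0, axis i 1)]" k "(x, y)" s] smooth[of "[i,i]"] assms
  by (simp add: kernel_dirs_def kderiv_def)

lemma kernel_deriv_uvv:
  assumes "x + s *\<^sub>R axis i 1 \<in> \<Omega>" "y \<in> \<Omega>"
  shows "((\<lambda>t. kderiv [] [i,i] k (x + t *\<^sub>R axis i 1, y)) has_real_derivative kderiv [i] [i,i] k (x + s *\<^sub>R axis i 1, y)) (at s)"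
  using iter_deriv_line[of "\<Omega> \<times> \<Omega>" "(axis i 1, 0)" "[(0, axis i 1), (0, axis i 1)]" k "(x, y)" s] smooth[of "[i,i]"] assms
  by (simp add: kernel_dirs_def kderiv_def)

lemma kernel_deriv_uuvv:
  assumes "x + s *\<^sub>R axis i 1 \<in> \<Omega>" "y \<in> \<Omega>"
  shows "((\<lambda>t. kderiv [i] [i,i] k (x + t *\<^sub>R axis i 1, y)) has_real_derivative kderiv [i,i] [i,i] k (x + s *\<^sub>R axis i 1, y)) (at s)"
  using iter_deriv_line[of "\<Omega> \<times> \<Omega>" "(axis i 1, 0)" "[(axis i 1, 0), (0, axis i 1), (0, axis i 1)]" k "(x, y)" s] smooth[of "[i,i]"] assms
  by (simp add: kernel_dirs_def kderiv_def)

definition diff1 :: "real \<Rightarrow> (real, 'd) vec \<Rightarrow> 'h" where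
  "diff1 t x = (1 / t) *\<^sub>R (ev (x + t *\<^sub>R axis i 1) - ev x)"

definition diff2 :: "real \<Rightarrow> (real, 'd) vec \<Rightarrow> 'h" where
  "diff2 t x = (1 / t\<^sup>2) *\<^sub>R (ev (x + (2 * t) *\<^sub>R axis i 1) - 2 *\<^sub>R ev (x + t *\<^sub>R axis i 1) + ev x)"

text \<open>The Gram matrix of the difference quotients is a mixed double difference quotient of \<open>k\<close>, hence a value of
\<open>\<partial>\<^sub>i\<partial>\<^sub>i\<^sub>+\<^sub>dk\<close> at a nearby point.\<close>

lemma gram_diff1:
  assumes xy: "x \<in> \<Omega>" "y \<in> \<Omega>" and "0 < \<epsilon>"
  shows "\<exists>d>0. \<forall>t s. 0 < \<bar>t\<bar> \<longrightarrow> \<bar>t\<bar> < d \<longrightarrow> 0 < \<bar>s\<bar> \<longrightarrow> \<bar>s\<bar> < d \<longrightarrow>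
    \<bar>diff1 t x \<bullet> diff1 s y - kderiv [i] [i] k (x, y)\<bar> < \<epsilon>"
proof -
  have cont: "continuous_on (\<Omega> \<times> \<Omega>) (kderiv [i] [i] k)" using smooth[of "[i]"] by simp
  obtain r where r: "0 < r" and nr: "\<And>u v. \<bar>u\<bar> < r \<Longrightarrow> \<bar>v\<bar> < r \<Longrightarrow>
    x + u *\<^sub>R axis i 1 \<in> \<Omega> \<and> y + v *\<^sub>R axis i 1 \<in> \<Omega> \<and> \<bar>kderiv [i] [i] k (x + u *\<^sub>R axis i 1, y + v *\<^sub>R axis i 1) - kderiv [i] [i] k (x, y)\<bar> < \<epsilon>"
    by (rule continuous_along_lines[OF cont xy norm_axis_1 \<open>0 < \<epsilon>\<close>]) blast
  have "\<bar>diff1 t x \<bullet> diff1 s y - kderiv [i] [i] k (x, y)\<bar> < \<epsilon>"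
    if t: "0 < \<bar>t\<bar>" "\<bar>t\<bar> < r" and s: "0 < \<bar>s\<bar>" "\<bar>s\<bar> < r" for t s
  proof -
    have in\<Omega>: "x + t *\<^sub>R axis i 1 \<in> \<Omega>" "y + s *\<^sub>R axis i 1 \<in> \<Omega>" using nr t s by auto
    define F where "F u v = k (x + u *\<^sub>R axis i 1, y + v *\<^sub>R axis i 1)" for u v
    have "\<exists>t' s'. \<bar>t'\<bar> \<le> \<bar>t\<bar> \<and> \<bar>s'\<bar> \<le> \<bar>s\<bar> \<and>
        F t s - F 0 s - (F t 0 - F 0 0) = t * s * kderiv [i] [i] k (x + t' *\<^sub>R axis i 1, y + s' *\<^sub>R axis i 1)"
      unfolding F_def
      by (rule double_difference_mvt[where r=r and Fv="\<lambda>u v. kderiv [] [i] k (x + u *\<^sub>R axis i 1, y + v *\<^sub>R axis i 1)"])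
         (use nr t s in \<open>auto intro!: kernel_deriv_v kernel_deriv_uv\<close>)
    then obtain t' s' where ts: "\<bar>t'\<bar> \<le> \<bar>t\<bar>" "\<bar>s'\<bar> \<le> \<bar>s\<bar>"
      and eq: "F t s - F 0 s - (F t 0 - F 0 0) = t * s * kderiv [i] [i] k (x + t' *\<^sub>R axis i 1, y + s' *\<^sub>R axis i 1)" by blast
    have "diff1 t x \<bullet> diff1 s y = (F t s - F 0 s - (F t 0 - F 0 0)) / (t * s)"
    proof -
      have "(ev (x + t *\<^sub>R axis i 1) - ev x) \<bullet> (ev (y + s *\<^sub>R axis i 1) - ev y) = F t s - F 0 s - (F t 0 - F 0 0)"
        using in\<Omega> xy by (simp add: F_def inner_diff_left inner_diff_right ev_inner)
      then show ?thesis by (simp add: diff1_def)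
    qed
    also have "\<dots> = kderiv [i] [i] k (x + t' *\<^sub>R axis i 1, y + s' *\<^sub>R axis i 1)" unfolding eq using t s by simp
    finally show ?thesis using nr[of t' s'] ts t s by simp
  qed
  then show ?thesis using r by blast
qed

text \<open>Second-order quotients are taken directly from \<open>k\<close> rather than as quotients of \<open>\<partial>\<^sub>ik(x,\<cdot>)\<close>: their Gram matrix then
involves the derivatives of \<open>k\<close> in exactly the order \<open>\<partial>\<^sub>i\<^sup>2\<partial>\<^sub>i\<^sub>+\<^sub>d\<^sup>2k\<close> in which they are known to exist.\<close>

lemma gram_diff2:
  assumes xy: "x \<in> \<Omega>" "y \<in> \<Omega>" and "0 < \<epsilon>"
  shows "\<exists>d>0. \<forall>t s. 0 < \<bar>t\<bar> \<longrightarrow> \<bar>t\<bar> < d \<longrightarrow> 0 < \<bar>s\<bar> \<longrightarrow> \<bar>s\<bar> < d \<longrightarrow>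
    \<bar>diff2 t x \<bullet> diff2 s y - kderiv [i,i] [i,i] k (x, y)\<bar> < \<epsilon>"
proof -
  have cont: "continuous_on (\<Omega> \<times> \<Omega>) (kderiv [i,i] [i,i] k)" using smooth[of "[i,i]"] by simp
  obtain r where r: "0 < r" and nr: "\<And>u v. \<bar>u\<bar> < r \<Longrightarrow> \<bar>v\<bar> < r \<Longrightarrow>
    x + u *\<^sub>R axis i 1 \<in> \<Omega> \<and> y + v *\<^sub>R axis i 1 \<in> \<Omega> \<and> \<bar>kderiv [i,i] [i,i] k (x + u *\<^sub>R axis i 1, y + v *\<^sub>R axis i 1) - kderiv [i,i] [i,i] k (x, y)\<bar> < \<epsilon>"
    by (rule continuous_along_lines[OF cont xy norm_axis_1 \<open>0 < \<epsilon>\<close>]) blast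
  have "\<bar>diff2 t x \<bullet> diff2 s y - kderiv [i,i] [i,i] k (x, y)\<bar> < \<epsilon>"
    if t: "0 < \<bar>t\<bar>" "\<bar>t\<bar> < r / 2" and s: "0 < \<bar>s\<bar>" "\<bar>s\<bar> < r / 2" for t s
  proof -
    have in\<Omega>: "x + t *\<^sub>R axis i 1 \<in> \<Omega>" "y + s *\<^sub>R axis i 1 \<in> \<Omega>" "x + (2 * t) *\<^sub>R axis i 1 \<in> \<Omega>" "y + (2 * s) *\<^sub>R axis i 1 \<in> \<Omega>"
      using nr[of t s] nr[of "2 * t" "2 * s"] t s by auto
    define F where "F u v = k (x + u *\<^sub>R axis i 1, y + v *\<^sub>R axis i 1)" for u v
    let ?N = "(F (2 * t) (2 * s) - 2 * F t (2 * s) + F 0 (2 * s)) - 2 * (F (2 * t) s - 2 * F t s + F 0 s)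
      + (F (2 * t) 0 - 2 * F t 0 + F 0 0)"
    have "\<exists>t' s'. \<bar>t'\<bar> \<le> 2 * \<bar>t\<bar> \<and> \<bar>s'\<bar> \<le> 2 * \<bar>s\<bar> \<and>
        ?N = t\<^sup>2 * s\<^sup>2 * kderiv [i,i] [i,i] k (x + t' *\<^sub>R axis i 1, y + s' *\<^sub>R axis i 1)"
      unfolding F_def
      by (rule double_second_difference_mvt[where r=r
            and ?F1.0="\<lambda>u v. kderiv [] [i] k (x + u *\<^sub>R axis i 1, y + v *\<^sub>R axis i 1)"
            and ?F2.0="\<lambda>u v. kderiv [] [i,i] k (x + u *\<^sub>R axis i 1, y + v *\<^sub>R axis i 1)"
            and ?F3.0="\<lambda>u v. kderiv [i] [i,i] k (x + u *\<^sub>R axis i 1, y + v *\<^sub>R axis i 1)"])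
         (use nr t s in \<open>auto intro!: kernel_deriv_v kernel_deriv_vv kernel_deriv_uvv kernel_deriv_uuvv\<close>)
    then obtain t' s' where ts: "\<bar>t'\<bar> \<le> 2 * \<bar>t\<bar>" "\<bar>s'\<bar> \<le> 2 * \<bar>s\<bar>"
      and eq: "?N = t\<^sup>2 * s\<^sup>2 * kderiv [i,i] [i,i] k (x + t' *\<^sub>R axis i 1, y + s' *\<^sub>R axis i 1)" by blast
    have "diff2 t x \<bullet> diff2 s y = ?N / (t\<^sup>2 * s\<^sup>2)"
    proof -
      have "(ev (x + (2 * t) *\<^sub>R axis i 1) - 2 *\<^sub>R ev (x + t *\<^sub>R axis i 1) + ev x) \<bullet>
          (ev (y + (2 * s) *\<^sub>R axis i 1) - 2 *\<^sub>R ev (y + s *\<^sub>R axis i 1) + ev y) = ?N"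
        using in\<Omega> xy by (simp add: F_def inner_diff_left inner_diff_right inner_add_left inner_add_right ev_inner)
      then show ?thesis by (simp add: diff2_def)
    qed
    also have "\<dots> = kderiv [i,i] [i,i] k (x + t' *\<^sub>R axis i 1, y + s' *\<^sub>R axis i 1)" unfolding eq using t s by simp
    finally show ?thesis using nr[of t' s'] ts t s by simp
  qed
  then show ?thesis using r by (intro exI[of _ "r / 2"]) auto
qed

lemma gram_limit:
  fixes a :: "real \<Rightarrow> (real, 'd) vec \<Rightarrow> 'h"
  assumes gram: "\<And>x y \<epsilon>. x \<in> \<Omega> \<Longrightarrow> y \<in> \<Omega> \<Longrightarrow> 0 < (\<epsilon>::real) \<Longrightarrow> \<exists>d>0. \<forall>t s. 0 < \<bar>t\<bar> \<longrightarrow> \<bar>t\<bar> < d \<longrightarrow>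
      0 < \<bar>s\<bar> \<longrightarrow> \<bar>s\<bar> < d \<longrightarrow> \<bar>a t x \<bullet> a s y - G (x, y)\<bar> < \<epsilon>"
  shows "\<exists>\<Phi>. (\<forall>x\<in>\<Omega>. ((\<lambda>t. a t x) \<longlongrightarrow> \<Phi> x) (at 0)) \<and> (\<forall>x\<in>\<Omega>. \<forall>y\<in>\<Omega>. \<Phi> x \<bullet> \<Phi> y = G (x, y))"
proof -
  have "\<forall>x\<in>\<Omega>. \<exists>h. ((\<lambda>t. a t x) \<longlongrightarrow> h) (at 0)"
    using tendsto_of_gram[of "\<lambda>t. a t _", OF gram] by blast
  then obtain \<Phi> where \<Phi>: "\<And>x. x \<in> \<Omega> \<Longrightarrow> ((\<lambda>t. a t x) \<longlongrightarrow> \<Phi> x) (at 0)" by metis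
  have "\<Phi> x \<bullet> \<Phi> y = G (x, y)" if xy: "x \<in> \<Omega>" "y \<in> \<Omega>" for x y
  proof -
    have "((\<lambda>t. a t x \<bullet> a t y) \<longlongrightarrow> G (x, y)) (at 0)"
    proof (rule tendstoI)
      fix \<epsilon> :: real assume "0 < \<epsilon>"
      then obtain d where "d > 0" "\<forall>t s. 0 < \<bar>t\<bar> \<longrightarrow> \<bar>t\<bar> < d \<longrightarrow>
          0 < \<bar>s\<bar> \<longrightarrow> \<bar>s\<bar> < d \<longrightarrow> \<bar>a t x \<bullet> a s y - G (x, y)\<bar> < \<epsilon>" using gram[OF xy] by blast
      then show "\<forall>\<^sub>F t in at 0. dist (a t x \<bullet> a t y) (G (x, y)) < \<epsilon>"
        unfolding eventually_at dist_real_def by (intro exI[of _ d]) auto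
    qed
    moreover have "((\<lambda>t. a t x \<bullet> a t y) \<longlongrightarrow> \<Phi> x \<bullet> \<Phi> y) (at 0)" by (intro tendsto_intros \<Phi> xy)
    ultimately show ?thesis using tendsto_unique at_neq_bot by blast
  qed
  then show ?thesis using \<Phi> by blast
qed

lemma line_in:
  assumes "x \<in> \<Omega>" obtains r where "0 < r" "\<And>u. \<bar>u\<bar> < r \<Longrightarrow> x + u *\<^sub>R axis i 1 \<in> \<Omega>"
proof -
  obtain r where "0 < r" "ball x r \<subseteq> \<Omega>" using open_Omega assms open_contains_ball by blast
  then show thesis using norm_axis_1 by (intro that[of r]) (auto simp: dist_norm)
qed

lemma kernel_deriv_from_diff1:
  assumes x: "x \<in> \<Omega>" and \<Phi>: "((\<lambda>t. diff1 t x) \<longlongrightarrow> \<Phi>) (at 0)"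
  shows "((\<lambda>t. \<iota> f (x + t *\<^sub>R axis i 1)) has_real_derivative f \<bullet> \<Phi>) (at 0)"
  unfolding DERIV_def
proof (rule Lim_transform_eventually)
  show "((\<lambda>t. f \<bullet> diff1 t x) \<longlongrightarrow> f \<bullet> \<Phi>) (at 0)" by (intro tendsto_intros \<Phi>)
  obtain r where r: "0 < r" "\<And>u. \<bar>u\<bar> < r \<Longrightarrow> x + u *\<^sub>R axis i 1 \<in> \<Omega>" using line_in[OF x] by blast
  have "f \<bullet> diff1 t x = (\<iota> f (x + (0 + t) *\<^sub>R axis i 1) - \<iota> f (x + 0 *\<^sub>R axis i 1)) / t" if "t \<noteq> 0" "\<bar>t\<bar> < r" for t
    using r(2)[of t] that x by (simp add: diff1_def ev(2) inner_diff_right)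
  then show "\<forall>\<^sub>F t in at 0. f \<bullet> diff1 t x = (\<iota> f (x + (0 + t) *\<^sub>R axis i 1) - \<iota> f (x + 0 *\<^sub>R axis i 1)) / t"
    unfolding eventually_at using r(1) by (intro exI[of _ r]) (auto simp: dist_real_def)
qed

lemma kfeat1_limit:
  shows "x \<in> \<Omega> \<Longrightarrow> ((\<lambda>t. diff1 t x) \<longlongrightarrow> kfeat \<Omega> \<iota> k [i] x) (at 0)"
    and "x \<in> \<Omega> \<Longrightarrow> y \<in> \<Omega> \<Longrightarrow> kfeat \<Omega> \<iota> k [i] x \<bullet> kfeat \<Omega> \<iota> k [i] y = kderiv [i] [i] k (x, y)"
    and "x \<in> \<Omega> \<Longrightarrow> y \<in> \<Omega> \<Longrightarrow> \<iota> (kfeat \<Omega> \<iota> k [i] x) y = kderiv [i] [] k (x, y)"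
proof -
  have "\<exists>\<Phi>. (\<forall>x\<in>\<Omega>. ((\<lambda>t. diff1 t x) \<longlongrightarrow> \<Phi> x) (at 0)) \<and>
      (\<forall>x\<in>\<Omega>. \<forall>y\<in>\<Omega>. \<Phi> x \<bullet> \<Phi> y = kderiv [i] [i] k (x, y))"
    by (rule gram_limit, rule gram_diff1)
  then obtain \<Phi> where "(\<forall>x\<in>\<Omega>. ((\<lambda>t. diff1 t x) \<longlongrightarrow> \<Phi> x) (at 0)) \<and>
      (\<forall>x\<in>\<Omega>. \<forall>y\<in>\<Omega>. \<Phi> x \<bullet> \<Phi> y = kderiv [i] [i] k (x, y))" ..
  then have \<Phi>: "\<And>x. x \<in> \<Omega> \<Longrightarrow> ((\<lambda>t. diff1 t x) \<longlongrightarrow> \<Phi> x) (at 0)"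
    and G: "\<And>x y. x \<in> \<Omega> \<Longrightarrow> y \<in> \<Omega> \<Longrightarrow> \<Phi> x \<bullet> \<Phi> y = kderiv [i] [i] k (x, y)"
    by simp_all
  have val: "\<iota> (\<Phi> x) y = kderiv [i] [] k (x, y)" if xy: "x \<in> \<Omega>" "y \<in> \<Omega>" for x y
  proof -
    obtain r where r: "0 < r" "\<And>u. \<bar>u\<bar> < r \<Longrightarrow> x + u *\<^sub>R axis i 1 \<in> \<Omega>" using line_in[OF xy(1)] by blast
    have "((\<lambda>t. k (x + t *\<^sub>R axis i 1, y)) has_real_derivative ev y \<bullet> \<Phi> x) (at 0)"
    proof (rule has_field_derivative_transform_within[OF kernel_deriv_from_diff1[OF xy(1) \<Phi>[OF xy(1)]] r(1)])
      show "\<iota> (ev y) (x + t *\<^sub>R axis i 1) = k (x + t *\<^sub>R axis i 1, y)" if "dist t 0 < r" for t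
        using r(2)[of t] that xy by (simp add: ev(1) kernel_symmetric)
    qed simp
    then have "deriv (\<lambda>t. k (x + t *\<^sub>R axis i 1, y)) 0 = ev y \<bullet> \<Phi> x" by (rule DERIV_imp_deriv)
    then show ?thesis using xy by (simp add: kderiv_def kernel_dirs_def dir_deriv_def ev(2) inner_commute)
  qed
  have eq: "kfeat \<Omega> \<iota> k [i] x = \<Phi> x" if "x \<in> \<Omega>" for x
    by (rule kfeat_eqI) (simp add: val that)
  show "x \<in> \<Omega> \<Longrightarrow> ((\<lambda>t. diff1 t x) \<longlongrightarrow> kfeat \<Omega> \<iota> k [i] x) (at 0)"
    "x \<in> \<Omega> \<Longrightarrow> y \<in> \<Omega> \<Longrightarrow> kfeat \<Omega> \<iota> k [i] x \<bullet> kfeat \<Omega> \<iota> k [i] y = kderiv [i] [i] k (x, y)"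
    "x \<in> \<Omega> \<Longrightarrow> y \<in> \<Omega> \<Longrightarrow> \<iota> (kfeat \<Omega> \<iota> k [i] x) y = kderiv [i] [] k (x, y)"
    using \<Phi> G val by (auto simp: eq)
qed

text \<open>Symmetry of \<open>k\<close> turns derivatives in the second argument, which are the ones assumed to exist, into derivatives in
the first.\<close>

lemma deriv_first_swap:
  assumes xy: "x \<in> \<Omega>" "y \<in> \<Omega>" shows "kderiv [i] [] k (x, y) = kderiv [] [i] k (y, x)"
proof -
  obtain r where r: "0 < r" "\<And>u. \<bar>u\<bar> < r \<Longrightarrow> x + u *\<^sub>R axis i 1 \<in> \<Omega>" using line_in[OF xy(1)] by blast
  have d: "((\<lambda>t. k (y, x + t *\<^sub>R axis i 1)) has_real_derivative kderiv [] [i] k (y, x)) (at 0)"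
    using kernel_deriv_v[of y x 0] xy by simp
  have "((\<lambda>t. k (x + t *\<^sub>R axis i 1, y)) has_real_derivative kderiv [] [i] k (y, x)) (at 0)"
  proof (rule has_field_derivative_transform_within[OF d r(1)])
    show "k (y, x + t *\<^sub>R axis i 1) = k (x + t *\<^sub>R axis i 1, y)" if "dist t 0 < r" for t
      using r(2)[of t] that xy by (simp add: kernel_symmetric)
  qed simp
  then have "deriv (\<lambda>t. k (x + t *\<^sub>R axis i 1, y)) 0 = kderiv [] [i] k (y, x)" by (rule DERIV_imp_deriv)
  then show ?thesis by (simp add: kderiv_def kernel_dirs_def dir_deriv_def)
qed

lemma deriv_first_twice:
  assumes xy: "x \<in> \<Omega>" "y \<in> \<Omega>"
  shows "((\<lambda>t. kderiv [i] [] k (x + t *\<^sub>R axis i 1, y)) has_real_derivative kderiv [i,i] [] k (x, y)) (at 0)"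
    and "kderiv [i,i] [] k (x, y) = kderiv [] [i,i] k (y, x)"
proof -
  obtain r where r: "0 < r" "\<And>u. \<bar>u\<bar> < r \<Longrightarrow> x + u *\<^sub>R axis i 1 \<in> \<Omega>" using line_in[OF xy(1)] by blast
  have d: "((\<lambda>t. kderiv [] [i] k (y, x + t *\<^sub>R axis i 1)) has_real_derivative kderiv [] [i,i] k (y, x)) (at 0)"
    using kernel_deriv_vv[of y x 0] xy by simp
  have d': "((\<lambda>t. kderiv [i] [] k (x + t *\<^sub>R axis i 1, y)) has_real_derivative kderiv [] [i,i] k (y, x)) (at 0)"
  proof (rule has_field_derivative_transform_within[OF d r(1)])
    show "kderiv [] [i] k (y, x + t *\<^sub>R axis i 1) = kderiv [i] [] k (x + t *\<^sub>R axis i 1, y)" if "dist t 0 < r" for t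
      using r(2)[of t] that xy by (simp add: deriv_first_swap)
  qed simp
  then have "deriv (\<lambda>t. kderiv [i] [] k (x + t *\<^sub>R axis i 1, y)) 0 = kderiv [] [i,i] k (y, x)" by (rule DERIV_imp_deriv)
  then show eq: "kderiv [i,i] [] k (x, y) = kderiv [] [i,i] k (y, x)"
    by (simp add: kderiv_def kernel_dirs_def dir_deriv_def[of _ "dir_deriv _ _"])
  show "((\<lambda>t. kderiv [i] [] k (x + t *\<^sub>R axis i 1, y)) has_real_derivative kderiv [i,i] [] k (x, y)) (at 0)"
    using d' by (simp add: eq)
qed

text \<open>The limit of the second difference quotients takes the value \<open>\<partial>\<^sub>i\<^sup>2k(x,y)\<close> at \<open>y\<close>, so it is the element
\<open>\<partial>\<^sub>i\<^sup>2k(x,\<cdot>)\<close>.\<close>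

lemma kfeat2_limit:
  shows "x \<in> \<Omega> \<Longrightarrow> y \<in> \<Omega> \<Longrightarrow> kfeat \<Omega> \<iota> k [i,i] x \<bullet> kfeat \<Omega> \<iota> k [i,i] y = kderiv [i,i] [i,i] k (x, y)"
    and "x \<in> \<Omega> \<Longrightarrow> y \<in> \<Omega> \<Longrightarrow> \<iota> (kfeat \<Omega> \<iota> k [i,i] x) y = kderiv [i,i] [] k (x, y)"
proof -
  have "\<exists>\<Phi>. (\<forall>x\<in>\<Omega>. ((\<lambda>t. diff2 t x) \<longlongrightarrow> \<Phi> x) (at 0)) \<and>
      (\<forall>x\<in>\<Omega>. \<forall>y\<in>\<Omega>. \<Phi> x \<bullet> \<Phi> y = kderiv [i,i] [i,i] k (x, y))"
    by (rule gram_limit, rule gram_diff2)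
  then obtain \<Phi> where "(\<forall>x\<in>\<Omega>. ((\<lambda>t. diff2 t x) \<longlongrightarrow> \<Phi> x) (at 0)) \<and>
      (\<forall>x\<in>\<Omega>. \<forall>y\<in>\<Omega>. \<Phi> x \<bullet> \<Phi> y = kderiv [i,i] [i,i] k (x, y))" ..
  then have \<Phi>: "\<And>x. x \<in> \<Omega> \<Longrightarrow> ((\<lambda>t. diff2 t x) \<longlongrightarrow> \<Phi> x) (at 0)"
    and G: "\<And>x y. x \<in> \<Omega> \<Longrightarrow> y \<in> \<Omega> \<Longrightarrow> \<Phi> x \<bullet> \<Phi> y = kderiv [i,i] [i,i] k (x, y)"
    by simp_all
  have val: "\<iota> (\<Phi> x) y = kderiv [i,i] [] k (x, y)" if xy: "x \<in> \<Omega>" "y \<in> \<Omega>" for x y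
  proof -
    obtain r where r: "0 < r" "\<And>u. \<bar>u\<bar> < r \<Longrightarrow> x + u *\<^sub>R axis i 1 \<in> \<Omega>" using line_in[OF xy(1)] by blast
    define f where "f u = k (y, x + u *\<^sub>R axis i 1)" for u
    have "((\<lambda>t. (f (2 * t) - 2 * f t + f 0) / t\<^sup>2) \<longlongrightarrow> kderiv [] [i,i] k (y, x)) (at 0)"
    proof (rule second_difference_tendsto[OF r(1)])
      show "(f has_real_derivative kderiv [] [i] k (y, x + u *\<^sub>R axis i 1)) (at u)" if "\<bar>u\<bar> < r" for u
        unfolding f_def[abs_def] by (rule kernel_deriv_v[OF xy(2) r(2)[OF that]])
      show "((\<lambda>u. kderiv [] [i] k (y, x + u *\<^sub>R axis i 1)) has_real_derivative kderiv [] [i,i] k (y, x)) (at 0)"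
        using kernel_deriv_vv[of y x 0] xy by simp
    qed
    moreover have "((\<lambda>t. (f (2 * t) - 2 * f t + f 0) / t\<^sup>2) \<longlongrightarrow> ev y \<bullet> \<Phi> x) (at 0)"
    proof (rule Lim_transform_eventually)
      show "((\<lambda>t. ev y \<bullet> diff2 t x) \<longlongrightarrow> ev y \<bullet> \<Phi> x) (at 0)" by (intro tendsto_intros \<Phi> xy)
      have "ev y \<bullet> diff2 t x = (f (2 * t) - 2 * f t + f 0) / t\<^sup>2" if "t \<noteq> 0" "\<bar>t\<bar> < r / 2" for t
        using r(2)[of t] r(2)[of "2 * t"] that xy
        by (simp add: diff2_def f_def inner_diff_right inner_add_right ev_inner)
      then show "\<forall>\<^sub>F t in at 0. ev y \<bullet> diff2 t x = (f (2 * t) - 2 * f t + f 0) / t\<^sup>2"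
        unfolding eventually_at using r(1) by (intro exI[of _ "r / 2"]) (auto simp: dist_real_def)
    qed
    ultimately have "kderiv [] [i,i] k (y, x) = ev y \<bullet> \<Phi> x" using tendsto_unique at_neq_bot by blast
    then show ?thesis using xy by (simp add: deriv_first_twice(2) ev(2) inner_commute)
  qed
  have eq: "kfeat \<Omega> \<iota> k [i,i] x = \<Phi> x" if "x \<in> \<Omega>" for x
    by (rule kfeat_eqI) (simp add: val that)
  show "x \<in> \<Omega> \<Longrightarrow> y \<in> \<Omega> \<Longrightarrow> kfeat \<Omega> \<iota> k [i,i] x \<bullet> kfeat \<Omega> \<iota> k [i,i] y = kderiv [i,i] [i,i] k (x, y)"
    "x \<in> \<Omega> \<Longrightarrow> y \<in> \<Omega> \<Longrightarrow> \<iota> (kfeat \<Omega> \<iota> k [i,i] x) y = kderiv [i,i] [] k (x, y)"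
    using G val by (auto simp: eq)
qed

lemma element_has_derivative:
  "x \<in> \<Omega> \<Longrightarrow> ((\<lambda>t. \<iota> f (x + t *\<^sub>R axis i 1)) has_real_derivative f \<bullet> kfeat \<Omega> \<iota> k [i] x) (at 0)"
  by (rule kernel_deriv_from_diff1) (auto intro: kfeat1_limit)

lemma kfeat1_has_derivative:
  assumes "x \<in> \<Omega>" "y \<in> \<Omega>"
  shows "((\<lambda>t. \<iota> (kfeat \<Omega> \<iota> k [i] (x + t *\<^sub>R axis i 1)) y) has_real_derivative \<iota> (kfeat \<Omega> \<iota> k [i,i] x) y) (at 0)"
proof -
  obtain r where r: "0 < r" "\<And>u. \<bar>u\<bar> < r \<Longrightarrow> x + u *\<^sub>R axis i 1 \<in> \<Omega>" using line_in[OF assms(1)] by blast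
  show ?thesis unfolding kfeat2_limit(2)[OF assms]
    by (rule has_field_derivative_transform_within[OF deriv_first_twice(1)[OF assms] r(1)])
       (use r(2) assms in \<open>auto simp: kfeat1_limit(3)\<close>)
qed

lemma continuous_on_kfeat: "continuous_on \<Omega> (kfeat \<Omega> \<iota> k [i])" "continuous_on \<Omega> (kfeat \<Omega> \<iota> k [i,i])"
  using smooth[of "[i]"] smooth[of "[i,i]"]
  by (auto intro: continuous_on_of_gram[where G="kderiv [i] [i] k", OF kfeat1_limit(2)]
      continuous_on_of_gram[where G="kderiv [i,i] [i,i] k", OF kfeat2_limit(1)])

lemma norm_kfeat:
  assumes "x \<in> \<Omega>"
  shows "norm (kfeat \<Omega> \<iota> k [i] x) = sqrt (kderiv [i] [i] k (x, x))"
    "norm (kfeat \<Omega> \<iota> k [i,i] x) = sqrt (kderiv [i,i] [i,i] k (x, x))"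
  using assms by (auto simp: norm_eq_sqrt_inner kfeat1_limit(2) kfeat2_limit(1))

end

end


section \<open>Integration by parts for fields vanishing at the boundary\<close>

text \<open>A countable basis of the topology separates the points of a set without accumulation points in itself.\<close>

lemma countable_isolated:
  fixes S :: "real set"
  assumes "\<And>x. x \<in> S \<Longrightarrow> \<exists>d>0. \<forall>t. 0 < \<bar>t\<bar> \<longrightarrow> \<bar>t\<bar> < d \<longrightarrow> x + t \<notin> S"
  shows "countable S"
proof -
  obtain B :: "real set set" where B: "countable B" "topological_basis B" using ex_countable_basis by blast
  have "\<exists>b\<in>B. S \<inter> b = {x}" if x: "x \<in> S" for x
  proof -
    obtain d where d: "d > 0" "\<And>t. 0 < \<bar>t\<bar> \<Longrightarrow> \<bar>t\<bar> < d \<Longrightarrow> x + t \<notin> S" using assms[OF x] by blast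
    obtain b where b: "b \<in> B" "x \<in> b" "b \<subseteq> ball x d"
      using topological_basisE[OF B(2) open_ball[of x d]] d(1) by (metis centre_in_ball)
    have "y = x" if "y \<in> S" "y \<in> b" for y
      using d(2)[of "y - x"] that b(3) by (force simp: dist_real_def subset_eq)
    then show ?thesis using b x by blast
  qed
  then obtain b where b: "\<And>x. x \<in> S \<Longrightarrow> b x \<in> B" "\<And>x. x \<in> S \<Longrightarrow> S \<inter> b x = {x}" by metis
  have "inj_on b S" by (rule inj_onI) (metis b(2) singleton_inject)
  moreover have "countable (b ` S)" using b(1) by (intro countable_subset[OF _ B(1)]) auto
  ultimately show ?thesis using countable_image_inj_on by blast
qed

lemma nn_integral_lborel_translate:
  fixes f :: "'a::euclidean_space \<Rightarrow> ennreal"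
  assumes [measurable]: "f \<in> borel_measurable borel"
  shows "(\<integral>\<^sup>+x. f (x + c) \<partial>lborel) = (\<integral>\<^sup>+x. f x \<partial>lborel)"
proof -
  have "(\<integral>\<^sup>+x. f x \<partial>lborel) = (\<integral>\<^sup>+x. f x \<partial>distr lborel borel ((+) c))" by (simp add: lborel_distr_plus)
  also have "\<dots> = (\<integral>\<^sup>+x. f (c + x) \<partial>lborel)" by (intro nn_integral_distr) auto
  finally show ?thesis by (simp add: add.commute)
qed

text \<open>Average the measure of \<open>N\<close> over the translates \<open>N - t e\<close>, \<open>0 \<le> t \<le> 1\<close>. After exchanging the integrals, the inner
one measures a line section of \<open>N\<close>, which is countable.\<close>

lemma null_set_of_isolated_on_lines:
  fixes N :: "'a::euclidean_space set"
  assumes N[measurable]: "N \<in> sets borel"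
    and iso: "\<And>x. x \<in> N \<Longrightarrow> \<exists>d>0. \<forall>t. 0 < \<bar>t\<bar> \<longrightarrow> \<bar>t\<bar> < d \<longrightarrow> x + t *\<^sub>R e \<notin> N"
  shows "N \<in> null_sets lborel"
proof -
  have slice: "(\<integral>\<^sup>+t. indicator {0..1} t * indicator N (x + t *\<^sub>R e) \<partial>lborel) = 0" for x
  proof -
    let ?S = "{t::real. x + t *\<^sub>R e \<in> N}"
    have "countable ?S"
    proof (rule countable_isolated)
      fix s assume "s \<in> ?S"
      then obtain d where "d > 0" "\<forall>t. 0 < \<bar>t\<bar> \<longrightarrow> \<bar>t\<bar> < d \<longrightarrow> (x + s *\<^sub>R e) + t *\<^sub>R e \<notin> N"
        using iso[of "x + s *\<^sub>R e"] by auto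
      then show "\<exists>d>0. \<forall>t. 0 < \<bar>t\<bar> \<longrightarrow> \<bar>t\<bar> < d \<longrightarrow> s + t \<notin> ?S"
        by (intro exI[of _ d]) (auto simp: scaleR_add_left add.assoc)
    qed
    then have "?S \<in> null_sets lborel" by (rule countable_imp_null_set_lborel)
    then have "AE t in lborel. t \<notin> ?S" by (rule AE_not_in)
    then have "AE t in lborel. indicator {0..1} t * indicator N (x + t *\<^sub>R e) = (0::ennreal)"
      by eventually_elim auto
    then show ?thesis by (subst nn_integral_0_iff_AE) auto
  qed
  have meas: "(\<lambda>(t, x). indicator {0..1} t * indicator N (x + t *\<^sub>R e) :: ennreal) \<in> borel_measurable (lborel \<Otimes>\<^sub>M lborel)"
    by measurable
  have "emeasure lborel N = (\<integral>\<^sup>+t. indicator {0..1} t * emeasure lborel N \<partial>(lborel :: real measure))"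
    by (simp add: nn_integral_multc)
  also have "\<dots> = (\<integral>\<^sup>+t. (\<integral>\<^sup>+x. indicator {0..1} t * indicator N (x + t *\<^sub>R e) \<partial>lborel) \<partial>lborel)"
  proof (rule nn_integral_cong)
    fix t :: real
    have "emeasure lborel N = (\<integral>\<^sup>+x. indicator N (x + t *\<^sub>R e) \<partial>lborel)"
      by (subst nn_integral_lborel_translate) (auto simp: nn_integral_indicator)
    then show "indicator {0..1} t * emeasure lborel N = (\<integral>\<^sup>+x. indicator {0..1} t * indicator N (x + t *\<^sub>R e) \<partial>lborel)"
      by (simp add: nn_integral_cmult)
  qed
  also have "\<dots> = (\<integral>\<^sup>+x. (\<integral>\<^sup>+t. indicator {0..1} t * indicator N (x + t *\<^sub>R e) \<partial>lborel) \<partial>lborel)"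
    using lborel_pair.Fubini'[OF meas] by simp
  also have "\<dots> = 0" by (simp add: slice)
  finally show ?thesis by auto
qed

text \<open>The integral of a difference quotient of \<open>g\<close> is zero by translation invariance. The quotients are bounded and
supported in one ball, so dominated convergence applies.\<close>

lemma integral_dir_deriv_compact_support:
  fixes g g' :: "'a::euclidean_space \<Rightarrow> real"
  assumes der: "\<And>x. ((\<lambda>t. g (x + t *\<^sub>R e)) has_real_derivative g' x) (at 0)"
    and cont: "continuous_on UNIV g" and K: "compact K" "\<And>x. x \<notin> K \<Longrightarrow> g x = 0"
    and bound: "\<And>x. \<bar>g' x\<bar> \<le> B"
  shows "integrable lborel g'" and "(\<integral>x. g' x \<partial>lborel) = 0"
proof -
  define h where "h n = inverse (real (Suc n))" for n
  have h: "0 < h n" "h n \<le> 1" for n by (auto simp: h_def field_simps)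
  have h0: "h \<longlonglongrightarrow> 0" unfolding h_def by (rule LIMSEQ_inverse_real_of_nat)
  define D where "D n x = (g (x + h n *\<^sub>R e) - g x) / h n" for n x
  have g_meas[measurable]: "g \<in> borel_measurable borel" using cont by (rule borel_measurable_continuous_onI)
  have g_int: "integrable lborel g"
  proof -
    have "integrable lborel (\<lambda>x. indicator K x *\<^sub>R g x)"
      using K(1) by (intro borel_integrable_compact continuous_on_subset[OF cont]) auto
    moreover have "(\<lambda>x. indicator K x *\<^sub>R g x) = g" using K(2) by (auto simp: indicator_def fun_eq_iff)
    ultimately show ?thesis by simp
  qed
  have g_shift: "integrable lborel (\<lambda>x. g (x + c))" "(\<integral>x. g (x + c) \<partial>lborel) = (\<integral>x. g x \<partial>lborel)" for c
  proof -
    have "integrable (distr lborel borel ((+) c)) g" by (simp add: lborel_distr_plus g_int)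
    then show "integrable lborel (\<lambda>x. g (x + c))" by (subst (asm) integrable_distr_eq) (auto simp: add.commute)
    have "(\<integral>x. g x \<partial>lborel) = (\<integral>x. g x \<partial>distr lborel borel ((+) c))" by (simp add: lborel_distr_plus)
    also have "\<dots> = (\<integral>x. g (c + x) \<partial>lborel)" by (intro integral_distr) auto
    finally show "(\<integral>x. g (x + c) \<partial>lborel) = (\<integral>x. g x \<partial>lborel)" by (simp add: add.commute)
  qed
  have D_int0: "(\<integral>x. D n x \<partial>lborel) = 0" for n
    unfolding D_def using g_int g_shift by simp
  have D_lim: "(\<lambda>n. D n x) \<longlonglongrightarrow> g' x" for x
  proof -
    have "((\<lambda>t. (g (x + (0 + t) *\<^sub>R e) - g (x + 0 *\<^sub>R e)) / t) \<longlongrightarrow> g' x) (at 0)" using der[of x] by (simp add: DERIV_def)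
    moreover have "filterlim h (at 0) sequentially"
      using h0 h(1) by (auto simp: filterlim_at less_imp_neq intro!: always_eventually) (metis less_irrefl)
    ultimately have "((\<lambda>n. (g (x + (0 + h n) *\<^sub>R e) - g (x + 0 *\<^sub>R e)) / h n) \<longlongrightarrow> g' x) sequentially"
      by (rule filterlim_compose)
    then show ?thesis by (simp add: D_def)
  qed
  have D_bound: "\<bar>D n x\<bar> \<le> B" for n x
  proof -
    have line: "((\<lambda>t. g (x + t *\<^sub>R e)) has_real_derivative g' (x + s *\<^sub>R e)) (at s)" for s
      by (rule line_derivI[where g=g]) (rule der)
    have "\<exists>z>0. z < h n \<and> g (x + h n *\<^sub>R e) - g (x + 0 *\<^sub>R e) = (h n - 0) * g' (x + z *\<^sub>R e)"
      by (rule MVT2[OF h(1)]) (rule line)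
    then obtain z where "g (x + h n *\<^sub>R e) - g x = h n * g' (x + z *\<^sub>R e)" by auto
    then have "D n x = g' (x + z *\<^sub>R e)" using h(1)[of n] by (simp add: D_def)
    then show ?thesis using bound by simp
  qed
  obtain R where R: "K \<subseteq> cball 0 R" using bounded_subset_ballD[OF compact_imp_bounded[OF K(1)], of 0] ball_subset_cball by blast
  \<comment> \<open>Steps have length at most \<open>norm e\<close>, so every quotient is supported in this ball.\<close>
  let ?W = "\<lambda>x::'a. B * indicator (cball 0 (R + norm e)) x"
  have D_dom: "norm (D n x) \<le> ?W x" for n x
  proof (cases "x \<in> cball 0 (R + norm e)")
    case False
    have "x \<notin> K"
    proof
      assume "x \<in> K"
      then have "norm x \<le> R" using R by auto
      then show False using False norm_ge_zero[of e] by simp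
    qed
    moreover have "x + h n *\<^sub>R e \<notin> K"
    proof
      assume "x + h n *\<^sub>R e \<in> K"
      then have "norm (x + h n *\<^sub>R e) \<le> R" using R by auto
      moreover have "norm (h n *\<^sub>R e) \<le> norm e" using h[of n] by (simp add: mult_left_le_one_le)
      ultimately show False using False norm_diff_ineq[of x "h n *\<^sub>R e"] by auto
    qed
    ultimately show ?thesis using K(2) False by (simp add: D_def)
  qed (use D_bound in auto)
  have W: "integrable lborel ?W" by (intro integrable_mult_right integrable_real_indicator) (simp_all add: emeasure_lborel_cball_finite[unfolded infinity_ennreal_def])
  have g'_meas: "g' \<in> borel_measurable lborel"
    by (rule borel_measurable_LIMSEQ_real[OF D_lim]) (simp add: D_def)
  have D_meas: "D n \<in> borel_measurable lborel" for n unfolding D_def by simp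
  show "integrable lborel g'"
    by (rule integrable_dominated_convergence[where s=D and w="?W", OF g'_meas D_meas W]) (use D_lim D_dom in auto)
  have "(\<lambda>n. \<integral>x. D n x \<partial>lborel) \<longlonglongrightarrow> (\<integral>x. g' x \<partial>lborel)"
    by (rule integral_dominated_convergence[where s=D and w="?W", OF g'_meas D_meas W]) (use D_lim D_dom in auto)
  then show "(\<integral>x. g' x \<partial>lborel) = 0" by (simp add: D_int0 LIMSEQ_const_iff)
qed

text \<open>A continuously differentiable approximation of the identity that vanishes near \<open>0\<close> and has slope in \<open>[0,1]\<close>.\<close>

definition trunc :: "real \<Rightarrow> real \<Rightarrow> real" where
  "trunc \<epsilon> s = (if \<bar>s\<bar> \<le> \<epsilon> then 0 else (\<bar>s\<bar> - \<epsilon>)\<^sup>2 / s)"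

definition trunc' :: "real \<Rightarrow> real \<Rightarrow> real" where
  "trunc' \<epsilon> s = (if \<bar>s\<bar> \<le> \<epsilon> then 0 else 1 - \<epsilon>\<^sup>2 / s\<^sup>2)"

text \<open>The truncation is built from squares of positive parts; this treats the points where its pieces meet.\<close>

lemma pos_part_square_has_derivative: "((\<lambda>s. (max 0 s)\<^sup>2) has_real_derivative 2 * max 0 s) (at s)" for s :: real
proof -
  consider "0 < s" | "s < 0" | "s = 0" by linarith
  then show ?thesis
  proof cases
    case 1
    have "((\<lambda>s. s\<^sup>2) has_real_derivative 2 * max 0 s) (at s)" using 1 by (auto intro!: derivative_eq_intros)
    then show ?thesis
      by (rule has_field_derivative_transform_within_open[where S="{0<..}"]) (use 1 in auto)
  next
    case 2
    have "((\<lambda>s. 0) has_real_derivative 2 * max 0 s) (at s)" using 2 by auto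
    then show ?thesis
      by (rule has_field_derivative_transform_within_open[where S="{..<0}"]) (use 2 in auto)
  next
    case 3
    have "((\<lambda>h. max 0 h) \<longlongrightarrow> max 0 0) (at (0::real))" by (intro tendsto_intros)
    moreover have "\<forall>\<^sub>F h in at (0::real). max 0 h = ((max 0 (0 + h))\<^sup>2 - (max 0 0)\<^sup>2) / h"
      by (auto simp: eventually_at_filter max_def power2_eq_square intro!: always_eventually)
    ultimately have "((\<lambda>h. ((max 0 (0 + h))\<^sup>2 - (max 0 0)\<^sup>2) / h) \<longlongrightarrow> max 0 0) (at (0::real))"
      by (rule Lim_transform_eventually)
    then show ?thesis using 3 by (simp add: DERIV_def)
  qed
qed

lemma trunc_has_derivative:
  assumes e: "0 < \<epsilon>" shows "(trunc \<epsilon> has_real_derivative trunc' \<epsilon> s) (at s)"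
proof -
  consider "0 < s" | "s < 0" | "s = 0" by linarith
  then show ?thesis
  proof cases
    case 1
    have "((\<lambda>s. (max 0 (s - \<epsilon>))\<^sup>2) has_real_derivative 2 * max 0 (s - \<epsilon>) * 1) (at s)"
      by (rule DERIV_chain2[OF pos_part_square_has_derivative]) (auto intro!: derivative_eq_intros)
    then have "((\<lambda>s. (max 0 (s - \<epsilon>))\<^sup>2 / s) has_real_derivative (2 * max 0 (s - \<epsilon>) * 1 * s - (max 0 (s - \<epsilon>))\<^sup>2 * 1) / (s * s)) (at s)"
      by (rule DERIV_divide) (use 1 in auto)
    also have "(2 * max 0 (s - \<epsilon>) * 1 * s - (max 0 (s - \<epsilon>))\<^sup>2 * 1) / (s * s) = trunc' \<epsilon> s"
      using 1 by (auto simp: trunc'_def max_def field_simps power2_eq_square)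
    finally show ?thesis
      by (rule has_field_derivative_transform_within_open[where S="{0<..}"]) (use 1 in \<open>auto simp: trunc_def max_def\<close>)
  next
    case 2
    have "((\<lambda>s. (max 0 (- s - \<epsilon>))\<^sup>2) has_real_derivative 2 * max 0 (- s - \<epsilon>) * (-1)) (at s)"
      by (rule DERIV_chain2[OF pos_part_square_has_derivative]) (auto intro!: derivative_eq_intros)
    then have "((\<lambda>s. (max 0 (- s - \<epsilon>))\<^sup>2 / s) has_real_derivative (2 * max 0 (- s - \<epsilon>) * (-1) * s - (max 0 (- s - \<epsilon>))\<^sup>2 * 1) / (s * s)) (at s)"
      by (rule DERIV_divide) (use 2 in auto)
    also have "(2 * max 0 (- s - \<epsilon>) * (-1) * s - (max 0 (- s - \<epsilon>))\<^sup>2 * 1) / (s * s) = trunc' \<epsilon> s"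
      using 2 by (auto simp: trunc'_def max_def field_simps power2_eq_square)
    finally show ?thesis
      by (rule has_field_derivative_transform_within_open[where S="{..<0}"]) (use 2 in \<open>auto simp: trunc_def max_def\<close>)
  next
    case 3
    have "((\<lambda>s. 0) has_real_derivative trunc' \<epsilon> s) (at s)" using 3 e by (auto simp: trunc'_def)
    then show ?thesis
      by (rule has_field_derivative_transform_within_open[where S="{-\<epsilon><..<\<epsilon>}"]) (use 3 e in \<open>auto simp: trunc_def\<close>)
  qed
qed

lemma abs_trunc'_le_1:
  assumes "0 < \<epsilon>" shows "\<bar>trunc' \<epsilon> s\<bar> \<le> 1"
proof (cases "\<bar>s\<bar> \<le> \<epsilon>")
  case False
  then have "\<epsilon>\<^sup>2 \<le> s\<^sup>2" using assms by (intro power2_le_iff_abs_le[THEN iffD2, of \<epsilon> s] | simp add: abs_le_square_iff[symmetric])+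
  then have "0 \<le> \<epsilon>\<^sup>2 / s\<^sup>2" "\<epsilon>\<^sup>2 / s\<^sup>2 \<le> 1" by (auto simp: divide_le_eq_1)
  then show ?thesis using False by (auto simp: trunc'_def)
qed (auto simp: trunc'_def)

lemma trunc'_tendsto:
  assumes \<epsilon>: "\<epsilon> \<longlonglongrightarrow> 0" "\<And>n::nat. 0 < \<epsilon> n"
  shows "(\<lambda>n. trunc' (\<epsilon> n) s) \<longlonglongrightarrow> (if s = 0 then 0 else 1)"
proof (cases "s = 0")
  case True
  then show ?thesis using \<epsilon>(2) by (simp add: trunc'_def less_imp_le)
next
  case False
  have "(\<lambda>n. 1 - (\<epsilon> n)\<^sup>2 / s\<^sup>2) \<longlonglongrightarrow> 1 - 0\<^sup>2 / s\<^sup>2" using False by (intro tendsto_intros \<epsilon>) auto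
  moreover have "\<forall>\<^sub>F n in sequentially. 1 - (\<epsilon> n)\<^sup>2 / s\<^sup>2 = trunc' (\<epsilon> n) s"
  proof -
    have "\<forall>\<^sub>F n in sequentially. \<epsilon> n < \<bar>s\<bar>" by (rule order_tendstoD(2)[OF \<epsilon>(1)]) (use False in simp)
    then show ?thesis by eventually_elim (simp add: trunc'_def)
  qed
  ultimately have "(\<lambda>n. trunc' (\<epsilon> n) s) \<longlonglongrightarrow> 1 - 0\<^sup>2 / s\<^sup>2" by (rule Lim_transform_eventually)
  then show ?thesis using False by simp
qed

text \<open>The function \<open>trunc \<epsilon> (w x)\<close> vanishes off a compact subset of \<open>\<Omega>\<close>, so its derivative integrates to zero.
As \<open>\<epsilon> \<rightarrow> 0\<close> that derivative tends to \<open>w'\<close> where \<open>w \<noteq> 0\<close> and to \<open>0\<close> where \<open>w = 0\<close>. The limits agree with \<open>w'\<close>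
almost everywhere: a zero of \<open>w\<close> with \<open>w' \<noteq> 0\<close> is isolated on its line, so such zeros form a null set.\<close>

theorem integral_dir_deriv_vanishing_at_boundary:
  fixes w w' :: "'a::euclidean_space \<Rightarrow> real"
  assumes \<Omega>: "open \<Omega>" and w: "continuous_on \<Omega> w" and w': "continuous_on \<Omega> w'"
    and der: "\<And>x. x \<in> \<Omega> \<Longrightarrow> ((\<lambda>t. w (x + t *\<^sub>R e)) has_real_derivative w' x) (at 0)"
    and int: "set_integrable lborel \<Omega> w'"
    and vanish: "\<And>\<epsilon>. 0 < \<epsilon> \<Longrightarrow> \<exists>K. compact K \<and> K \<subseteq> \<Omega> \<and> (\<forall>x\<in>\<Omega> - K. \<bar>w x\<bar> < \<epsilon>)"
  shows "(LINT x:\<Omega>|lborel. w' x) = 0"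
proof -
  have \<Omega>_meas[measurable]: "\<Omega> \<in> sets borel" using \<Omega> by auto
  define G where "G \<epsilon> x = (if x \<in> \<Omega> then trunc \<epsilon> (w x) else 0)" for \<epsilon> x
  define G' where "G' \<epsilon> x = (if x \<in> \<Omega> then trunc' \<epsilon> (w x) * w' x else 0)" for \<epsilon> x
  have step: "integrable lborel (G' \<epsilon>) \<and> (\<integral>x. G' \<epsilon> x \<partial>lborel) = 0" if e: "0 < \<epsilon>" for \<epsilon>
  proof -
    obtain K where K: "compact K" "K \<subseteq> \<Omega>" "\<And>x. x \<in> \<Omega> - K \<Longrightarrow> \<bar>w x\<bar> < \<epsilon>" using vanish[OF e] by blast
    have G0: "G \<epsilon> x = 0" "G' \<epsilon> x = 0" if "x \<notin> K" for x
      using K(3)[of x] that by (auto simp: G_def G'_def trunc_def trunc'_def)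
    obtain B where B: "\<And>x. x \<in> K \<Longrightarrow> \<bar>w' x\<bar> \<le> B" "0 \<le> B"
    proof -
      have "bounded (w' ` K)"
        by (intro compact_imp_bounded compact_continuous_image continuous_on_subset[OF w' K(2)] K)
      then obtain B where "\<And>x. x \<in> K \<Longrightarrow> \<bar>w' x\<bar> \<le> B" by (auto simp: bounded_iff)
      then show thesis using that[of "max 0 B"] by (simp add: le_max_iff_disj)
    qed
    have "((\<lambda>t. G \<epsilon> (x + t *\<^sub>R e)) has_real_derivative G' \<epsilon> x) (at 0)" for x
    proof (cases "x \<in> \<Omega>")
      case True
      have op: "open ((\<lambda>t. x + t *\<^sub>R e) -` \<Omega>)" by (intro open_vimage[OF \<Omega>] continuous_intros)
      have "((\<lambda>t. trunc \<epsilon> (w (x + t *\<^sub>R e))) has_real_derivative trunc' \<epsilon> (w (x + 0 *\<^sub>R e)) * w' x) (at 0)"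
        by (rule DERIV_chain2[OF trunc_has_derivative[OF e] der[OF True]])
      then have "((\<lambda>t. trunc \<epsilon> (w (x + t *\<^sub>R e))) has_real_derivative G' \<epsilon> x) (at 0)" using True by (simp add: G'_def)
      then show ?thesis
        by (rule has_field_derivative_transform_within_open[OF _ op]) (use True in \<open>auto simp: G_def\<close>)
    next
      case False
      then have nK: "x \<notin> K" using K(2) by auto
      have op: "open ((\<lambda>t. x + t *\<^sub>R e) -` (- K))"
        by (intro open_vimage continuous_intros open_Compl compact_imp_closed K)
      have "((\<lambda>t. 0) has_real_derivative G' \<epsilon> x) (at 0)" using G0 nK by simp
      then show ?thesis
        by (rule has_field_derivative_transform_within_open[OF _ op]) (use nK G0 in auto)
    qed
    moreover have "continuous_on UNIV (G \<epsilon>)"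
    proof -
      have "continuous_on UNIV (trunc \<epsilon>)"
        using trunc_has_derivative[OF e] by (meson DERIV_isCont continuous_at_imp_continuous_on)
      then have "continuous_on \<Omega> (\<lambda>x. trunc \<epsilon> (w x))" by (rule continuous_on_compose2[OF _ w]) auto
      then have "continuous_on \<Omega> (G \<epsilon>)" by (rule continuous_on_eq) (simp add: G_def)
      moreover have "continuous_on (- K) (G \<epsilon>)"
        by (rule continuous_on_eq[OF continuous_on_const[of _ 0]]) (simp add: G0)
      ultimately have "continuous_on (\<Omega> \<union> - K) (G \<epsilon>)"
        using \<Omega> K(1) by (intro continuous_on_open_Un open_Compl compact_imp_closed)
      moreover have "\<Omega> \<union> - K = UNIV" using K(2) by auto
      ultimately show ?thesis by simp
    qed
    moreover have "\<bar>G' \<epsilon> x\<bar> \<le> B" for x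
    proof (cases "x \<in> K")
      case True
      have "\<bar>trunc' \<epsilon> (w x)\<bar> * \<bar>w' x\<bar> \<le> 1 * B" by (intro mult_mono abs_trunc'_le_1 e B True) auto
      then show ?thesis using True K(2) by (auto simp: G'_def abs_mult)
    qed (use G0 B in auto)
    ultimately show ?thesis
      using integral_dir_deriv_compact_support[of "G \<epsilon>" e "G' \<epsilon>" K B] K(1) G0(1) by blast
  qed
  define \<epsilon> where "\<epsilon> n = inverse (real (Suc n))" for n
  have \<epsilon>: "0 < \<epsilon> n" "\<epsilon> \<longlonglongrightarrow> 0" for n unfolding \<epsilon>_def by (simp, rule LIMSEQ_inverse_real_of_nat)
  define iw where "iw x = indicator \<Omega> x *\<^sub>R w x" for x
  define iw' where "iw' x = indicator \<Omega> x *\<^sub>R w' x" for x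
  have iw_meas[measurable]: "iw \<in> borel_measurable borel" "iw' \<in> borel_measurable borel"
    unfolding iw_def[abs_def] iw'_def[abs_def]
    by (rule borel_measurable_continuous_on_indicator[OF \<Omega>_meas w], rule borel_measurable_continuous_on_indicator[OF \<Omega>_meas w'])
  have iw'_int: "integrable lborel iw'" using int by (simp add: set_integrable_def iw'_def[abs_def])
  let ?L = "\<lambda>x. if iw x = 0 then 0 else iw' x"
  have lim: "(\<lambda>n. \<integral>x. G' (\<epsilon> n) x \<partial>lborel) \<longlonglongrightarrow> (\<integral>x. ?L x \<partial>lborel)"
  proof (rule integral_dominated_convergence[where w="\<lambda>x. \<bar>iw' x\<bar>"])
    show "AE x in lborel. (\<lambda>n. G' (\<epsilon> n) x) \<longlonglongrightarrow> ?L x"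
    proof (rule AE_I2)
      fix x
      show "(\<lambda>n. G' (\<epsilon> n) x) \<longlonglongrightarrow> ?L x"
      proof (cases "x \<in> \<Omega>")
        case True
        have "(\<lambda>n. trunc' (\<epsilon> n) (w x) * w' x) \<longlonglongrightarrow> (if w x = 0 then 0 else 1) * w' x"
          by (intro tendsto_intros trunc'_tendsto \<epsilon>)
        then show ?thesis using True by (auto simp: G'_def iw_def iw'_def)
      qed (auto simp: G'_def iw_def iw'_def)
    qed
    show "AE x in lborel. norm (G' (\<epsilon> n) x) \<le> \<bar>iw' x\<bar>" for n
    proof (rule AE_I2)
      fix x
      have "\<bar>trunc' (\<epsilon> n) (w x)\<bar> * \<bar>w' x\<bar> \<le> 1 * \<bar>w' x\<bar>" by (intro mult_right_mono abs_trunc'_le_1 \<epsilon>) auto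
      then show "norm (G' (\<epsilon> n) x) \<le> \<bar>iw' x\<bar>" by (auto simp: G'_def iw'_def abs_mult)
    qed
    show "G' (\<epsilon> n) \<in> borel_measurable lborel" for n using step[OF \<epsilon>(1)] by (blast intro: borel_measurable_integrable)
    show "integrable lborel (\<lambda>x. \<bar>iw' x\<bar>)" using iw'_int by simp
  qed measurable
  have L0: "(\<integral>x. ?L x \<partial>lborel) = 0" using lim step[OF \<epsilon>(1)] by (simp add: LIMSEQ_const_iff)
  define N where "N = {x. iw x = 0 \<and> iw' x \<noteq> 0}"
  have "N \<in> null_sets lborel"
  proof (rule null_set_of_isolated_on_lines[where e=e])
    show "N \<in> sets borel" unfolding N_def by measurable
    fix x assume x: "x \<in> N"
    then have x\<Omega>: "x \<in> \<Omega>" and wx: "w x = 0" "w' x \<noteq> 0" by (auto simp: N_def iw_def iw'_def indicator_def split: if_splits)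
    have "((\<lambda>t. (w (x + (0 + t) *\<^sub>R e) - w (x + 0 *\<^sub>R e)) / t) \<longlongrightarrow> w' x) (at 0)" using der[OF x\<Omega>] by (simp add: DERIV_def)
    then have "((\<lambda>t. w (x + t *\<^sub>R e) / t) \<longlongrightarrow> w' x) (at 0)" using wx by simp
    then have "\<forall>\<^sub>F t in at 0. w (x + t *\<^sub>R e) / t \<noteq> 0" by (rule tendsto_imp_eventually_ne[OF _ wx(2)])
    then obtain d where d: "d > 0" "\<And>t. t \<noteq> 0 \<Longrightarrow> \<bar>t\<bar> < d \<Longrightarrow> w (x + t *\<^sub>R e) \<noteq> 0"
      unfolding eventually_at by (auto simp: dist_real_def)
    then have "x + t *\<^sub>R e \<notin> N" if "0 < \<bar>t\<bar>" "\<bar>t\<bar> < d" for t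
      using d(2)[of t] that by (auto simp: N_def iw_def iw'_def indicator_def)
    then show "\<exists>d>0. \<forall>t. 0 < \<bar>t\<bar> \<longrightarrow> \<bar>t\<bar> < d \<longrightarrow> x + t *\<^sub>R e \<notin> N" using d(1) by blast
  qed
  then have "AE x in lborel. x \<notin> N" by (rule AE_not_in)
  then have "AE x in lborel. iw' x = ?L x" by eventually_elim (auto simp: N_def)
  then have "(\<integral>x. iw' x \<partial>lborel) = (\<integral>x. ?L x \<partial>lborel)"
    by (intro integral_cong_AE) measurable
  then show ?thesis using L0 by (simp add: set_lebesgue_integral_def iw'_def)
qed


section \<open>Mean square deviation of sample averages\<close>

definition square_integrable :: "'a measure \<Rightarrow> ('a \<Rightarrow> 'h::{banach,second_countable_topology}) \<Rightarrow> bool" where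
  "square_integrable P u \<longleftrightarrow> u \<in> borel_measurable P \<and> integrable P (\<lambda>x. (norm (u x))\<^sup>2)"

lemma norm_add_square_le:
  fixes a b :: "'h::real_normed_vector"
  shows "(norm (a + b))\<^sup>2 \<le> 2 * (norm a)\<^sup>2 + 2 * (norm b)\<^sup>2"
proof -
  have "(norm (a + b))\<^sup>2 \<le> (norm a + norm b)\<^sup>2" by (intro power_mono norm_triangle_ineq) simp
  also have "\<dots> \<le> 2 * (norm a)\<^sup>2 + 2 * (norm b)\<^sup>2"
    using zero_le_power2[of "norm a - norm b"] by (simp add: power2_eq_square algebra_simps)
  finally show ?thesis .
qed

lemma square_integrable_bound:
  assumes v: "square_integrable P v" and u[measurable]: "u \<in> borel_measurable P"
    and le: "\<And>x. x \<in> space P \<Longrightarrow> norm (u x) \<le> c * norm (v x)"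
  shows "square_integrable P u"
  unfolding square_integrable_def
proof
  have [measurable]: "v \<in> borel_measurable P" and "integrable P (\<lambda>x. (norm (v x))\<^sup>2)"
    using v by (auto simp: square_integrable_def)
  then have "integrable P (\<lambda>x. c\<^sup>2 * (norm (v x))\<^sup>2)" by simp
  then show "integrable P (\<lambda>x. (norm (u x))\<^sup>2)"
  proof (rule Bochner_Integration.integrable_bound)
    show "AE x in P. norm ((norm (u x))\<^sup>2) \<le> norm (c\<^sup>2 * (norm (v x))\<^sup>2)"
      using power_mono[OF le norm_ge_zero, of _ 2] by (intro AE_I2) (simp add: power_mult_distrib)
  qed measurable
qed (rule u)

lemma square_integrable_add:
  assumes "square_integrable P u" "square_integrable P v"
  shows "square_integrable P (\<lambda>x. u x + v x)"
  unfolding square_integrable_def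
proof
  have [measurable]: "u \<in> borel_measurable P" "v \<in> borel_measurable P"
    and int: "integrable P (\<lambda>x. (norm (u x))\<^sup>2)" "integrable P (\<lambda>x. (norm (v x))\<^sup>2)"
    using assms by (auto simp: square_integrable_def)
  show "(\<lambda>x. u x + v x) \<in> borel_measurable P" by measurable
  have "integrable P (\<lambda>x. 2 * (norm (u x))\<^sup>2 + 2 * (norm (v x))\<^sup>2)" using int by simp
  then show "integrable P (\<lambda>x. (norm (u x + v x))\<^sup>2)"
    by (rule Bochner_Integration.integrable_bound) (auto simp: norm_add_square_le abs_of_nonneg)
qed

lemma square_integrable_sum:
  assumes "finite I" "\<And>i. i \<in> I \<Longrightarrow> square_integrable P (u i)"
  shows "square_integrable P (\<lambda>x. \<Sum>i\<in>I. u i x)"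
  using assms
  by (induction I rule: finite_induct) (auto intro: square_integrable_add simp: square_integrable_def[of _ "\<lambda>x. 0"])

lemma square_integrable_scaleR:
  assumes "square_integrable P u" shows "square_integrable P (\<lambda>x. c *\<^sub>R u x)"
  by (rule square_integrable_bound[OF assms, of _ "\<bar>c\<bar>"]) (use assms in \<open>auto simp: square_integrable_def\<close>)

lemma square_integrable_diff:
  assumes "square_integrable P u" "square_integrable P v"
  shows "square_integrable P (\<lambda>x. u x - v x)"
  using square_integrable_add[OF assms(1) square_integrable_scaleR[OF assms(2), of "-1"]] by simp

lemma (in finite_measure) square_integrable_imp_integrable:
  assumes "square_integrable M u" shows "integrable M u"
proof -
  have [measurable]: "u \<in> borel_measurable M" and int: "integrable M (\<lambda>x. 1 + (norm (u x))\<^sup>2)"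
    using assms by (auto simp: square_integrable_def)
  show ?thesis
  proof (rule Bochner_Integration.integrable_bound[OF int])
    show "AE x in M. norm (u x) \<le> norm (1 + (norm (u x))\<^sup>2)"
    proof (rule AE_I2)
      fix x
      have "2 * norm (u x) \<le> 1 + (norm (u x))\<^sup>2"
        using zero_le_power2[of "norm (u x) - 1"] by (simp add: power2_eq_square algebra_simps)
      then have "norm (u x) \<le> 1 + (norm (u x))\<^sup>2" using zero_le_power2[of "norm (u x)"] by linarith
      then show "norm (u x) \<le> norm (1 + (norm (u x))\<^sup>2)" by simp
    qed
  qed measurable
qed

lemma (in prob_space) indep_vars_imp_indep_var:
  assumes "indep_vars (\<lambda>_. N) X I" "a \<in> I" "b \<in> I" "a \<noteq> b"
  shows "indep_var N (X a) N (X b)"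
proof -
  have "indep_var N ((\<lambda>f. f a) \<circ> (\<lambda>\<omega>. restrict (\<lambda>i. X i \<omega>) {a})) N ((\<lambda>f. f b) \<circ> (\<lambda>\<omega>. restrict (\<lambda>i. X i \<omega>) {b}))"
    by (rule indep_var_compose[OF indep_var_restrict[OF assms(1)]]) (use assms(2-4) in auto)
  then show ?thesis by (simp add: comp_def)
qed

text \<open>The joint law is a product measure, and integrating out one factor replaces \<open>y(X')\<close> by its mean.\<close>

lemma (in prob_space) expectation_inner_indep:
  fixes y :: "'b \<Rightarrow> 'h::{real_inner,banach,second_countable_topology}"
  assumes indep: "indep_var N X N X'" and P: "distr M N X = P" "distr M N X' = P"
    and y: "y \<in> borel_measurable N" "integrable P y" "(\<integral>x. y x \<partial>P) = 0"
  shows "integrable M (\<lambda>\<omega>. y (X \<omega>) \<bullet> y (X' \<omega>))" and "(\<integral>\<omega>. y (X \<omega>) \<bullet> y (X' \<omega>) \<partial>M) = 0"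
proof -
  have [measurable]: "X \<in> measurable M N" "X' \<in> measurable M N" "y \<in> borel_measurable N"
    using indep y by (auto simp: indep_var_distribution_eq)
  have pair: "P \<Otimes>\<^sub>M P = distr M (N \<Otimes>\<^sub>M N) (\<lambda>\<omega>. (X \<omega>, X' \<omega>))"
    using indep P by (auto simp: indep_var_distribution_eq)
  have sP[measurable_cong]: "sets P = sets N" using P by auto
  interpret P: prob_space P unfolding P(1)[symmetric] by (rule prob_space_distr) simp
  interpret PP: pair_sigma_finite P P ..
  let ?f = "\<lambda>(x, x'). y x \<bullet> y x'"
  have f_meas: "?f \<in> borel_measurable (P \<Otimes>\<^sub>M P)" by measurable
  have f_int: "integrable (P \<Otimes>\<^sub>M P) ?f"
  proof (rule PP.Fubini_integrable[OF f_meas])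
    have meas: "(\<lambda>x. \<integral>x'. norm (y x \<bullet> y x') \<partial>P) \<in> borel_measurable P" by measurable
    have int: "integrable P (\<lambda>x. norm (y x) * (\<integral>x'. norm (y x') \<partial>P))" using y(2) by simp
    have "norm (\<integral>x'. norm (y x \<bullet> y x') \<partial>P) \<le> norm (norm (y x) * (\<integral>x'. norm (y x') \<partial>P))" for x
    proof -
      have "(\<integral>x'. norm (y x \<bullet> y x') \<partial>P) \<le> (\<integral>x'. norm (y x) * norm (y x') \<partial>P)"
        using y(2) by (intro integral_mono integrable_norm integrable_inner_right integrable_mult_right)
          (auto simp: Cauchy_Schwarz_ineq2)
      moreover have "0 \<le> (\<integral>x'. norm (y x \<bullet> y x') \<partial>P)" by simp
      ultimately show ?thesis by simp
    qed
    then show "integrable P (\<lambda>x. \<integral>x'. norm (case (x, x') of (x, x') \<Rightarrow> y x \<bullet> y x') \<partial>P)"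
      using Bochner_Integration.integrable_bound[OF int meas] by simp
    show "AE x in P. integrable P (\<lambda>x'. case (x, x') of (x, x') \<Rightarrow> y x \<bullet> y x')" using y(2) by simp
  qed
  show "integrable M (\<lambda>\<omega>. y (X \<omega>) \<bullet> y (X' \<omega>))"
    using f_int unfolding pair by (subst (asm) integrable_distr_eq) (auto simp: measurable_Pair)
  have "(\<integral>\<omega>. y (X \<omega>) \<bullet> y (X' \<omega>) \<partial>M) = (\<integral>z. ?f z \<partial>(P \<Otimes>\<^sub>M P))"
    unfolding pair by (subst integral_distr) (auto simp: measurable_Pair)
  also have "\<dots> = (\<integral>x. \<integral>x'. y x \<bullet> y x' \<partial>P \<partial>P)" using PP.integral_fst'[OF f_int] by simp
  also have "\<dots> = 0" using y(2,3) by simp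
  finally show "(\<integral>\<omega>. y (X \<omega>) \<bullet> y (X' \<omega>) \<partial>M) = 0" .
qed

text \<open>Independence removes the cross terms, so the mean square deviation of the average is at most \<open>E\<parallel>z\<parallel>\<^sup>2 / n\<close>, and
Markov's inequality applies.\<close>

theorem (in prob_space) average_deviation:
  fixes z :: "'b \<Rightarrow> 'h::{real_inner,banach,second_countable_topology}" and X :: "nat \<Rightarrow> 'a \<Rightarrow> 'b"
  assumes indep: "indep_vars (\<lambda>_. N) X {1..}" and P: "\<And>a. 1 \<le> a \<Longrightarrow> distr M N (X a) = P"
    and z: "square_integrable P z" and n: "1 \<le> n" and K: "0 < K"
  shows "{\<omega> \<in> space M. K / sqrt n \<le> norm ((1 / real n) *\<^sub>R (\<Sum>a=1..n. z (X a \<omega>)) - (\<integral>x. z x \<partial>P))} \<in> sets M" (is "?E \<in> _")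
    and "emeasure M {\<omega> \<in> space M. K / sqrt n \<le> norm ((1 / real n) *\<^sub>R (\<Sum>a=1..n. z (X a \<omega>)) - (\<integral>x. z x \<partial>P))}
      \<le> ennreal ((\<integral>x. (norm (z x))\<^sup>2 \<partial>P) / K\<^sup>2)"
proof -
  have X[measurable]: "X a \<in> measurable M N" if "1 \<le> a" for a
    using indep that by (auto simp: indep_vars_def)
  have sP[measurable_cong]: "sets P = sets N" using P[of 1] by auto
  interpret P: prob_space P unfolding P[of 1, OF order_refl, symmetric] by (rule prob_space_distr) simp
  have zm[measurable]: "z \<in> borel_measurable N" and z2: "integrable P (\<lambda>x. (norm (z x))\<^sup>2)"
    using z by (auto simp: square_integrable_def measurable_cong_sets[OF sP refl])
  have zi: "integrable P z" by (rule P.square_integrable_imp_integrable[OF z])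
  define m where "m = (\<integral>x. z x \<partial>P)"
  define y where "y x = z x - m" for x
  have ym[measurable]: "y \<in> borel_measurable N" unfolding y_def by measurable
  have yi: "integrable P y" "(\<integral>x. y x \<partial>P) = 0" using zi by (simp_all add: y_def[abs_def] m_def P.prob_space)
  have y_sq: "(norm (y x))\<^sup>2 = (norm (z x))\<^sup>2 - 2 * (z x \<bullet> m) + (norm m)\<^sup>2" for x
    by (simp add: y_def power2_norm_eq_inner inner_diff_left inner_diff_right inner_commute)
  have y2: "integrable P (\<lambda>x. (norm (y x))\<^sup>2)" unfolding y_sq using z2 zi by simp
  have "(\<integral>x. (norm (y x))\<^sup>2 \<partial>P) = (\<integral>x. (norm (z x))\<^sup>2 \<partial>P) - 2 * (m \<bullet> m) + (norm m)\<^sup>2"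
    unfolding y_sq using z2 zi by (simp add: m_def P.prob_space)
  then have y2_le: "(\<integral>x. (norm (y x))\<^sup>2 \<partial>P) \<le> (\<integral>x. (norm (z x))\<^sup>2 \<partial>P)"
    by (simp add: power2_norm_eq_inner)
  have cross: "integrable M (\<lambda>\<omega>. y (X a \<omega>) \<bullet> y (X b \<omega>))"
    "(\<integral>\<omega>. y (X a \<omega>) \<bullet> y (X b \<omega>) \<partial>M) = (if a = b then (\<integral>x. (norm (y x))\<^sup>2 \<partial>P) else 0)"
    if ab: "1 \<le> a" "1 \<le> b" for a b
  proof -
    have "integrable M (\<lambda>\<omega>. y (X a \<omega>) \<bullet> y (X b \<omega>)) \<and>
      (\<integral>\<omega>. y (X a \<omega>) \<bullet> y (X b \<omega>) \<partial>M) = (if a = b then (\<integral>x. (norm (y x))\<^sup>2 \<partial>P) else 0)"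
    proof (cases "a = b")
      case True
      have "integrable M (\<lambda>\<omega>. (norm (y (X a \<omega>)))\<^sup>2)"
        using y2 unfolding P[OF ab(1), symmetric] by (subst (asm) integrable_distr_eq) (use ab in auto)
      moreover have "(\<integral>\<omega>. (norm (y (X a \<omega>)))\<^sup>2 \<partial>M) = (\<integral>x. (norm (y x))\<^sup>2 \<partial>P)"
        unfolding P[OF ab(1), symmetric] by (subst integral_distr) (use ab in auto)
      ultimately show ?thesis using True by (simp add: power2_norm_eq_inner)
    next
      case False
      have "indep_var N (X a) N (X b)"
        by (rule indep_vars_imp_indep_var[OF indep]) (use ab False in auto)
      from expectation_inner_indep[OF this P[OF ab(1)] P[OF ab(2)] ym yi] show ?thesis using False by simp
    qed
    then show "integrable M (\<lambda>\<omega>. y (X a \<omega>) \<bullet> y (X b \<omega>))"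
      "(\<integral>\<omega>. y (X a \<omega>) \<bullet> y (X b \<omega>) \<partial>M) = (if a = b then (\<integral>x. (norm (y x))\<^sup>2 \<partial>P) else 0)" by auto
  qed
  define A where "A \<omega> = (1 / real n) *\<^sub>R (\<Sum>a=1..n. z (X a \<omega>)) - m" for \<omega>
  have A: "A \<omega> = (1 / real n) *\<^sub>R (\<Sum>a=1..n. y (X a \<omega>))" for \<omega>
    using n by (simp add: A_def y_def sum_subtractf scaleR_diff_right sum_constant_scaleR)
  have A_sq: "(norm (A \<omega>))\<^sup>2 = (1 / (real n)\<^sup>2) * (\<Sum>a=1..n. \<Sum>b=1..n. y (X a \<omega>) \<bullet> y (X b \<omega>))" for \<omega>
  proof -
    have "(\<Sum>a=1..n. y (X a \<omega>)) \<bullet> (\<Sum>a=1..n. y (X a \<omega>)) = (\<Sum>a=1..n. \<Sum>b=1..n. y (X a \<omega>) \<bullet> y (X b \<omega>))"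
      unfolding inner_sum_left by (simp add: inner_sum_right)
    then show ?thesis unfolding A power2_norm_eq_inner by (simp add: power2_eq_square)
  qed
  have A_int: "integrable M (\<lambda>\<omega>. (norm (A \<omega>))\<^sup>2)"
    unfolding A_sq by (intro integrable_mult_right Bochner_Integration.integrable_sum cross) auto
  have "(\<integral>\<omega>. (\<Sum>a=1..n. \<Sum>b=1..n. y (X a \<omega>) \<bullet> y (X b \<omega>)) \<partial>M) = (\<Sum>a=1..n. \<integral>\<omega>. (\<Sum>b=1..n. y (X a \<omega>) \<bullet> y (X b \<omega>)) \<partial>M)"
    by (intro Bochner_Integration.integral_sum Bochner_Integration.integrable_sum cross) auto
  also have "\<dots> = (\<Sum>a=1..n. \<Sum>b=1..n. \<integral>\<omega>. y (X a \<omega>) \<bullet> y (X b \<omega>) \<partial>M)"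
    by (intro sum.cong refl Bochner_Integration.integral_sum cross) auto
  also have "\<dots> = (\<Sum>a=1..n. \<Sum>b=1..n. if a = b then (\<integral>x. (norm (y x))\<^sup>2 \<partial>P) else 0)"
    by (intro sum.cong refl cross) auto
  finally have "(\<integral>\<omega>. (norm (A \<omega>))\<^sup>2 \<partial>M) = (1 / (real n)\<^sup>2) * (\<Sum>a=1..n. \<Sum>b=1..n. if a = b then (\<integral>x. (norm (y x))\<^sup>2 \<partial>P) else 0)"
    unfolding A_sq integral_mult_right_zero by simp
  also have "\<dots> = (\<integral>x. (norm (y x))\<^sup>2 \<partial>P) / n" using n by (simp add: power2_eq_square)
  also have "\<dots> \<le> (\<integral>x. (norm (z x))\<^sup>2 \<partial>P) / n" using y2_le by (intro divide_right_mono) auto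
  finally have var: "(\<integral>\<omega>. (norm (A \<omega>))\<^sup>2 \<partial>M) \<le> (\<integral>x. (norm (z x))\<^sup>2 \<partial>P) / n" .
  have A_meas[measurable]: "A \<in> borel_measurable M" unfolding A_def[abs_def] by measurable
  have E: "?E = {\<omega> \<in> space M. K / sqrt n \<le> norm (A \<omega>)}" by (simp add: A_def m_def)
  show "?E \<in> sets M" unfolding E by measurable
  have "{\<omega> \<in> space M. K / sqrt n \<le> norm (A \<omega>)} = {\<omega> \<in> space M. K\<^sup>2 / n \<le> (norm (A \<omega>))\<^sup>2}"
  proof -
    have "K / sqrt n \<le> norm v \<longleftrightarrow> K\<^sup>2 / n \<le> (norm v)\<^sup>2" for v :: 'h
    proof -
      have "K\<^sup>2 / n = (K / sqrt n)\<^sup>2" using n by (simp add: power_divide)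
      then show ?thesis using K n by (simp add: power_mono_iff)
    qed
    then show ?thesis by simp
  qed
  then have "emeasure M ?E \<le> ennreal (1 / (K\<^sup>2 / n) * (\<integral>\<omega>. (norm (A \<omega>))\<^sup>2 \<partial>M))"
    unfolding E using integral_Markov_inequality[OF A_int, of "K\<^sup>2 / n"] K n by simp
  also have "\<dots> \<le> ennreal (1 / (K\<^sup>2 / n) * ((\<integral>x. (norm (z x))\<^sup>2 \<partial>P) / n))"
    by (intro ennreal_leI mult_left_mono var) auto
  also have "1 / (K\<^sup>2 / n) * ((\<integral>x. (norm (z x))\<^sup>2 \<partial>P) / n) = (\<integral>x. (norm (z x))\<^sup>2 \<partial>P) / K\<^sup>2"
    using n K by simp
  finally show "emeasure M ?E \<le> ennreal ((\<integral>x. (norm (z x))\<^sup>2 \<partial>P) / K\<^sup>2)" .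
qed


section \<open>Score matching\<close>

lemma cont_ext_eq:
  fixes f g :: "'a::t2_space \<Rightarrow> real"
  assumes g: "continuous_on (closure S) g" "\<And>x. x \<in> S \<Longrightarrow> g x = f x" and x: "x \<in> closure S"
  shows "cont_ext S f x = g x"
proof (cases "x \<in> S")
  case False
  have "(g \<longlongrightarrow> g x) (at x within closure S)" using g(1) x by (simp add: continuous_on_def)
  then have "(g \<longlongrightarrow> g x) (at x within S)" using closure_subset by (rule tendsto_within_subset)
  moreover have "\<forall>\<^sub>F y in at x within S. g y = f y" using g(2) by (simp add: eventually_at_filter)
  ultimately have "(f \<longlongrightarrow> g x) (at x within S)" by (rule Lim_transform_eventually)
  moreover have "at x within S \<noteq> bot" using x False by (auto simp: closure_def trivial_limit_within)
  ultimately show ?thesis using False by (simp add: cont_ext_def tendsto_Lim)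
qed (simp add: cont_ext_def g(2))

locale score_matching = smooth_rkhs \<Omega> \<iota> k
  for \<Omega> :: "(real, 'd::{finite,linorder}) vec set"
    and \<iota> :: "'h::{real_inner,banach,second_countable_topology} \<Rightarrow> (real, 'd) vec \<Rightarrow> real"
    and k :: "(real, 'd) vec \<times> (real, 'd) vec \<Rightarrow> real" +
  fixes q0 p0 :: "(real, 'd) vec \<Rightarrow> real" and f0 :: 'h
    and M :: "'w measure" and X :: "nat \<Rightarrow> 'w \<Rightarrow> (real, 'd) vec"
  assumes q0_nonneg: "\<And>x. x \<in> \<Omega> \<Longrightarrow> 0 \<le> q0 x"
    and p0: "p0 = exp_density \<Omega> q0 \<iota> f0"
    and B: "assumption_B \<Omega> k p0"
    and C: "assumption_C \<Omega> k p0"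
    and D: "assumption_D 2 \<Omega> k q0 p0"
    and X: "iid_sample M \<Omega> p0 X"
begin

abbreviation \<Phi> :: "'d \<Rightarrow> (real, 'd) vec \<Rightarrow> 'h" where "\<Phi> i \<equiv> kfeat \<Omega> \<iota> k [i]"
abbreviation \<Psi> :: "'d \<Rightarrow> (real, 'd) vec \<Rightarrow> 'h" where "\<Psi> i \<equiv> kfeat \<Omega> \<iota> k [i, i]"
abbreviation qscore :: "'d \<Rightarrow> (real, 'd) vec \<Rightarrow> real" where "qscore i \<equiv> partial i (\<lambda>y. ln (q0 y))"

definition N :: "(real, 'd) vec measure" where "N = restrict_space lborel \<Omega>"
definition P :: "(real, 'd) vec measure" where "P = density N (\<lambda>x. ennreal (p0 x))"

lemma Omega_sets[measurable, simp]: "\<Omega> \<in> sets borel"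
  using open_Omega by (rule borel_open)

lemma space_N[simp]: "space N = \<Omega>" by (simp add: N_def space_restrict_space)
lemma sets_P[simp, measurable_cong]: "sets P = sets N" by (simp add: P_def)
lemma space_P[simp]: "space P = \<Omega>" using sets_eq_imp_space_eq[OF sets_P] by simp

lemma measurable_P_eq: "borel_measurable P = borel_measurable N"
  by (rule measurable_cong_sets) simp_all

lemma continuous_imp_measurable_N: "continuous_on \<Omega> f \<Longrightarrow> f \<in> borel_measurable N"
proof -
  assume "continuous_on \<Omega> f"
  then have "f \<in> borel_measurable (restrict_space borel \<Omega>)" by (rule borel_measurable_continuous_on_restrict)
  moreover have "sets N = sets (restrict_space borel \<Omega>)" by (simp add: N_def sets_restrict_space)
  ultimately show "f \<in> borel_measurable N" using measurable_cong_sets[OF _ refl] by blast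
qed

lemma measurable_N_iff:
  "f \<in> borel_measurable N \<longleftrightarrow> (\<lambda>x. indicator \<Omega> x *\<^sub>R f x) \<in> borel_measurable lborel"
  for f :: "_ \<Rightarrow> 'b::real_normed_vector"
  unfolding N_def by (rule borel_measurable_restrict_space_iff) simp

lemma p0_eq: "p0 x = exp (\<iota> f0 x - log_partition \<Omega> q0 \<iota> f0) * q0 x"
  by (simp add: p0 exp_density_def)

lemma p0_nonneg: "x \<in> \<Omega> \<Longrightarrow> 0 \<le> p0 x" by (simp add: p0_eq q0_nonneg)

definition q0' :: "(real, 'd) vec \<Rightarrow> (real, 'd) vec" where
  "q0' = (SOME f'. C1_with_gradient \<Omega> q0 f')"

lemma q0': "x \<in> \<Omega> \<Longrightarrow> (q0 has_derivative (\<lambda>v. q0' x \<bullet> v)) (at x)" "continuous_on \<Omega> q0'"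
proof -
  have "C1_on \<Omega> q0" using D unfolding assumption_D_def by (rule conjunct1)
  then have "\<exists>f'. C1_with_gradient \<Omega> q0 f'" unfolding C1_on_def .
  then have "C1_with_gradient \<Omega> q0 q0'" unfolding q0'_def by (rule someI_ex)
  then show "x \<in> \<Omega> \<Longrightarrow> (q0 has_derivative (\<lambda>v. q0' x \<bullet> v)) (at x)" "continuous_on \<Omega> q0'"
    by (auto simp: C1_with_gradient_def)
qed

lemma q0_line_deriv:
  assumes "x \<in> \<Omega>"
  shows "((\<lambda>t. q0 (x + t *\<^sub>R v)) has_real_derivative q0' x \<bullet> v) (at 0)"
proof -
  have "((\<lambda>t. x + t *\<^sub>R v) has_derivative (\<lambda>t. t *\<^sub>R v)) (at 0)" by (auto intro!: derivative_eq_intros)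
  moreover have "(q0 has_derivative (\<lambda>v. q0' x \<bullet> v)) (at (x + 0 *\<^sub>R v))" using q0'(1)[OF assms] by simp
  ultimately have "((\<lambda>t. q0 (x + t *\<^sub>R v)) has_derivative (\<lambda>t. q0' x \<bullet> (t *\<^sub>R v))) (at 0)"
    by (rule has_derivative_compose)
  then show ?thesis by (simp add: has_field_derivative_def mult.commute[of _ "q0' x \<bullet> v"] cong: if_cong)
qed

lemma continuous_on_q0: "continuous_on \<Omega> q0"
  using q0'(1) by (meson continuous_at_imp_continuous_on has_derivative_continuous)

lemma continuous_on_p0: "continuous_on \<Omega> p0"
  unfolding p0_eq[abs_def] by (intro continuous_intros continuous_on_element continuous_on_q0)

lemma p0_measurable[measurable]: "p0 \<in> borel_measurable N"
  by (rule continuous_imp_measurable_N[OF continuous_on_p0])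

text \<open>Where \<open>q\<^sub>0\<close> vanishes, \<open>\<partial>\<^sub>i log q\<^sub>0\<close> is a meaningless default value, but there \<open>p\<^sub>0 = 0\<close> and \<open>q\<^sub>0\<close> has a local minimum, so
both sides are zero.\<close>

lemma p0_qscore:
  assumes x: "x \<in> \<Omega>"
  shows "p0 x * qscore i x = exp (\<iota> f0 x - log_partition \<Omega> q0 \<iota> f0) * (q0' x \<bullet> axis i 1)"
proof -
  have d: "((\<lambda>t. q0 (x + t *\<^sub>R axis i 1)) has_real_derivative q0' x \<bullet> axis i 1) (at 0)" by (rule q0_line_deriv[OF x])
  show ?thesis
  proof (cases "q0 x = 0")
    case True
    obtain r where r: "0 < r" "\<And>u. \<bar>u\<bar> < r \<Longrightarrow> x + u *\<^sub>R axis i 1 \<in> \<Omega>" using line_in[OF x, of i] by blast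
    have "q0' x \<bullet> axis i 1 = 0"
      by (rule DERIV_local_min[OF d r(1)]) (use r(2) True q0_nonneg in auto)
    then show ?thesis using True by (simp add: p0_eq)
  next
    case False
    then have pos: "0 < q0 (x + 0 *\<^sub>R axis i 1)" using q0_nonneg[OF x] by simp
    have "((\<lambda>t. ln (q0 (x + t *\<^sub>R axis i 1))) has_real_derivative 1 / q0 (x + 0 *\<^sub>R axis i 1) * (q0' x \<bullet> axis i 1)) (at 0)"
      by (rule DERIV_chain2[OF DERIV_ln_divide[OF pos] d])
    then have "qscore i x = 1 / q0 x * (q0' x \<bullet> axis i 1)"
      unfolding dir_deriv_def by (intro DERIV_imp_deriv) simp
    then show ?thesis using False by (simp add: p0_eq)
  qed
qed

lemma p0_line_deriv:
  assumes x: "x \<in> \<Omega>"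
  shows "((\<lambda>t. p0 (x + t *\<^sub>R axis i 1)) has_real_derivative p0 x * (qscore i x + f0 \<bullet> \<Phi> i x)) (at 0)"
proof -
  let ?c = "log_partition \<Omega> q0 \<iota> f0"
  have a: "((\<lambda>t. \<iota> f0 (x + t *\<^sub>R axis i 1)) has_real_derivative f0 \<bullet> \<Phi> i x) (at 0)"
    by (rule element_has_derivative[OF x])
  have b: "((\<lambda>t. q0 (x + t *\<^sub>R axis i 1)) has_real_derivative q0' x \<bullet> axis i 1) (at 0)" by (rule q0_line_deriv[OF x])
  have "((\<lambda>t. exp (\<iota> f0 (x + t *\<^sub>R axis i 1) - ?c) * q0 (x + t *\<^sub>R axis i 1)) has_real_derivative
      exp (\<iota> f0 x - ?c) * (f0 \<bullet> \<Phi> i x) * q0 x + (q0' x \<bullet> axis i 1) * exp (\<iota> f0 x - ?c)) (at 0)"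
    by (rule derivative_eq_intros a b refl | simp)+
  moreover have "exp (\<iota> f0 x - ?c) * (f0 \<bullet> \<Phi> i x) * q0 x + (q0' x \<bullet> axis i 1) * exp (\<iota> f0 x - ?c)
      = p0 x * (qscore i x + f0 \<bullet> \<Phi> i x)"
    using p0_qscore[OF x, of i] by (simp add: p0_eq algebra_simps)
  ultimately show ?thesis by (simp add: p0_eq)
qed

lemma prob_space_M: "prob_space M" using X by (simp add: iid_sample_def)

lemma indep_X: "prob_space.indep_vars M (\<lambda>_. N) X {1..}" using X by (simp add: iid_sample_def N_def)

lemma distr_X: "1 \<le> a \<Longrightarrow> distr M N (X a) = P"
  using X by (simp add: iid_sample_def N_def P_def distributed_def)

lemma X_measurable: "1 \<le> a \<Longrightarrow> X a \<in> measurable M N"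
  using X by (simp add: iid_sample_def N_def distributed_def)

sublocale P: prob_space P
proof -
  interpret M: prob_space M by (rule prob_space_M)
  show "prob_space P" using M.prob_space_distr[OF X_measurable[of 1]] distr_X[of 1] by simp
qed

lemma integrable_P_iff:
  fixes f :: "_ \<Rightarrow> 'b::{banach,second_countable_topology}"
  assumes "f \<in> borel_measurable N"
  shows "integrable P f \<longleftrightarrow> set_integrable lborel \<Omega> (\<lambda>x. p0 x *\<^sub>R f x)"
proof -
  have "integrable P f \<longleftrightarrow> integrable N (\<lambda>x. p0 x *\<^sub>R f x)"
    unfolding P_def using assms by (intro integrable_density) (auto simp: p0_nonneg)
  also have "\<dots> \<longleftrightarrow> set_integrable lborel \<Omega> (\<lambda>x. p0 x *\<^sub>R f x)"
    unfolding N_def set_integrable_def by (rule integrable_restrict_space) simp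
  finally show ?thesis .
qed

lemma integral_P_eq:
  fixes f :: "_ \<Rightarrow> 'b::{banach,second_countable_topology}"
  assumes "f \<in> borel_measurable N"
  shows "(\<integral>x. f x \<partial>P) = (LINT x:\<Omega>|lborel. p0 x *\<^sub>R f x)"
proof -
  have "(\<integral>x. f x \<partial>P) = (\<integral>x. p0 x *\<^sub>R f x \<partial>N)"
    unfolding P_def using assms by (intro integral_density) (auto simp: p0_nonneg)
  also have "\<dots> = (LINT x:\<Omega>|lborel. p0 x *\<^sub>R f x)"
    unfolding N_def set_lebesgue_integral_def by (rule integral_restrict_space) simp
  finally show ?thesis .
qed

lemma in_Lp_square_integrable:
  assumes "in_Lp 2 \<Omega> p0 g" shows "square_integrable P g"
proof -
  have g[measurable]: "g \<in> borel_measurable N"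
    using assms by (simp add: in_Lp_def set_borel_measurable_def measurable_N_iff)
  have "set_integrable lborel \<Omega> (\<lambda>x. p0 x *\<^sub>R (norm (g x))\<^sup>2)"
    using assms by (simp add: in_Lp_def mult.commute)
  then have "integrable P (\<lambda>x. (norm (g x))\<^sup>2)" by (subst integrable_P_iff) auto
  then show ?thesis by (simp add: square_integrable_def measurable_P_eq g)
qed

lemma Phi_measurable[measurable]: "\<Phi> i \<in> borel_measurable N"
  and Psi_measurable[measurable]: "\<Psi> i \<in> borel_measurable N"
  using continuous_on_kfeat by (auto intro: continuous_imp_measurable_N)

lemma square_integrable_Phi_sq: "square_integrable P (\<lambda>x. (norm (\<Phi> i x))\<^sup>2)"
proof (rule square_integrable_bound[where c=1])
  show "square_integrable P (\<lambda>x. kderiv [i] [i] k (x, x))"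
    using D by (intro in_Lp_square_integrable) (simp add: assumption_D_def)
  show "norm ((norm (\<Phi> i x))\<^sup>2) \<le> 1 * norm (kderiv [i] [i] k (x, x))" if "x \<in> space P" for x
    using that kfeat1_limit(2)[of x x i] by (simp add: power2_norm_eq_inner)
qed (simp add: measurable_P_eq)

lemma square_integrable_Psi: "square_integrable P (\<Psi> i)"
proof (rule square_integrable_bound[where c=1])
  show "square_integrable P (\<lambda>x. sqrt (kderiv [i,i] [i,i] k (x, x)))"
    using D by (intro in_Lp_square_integrable) (simp add: assumption_D_def)
  show "norm (\<Psi> i x) \<le> 1 * norm (sqrt (kderiv [i,i] [i,i] k (x, x)))" if "x \<in> space P" for x
    using that norm_kfeat(2)[of x i] by simp
qed (simp add: measurable_P_eq)

text \<open>The hypothesis is on \<open>\<parallel>\<partial>\<^sub>ik(x,\<cdot>)\<parallel> \<partial>\<^sub>i log q\<^sub>0\<close>; writing the vector as this scalar times a direction also supplies its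
measurability, since \<open>\<partial>\<^sub>i log q\<^sub>0\<close> by itself is not known to be measurable.\<close>

lemma square_integrable_qscore_Phi: "square_integrable P (\<lambda>x. qscore i x *\<^sub>R \<Phi> i x)"
proof (rule square_integrable_bound[where c=1])
  let ?g = "\<lambda>x. sqrt (kderiv [i] [i] k (x, x)) * qscore i x"
  show g: "square_integrable P ?g"
    using D by (intro in_Lp_square_integrable) (simp add: assumption_D_def)
  have eq: "qscore i x *\<^sub>R \<Phi> i x = ?g x *\<^sub>R sgn (\<Phi> i x)" if "x \<in> \<Omega>" for x
    using norm_kfeat(1)[OF that, of i, symmetric] by (cases "\<Phi> i x = 0") (simp_all add: sgn_div_norm)
  have [measurable]: "?g \<in> borel_measurable N" using g by (simp add: square_integrable_def measurable_P_eq)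
  have "(\<lambda>x. ?g x *\<^sub>R sgn (\<Phi> i x)) \<in> borel_measurable N" unfolding sgn_div_norm by measurable
  then have "(\<lambda>x. qscore i x *\<^sub>R \<Phi> i x) \<in> borel_measurable N"
    by (subst measurable_cong[where g="\<lambda>x. ?g x *\<^sub>R sgn (\<Phi> i x)"]) (auto simp: eq)
  then show "(\<lambda>x. qscore i x *\<^sub>R \<Phi> i x) \<in> borel_measurable P" by (simp add: measurable_P_eq)
  show "norm (qscore i x *\<^sub>R \<Phi> i x) \<le> 1 * norm (?g x)" if "x \<in> space P" for x
    using that by (simp add: abs_mult norm_kfeat(1)[symmetric])
qed

text \<open>The trace of \<open>theta x\<close>.\<close>

definition trace_density :: "(real, 'd) vec \<Rightarrow> real" where
  "trace_density x = (\<Sum>i\<in>UNIV. (norm (\<Phi> i x))\<^sup>2)"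

text \<open>The integrand of the operator \<open>C\<close>, before weighting with \<open>p\<^sub>0\<close>.\<close>

definition theta :: "(real, 'd) vec \<Rightarrow> 'h \<Rightarrow> 'h" where
  "theta x g = (\<Sum>i\<in>UNIV. (\<Phi> i x \<bullet> g) *\<^sub>R \<Phi> i x)"

text \<open>The summand of \<open>\<xi>\<close>, plus the summand of the empirical operator applied to \<open>f\<^sub>0\<close>. Its mean is \<open>\<xi> + C f\<^sub>0\<close>.\<close>

definition zeta :: "(real, 'd) vec \<Rightarrow> 'h" where
  "zeta x = (\<Sum>i\<in>UNIV. qscore i x *\<^sub>R \<Phi> i x + \<Psi> i x) + theta x f0"

lemma trace_density_nonneg: "0 \<le> trace_density x"
  by (auto simp: trace_density_def intro: sum_nonneg)

lemma norm_theta_le: "norm (theta x g) \<le> norm g * trace_density x"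
  unfolding theta_def trace_density_def sum_distrib_left
proof (rule sum_norm_le)
  fix i
  have "\<bar>\<Phi> i x \<bullet> g\<bar> * norm (\<Phi> i x) \<le> (norm (\<Phi> i x) * norm g) * norm (\<Phi> i x)"
    by (intro mult_right_mono Cauchy_Schwarz_ineq2) simp
  then show "norm ((\<Phi> i x \<bullet> g) *\<^sub>R \<Phi> i x) \<le> norm g * (norm (\<Phi> i x))\<^sup>2"
    by (simp add: power2_eq_square mult_ac)
qed

lemma theta_linear:
  "theta x (g + h) = theta x g + theta x h" "theta x (r *\<^sub>R g) = r *\<^sub>R theta x g"
  "theta x (g - h) = theta x g - theta x h"
  by (simp_all add: theta_def inner_add_right inner_diff_right scaleR_add_left scaleR_diff_left
      sum.distrib sum_subtractf scaleR_sum_right)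

lemma theta_symmetric: "theta x g \<bullet> h = g \<bullet> theta x h"
  by (simp add: theta_def inner_sum_left inner_sum_right inner_commute mult.commute)

lemma theta_positive: "0 \<le> theta x g \<bullet> g"
  by (auto simp: theta_def inner_sum_left intro!: sum_nonneg)

lemma square_integrable_trace_density: "square_integrable P trace_density"
  unfolding trace_density_def[abs_def] by (intro square_integrable_sum square_integrable_Phi_sq) simp

lemma theta_measurable[measurable]: "(\<lambda>x. theta x g) \<in> borel_measurable N"
  unfolding theta_def by measurable

lemma square_integrable_rank_one: "square_integrable P (\<lambda>x. (\<Phi> i x \<bullet> g) *\<^sub>R \<Phi> i x)"
proof (rule square_integrable_bound[OF square_integrable_Phi_sq[of i], where c="norm g"])
  fix x
  have "\<bar>\<Phi> i x \<bullet> g\<bar> * norm (\<Phi> i x) \<le> (norm (\<Phi> i x) * norm g) * norm (\<Phi> i x)"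
    by (intro mult_right_mono Cauchy_Schwarz_ineq2) simp
  then show "norm ((\<Phi> i x \<bullet> g) *\<^sub>R \<Phi> i x) \<le> norm g * norm ((norm (\<Phi> i x))\<^sup>2)"
    by (simp add: power2_eq_square mult_ac)
qed (simp add: measurable_P_eq)

lemma square_integrable_theta: "square_integrable P (\<lambda>x. theta x g)"
  unfolding theta_def by (intro square_integrable_sum square_integrable_rank_one) simp

lemma square_integrable_zeta: "square_integrable P zeta"
  unfolding zeta_def[abs_def]
  by (intro square_integrable_add square_integrable_sum square_integrable_theta
      square_integrable_qscore_Phi square_integrable_Psi) simp

lemmas integrable_theta = P.square_integrable_imp_integrable[OF square_integrable_theta]
lemmas integrable_zeta = P.square_integrable_imp_integrable[OF square_integrable_zeta]
lemmas integrable_trace_density = P.square_integrable_imp_integrable[OF square_integrable_trace_density]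

abbreviation estimate :: "real \<Rightarrow> nat \<Rightarrow> (nat \<Rightarrow> (real, 'd) vec) \<Rightarrow> 'h" where
  "estimate \<equiv> score_estimator \<Omega> \<iota> k q0"

abbreviation Cn :: "nat \<Rightarrow> (nat \<Rightarrow> (real, 'd) vec) \<Rightarrow> 'h \<Rightarrow> 'h" where
  "Cn \<equiv> emp_score_op \<Omega> \<iota> k"

abbreviation exceeds :: "real \<Rightarrow> real \<Rightarrow> nat \<Rightarrow> 'w set" where
  "exceeds t l n \<equiv> {\<omega> \<in> space M. t < \<bar>norm (estimate l n (\<lambda>a. X a \<omega>) - f0)\<bar>}"

abbreviation CC :: "'h \<Rightarrow> 'h" where "CC \<equiv> score_op \<Omega> \<iota> k p0"

lemma score_op_eq: "CC g = (\<integral>x. theta x g \<partial>P)"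
  by (simp add: integral_P_eq score_op_def theta_def tensor_op_def)

lemma emp_score_op_eq: "Cn n Y g = (1 / real n) *\<^sub>R (\<Sum>a=1..n. theta (Y a) g)"
  by (simp add: emp_score_op_def theta_def tensor_op_def)

lemma emp_xi_eq: "emp_xi \<Omega> \<iota> k q0 n Y + Cn n Y f0 = (1 / real n) *\<^sub>R (\<Sum>a=1..n. zeta (Y a))"
  by (simp add: emp_score_op_eq emp_xi_def zeta_def sum.distrib scaleR_add_right)

lemma selfadjoint_positive_score_op: "selfadjoint_positive_op CC"
proof -
  have "bounded_linear CC"
  proof (rule bounded_linear_intro)
    show "CC (g + h) = CC g + CC h" "CC (r *\<^sub>R g) = r *\<^sub>R CC g" for g h r
      by (simp_all add: score_op_eq theta_linear integrable_theta)
    show "norm (CC g) \<le> norm g * (\<integral>x. trace_density x \<partial>P)" for g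
    proof -
      have "norm (CC g) \<le> (\<integral>x. norm g * trace_density x \<partial>P)"
        unfolding score_op_eq
        by (rule order_trans[OF integral_norm_bound integral_mono])
           (auto intro: integrable_theta integrable_trace_density norm_theta_le)
      then show ?thesis by simp
    qed
  qed
  moreover have "0 \<le> CC g \<bullet> g" for g
  proof -
    have "CC g \<bullet> g = (\<integral>x. theta x g \<bullet> g \<partial>P)" unfolding score_op_eq using integrable_theta by simp
    also have "\<dots> \<ge> 0" by (rule Bochner_Integration.integral_nonneg) (rule theta_positive)
    finally show ?thesis .
  qed
  moreover have "CC g \<bullet> h = g \<bullet> CC h" for g h
  proof -
    have "CC g \<bullet> h = (\<integral>x. theta x g \<bullet> h \<partial>P)" unfolding score_op_eq using integrable_theta by simp
    also have "\<dots> = (\<integral>x. g \<bullet> theta x h \<partial>P)" by (simp add: theta_symmetric)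
    also have "\<dots> = g \<bullet> CC h" unfolding score_op_eq using integrable_theta by simp
    finally show ?thesis .
  qed
  ultimately show ?thesis
    by (simp add: selfadjoint_positive_op_def selfadjoint_positive_op_axioms_def positive_op_def positive_op_axioms_def)
qed

sublocale C: selfadjoint_positive_op CC by (rule selfadjoint_positive_score_op)

lemma positive_emp_score_op: "positive_op (Cn n Y)"
proof -
  have "bounded_linear (Cn n Y)"
    unfolding emp_score_op_eq[abs_def] theta_def
    by (intro bounded_linear_scaleR_const[THEN bounded_linear_compose] bounded_linear_intros)
  moreover have "0 \<le> Cn n Y g \<bullet> g" for g
    by (auto simp: emp_score_op_eq inner_sum_left theta_positive intro!: divide_nonneg_nonneg sum_nonneg)
  ultimately show ?thesis by (simp add: positive_op_def positive_op_axioms_def)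
qed

text \<open>Apply Bessel's inequality to each \<open>\<partial>\<^sub>ik(x,\<cdot>)\<close> under the integral. This is the form in which the finite trace of \<open>C\<close>
is used.\<close>

lemma sum_orthonormal_le_trace:
  assumes E: "finite E" "orthonormal E"
  shows "(\<Sum>g\<in>E. CC g \<bullet> g) \<le> (\<integral>x. trace_density x \<partial>P)"
proof -
  have int: "integrable P (\<lambda>x. theta x g \<bullet> g)" for g using integrable_theta by simp
  have "(\<Sum>g\<in>E. CC g \<bullet> g) = (\<integral>x. (\<Sum>g\<in>E. theta x g \<bullet> g) \<partial>P)"
    using integrable_theta by (subst Bochner_Integration.integral_sum) (auto simp: score_op_eq int)
  also have "\<dots> \<le> (\<integral>x. trace_density x \<partial>P)"
  proof (rule integral_mono)
    show "integrable P (\<lambda>x. \<Sum>g\<in>E. theta x g \<bullet> g)" by (intro Bochner_Integration.integrable_sum int)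
    fix x
    have "(\<Sum>g\<in>E. theta x g \<bullet> g) = (\<Sum>g\<in>E. \<Sum>i\<in>UNIV. (\<Phi> i x \<bullet> g)\<^sup>2)"
      by (simp add: theta_def inner_sum_left power2_eq_square)
    also have "\<dots> = (\<Sum>i\<in>UNIV. \<Sum>g\<in>E. (\<Phi> i x \<bullet> g)\<^sup>2)" by (rule sum.swap)
    also have "\<dots> \<le> trace_density x"
      unfolding trace_density_def by (intro sum_mono orthonormal_bessel E)
    finally show "(\<Sum>g\<in>E. theta x g \<bullet> g) \<le> trace_density x" .
  qed (rule integrable_trace_density)
  finally show ?thesis .
qed


text \<open>On the closure of \<open>\<Omega>\<close> the function \<open>p\<^sub>0(x) \<parallel>\<partial>\<^sub>ik(x,\<cdot>)\<parallel>\<close> extends continuously and is zero on the boundary; at infinity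
it is \<open>o(\<parallel>x\<parallel>\<^sup>1\<^sup>-\<^sup>d)\<close>, in particular it tends to zero. So the set where it is at least \<open>\<epsilon>\<close> is compact and contained in \<open>\<Omega>\<close>.\<close>

lemma envelope_vanishes:
  assumes \<epsilon>: "0 < \<epsilon>"
  shows "\<exists>K. compact K \<and> K \<subseteq> \<Omega> \<and> (\<forall>x\<in>\<Omega> - K. p0 x * norm (\<Phi> i x) < \<epsilon>)"
proof -
  let ?kd = "kderiv [i] [i] k"
  obtain Q where Q: "continuous_on (closure \<Omega>) Q" "\<And>x. x \<in> \<Omega> \<Longrightarrow> Q x = p0 x"
    using B unfolding assumption_B_def continuously_extendible_def by blast
  obtain G where G: "continuous_on (closure (\<Omega> \<times> \<Omega>)) G" "\<And>z. z \<in> \<Omega> \<times> \<Omega> \<Longrightarrow> G z = ?kd z"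
  proof -
    have "sorted [i] \<and> length [i] \<le> 2" by simp
    then have "continuously_extendible (\<Omega> \<times> \<Omega>) ?kd" using B unfolding assumption_B_def by blast
    then show thesis using that unfolding continuously_extendible_def by blast
  qed
  define b where "b x = Q x * sqrt (G (x, x))" for x
  have diag: "(x, x) \<in> closure (\<Omega> \<times> \<Omega>)" if "x \<in> closure \<Omega>" for x using that by (simp add: closure_Times)
  have b_cont: "continuous_on (closure \<Omega>) b"
    unfolding b_def using diag
    by (intro continuous_intros Q(1) continuous_on_real_sqrt continuous_on_compose2[OF G(1)]) auto
  have b_eq: "b x = p0 x * norm (\<Phi> i x)" if "x \<in> \<Omega>" for x
    using that by (simp add: b_def Q(2) G(2) norm_kfeat(1))
  have b0: "b x = 0" if x: "x \<in> closure \<Omega> - \<Omega>" for x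
  proof -
    have "cont_ext (\<Omega> \<times> \<Omega>) ?kd (x, x) * cont_ext \<Omega> p0 x = 0"
      using C x unfolding assumption_C_def by blast
    moreover have "cont_ext (\<Omega> \<times> \<Omega>) ?kd (x, x) = G (x, x)" by (rule cont_ext_eq[OF G]) (use x diag in auto)
    moreover have "cont_ext \<Omega> p0 x = Q x" by (rule cont_ext_eq[OF Q]) (use x in auto)
    ultimately show ?thesis by (auto simp: b_def)
  qed
  have "(\<lambda>x. sqrt (?kd (x, x)) * p0 x) \<in> o[inf at_infinity (principal \<Omega>)](\<lambda>x. norm x powr (1 - real CARD('d)))"
    using C unfolding assumption_C_def by blast
  from landau_o.smallD[OF this, of "\<epsilon> / 2"] \<epsilon>
  have "\<forall>\<^sub>F x in at_infinity. x \<in> \<Omega> \<longrightarrow> norm (sqrt (?kd (x, x)) * p0 x) \<le> \<epsilon> / 2 * norm (norm x powr (1 - real CARD('d)))"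
    by (simp add: eventually_inf_principal)
  then obtain R where R: "\<And>x. R \<le> norm x \<Longrightarrow> x \<in> \<Omega> \<Longrightarrow>
      norm (sqrt (?kd (x, x)) * p0 x) \<le> \<epsilon> / 2 * norm (norm x powr (1 - real CARD('d)))"
    unfolding eventually_at_infinity by blast
  have far: "p0 x * norm (\<Phi> i x) < \<epsilon>" if x: "x \<in> \<Omega>" "max R 1 \<le> norm x" for x
  proof -
    have "norm x powr (1 - real CARD('d)) \<le> norm x powr 0"
      using x(2) by (intro powr_mono) (auto simp: Suc_le_eq)
    then have "norm x powr (1 - real CARD('d)) \<le> 1" by (simp split: if_splits)
    then have "\<epsilon> / 2 * norm (norm x powr (1 - real CARD('d))) \<le> \<epsilon> / 2 * 1" using x(2) \<epsilon> by (intro mult_left_mono) auto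
    moreover have "p0 x * norm (\<Phi> i x) \<le> norm (sqrt (?kd (x, x)) * p0 x)"
      using x(1) by (simp add: norm_kfeat(1) mult.commute)
    moreover have "R \<le> norm x" using x(2) by simp
    ultimately show ?thesis using R[of x] x(1) \<epsilon> by linarith
  qed
  define K where "K = cball 0 (max R 1) \<inter> {x \<in> closure \<Omega>. \<epsilon> \<le> b x}"
  have "closed {x \<in> closure \<Omega>. \<epsilon> \<le> b x}"
    using continuous_closed_preimage[OF b_cont closed_closure, of "{\<epsilon>..}"] by (simp add: vimage_def Int_def)
  then have "compact K" unfolding K_def by (intro compact_Int_closed compact_cball)
  moreover have "K \<subseteq> \<Omega>" using b0 \<epsilon> by (force simp: K_def)
  moreover have "p0 x * norm (\<Phi> i x) < \<epsilon>" if "x \<in> \<Omega> - K" for x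
  proof (cases "max R 1 \<le> norm x")
    case False
    then have "\<not> \<epsilon> \<le> b x" using that closure_subset[of \<Omega>] by (auto simp: K_def)
    then show ?thesis using b_eq that by simp
  qed (use far that in auto)
  ultimately show ?thesis by blast
qed

text \<open>Evaluated at \<open>y\<close>, the weighted summand \<open>p\<^sub>0 \<zeta>\<close> is the sum over \<open>i\<close> of the \<open>i\<close>-th derivatives of
\<open>w = p\<^sub>0 \<partial>\<^sub>ik(\<cdot>,y)\<close>, and each of them integrates to zero separately.\<close>

lemma integral_zeta: "(\<integral>x. zeta x \<partial>P) = 0"
proof -
  have "\<iota> (\<integral>x. zeta x \<partial>P) y = 0" if y: "y \<in> \<Omega>" for y
  proof -
    let ?v = "\<lambda>i x. qscore i x *\<^sub>R \<Phi> i x + \<Psi> i x + (\<Phi> i x \<bullet> f0) *\<^sub>R \<Phi> i x"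
    have sq: "square_integrable P (?v i)" for i
      by (intro square_integrable_add square_integrable_qscore_Phi square_integrable_Psi square_integrable_rank_one)
    have vm: "?v i \<in> borel_measurable N" for i using sq[of i] by (simp add: square_integrable_def measurable_P_eq)
    have vi: "integrable P (?v i)" for i by (rule P.square_integrable_imp_integrable[OF sq])
    have int0: "(\<integral>x. ?v i x \<bullet> ev y \<partial>P) = 0" for i
    proof -
      define w where "w x = p0 x * \<iota> (\<Phi> i x) y" for x
      define w' where "w' x = p0 x * (?v i x \<bullet> ev y)" for x
      have wm: "(\<lambda>x. ?v i x \<bullet> ev y) \<in> borel_measurable N" using vm[of i] by simp
      have "(LINT x:\<Omega>|lborel. w' x) = 0"
      proof (rule integral_dir_deriv_vanishing_at_boundary[OF open_Omega])
        show "continuous_on \<Omega> w"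
          unfolding w_def ev(2)[OF y] by (intro continuous_intros continuous_on_p0 continuous_on_kfeat)
        have "continuous_on \<Omega> (\<lambda>x. exp (\<iota> f0 x - log_partition \<Omega> q0 \<iota> f0) * (q0' x \<bullet> axis i 1) * (\<Phi> i x \<bullet> ev y)
            + p0 x * (\<Psi> i x \<bullet> ev y) + p0 x * ((\<Phi> i x \<bullet> f0) * (\<Phi> i x \<bullet> ev y)))"
          by (intro continuous_intros continuous_on_p0 continuous_on_kfeat q0'(2) continuous_on_element)
        then show "continuous_on \<Omega> w'"
          by (rule continuous_on_eq) (simp add: w'_def inner_add_left distrib_left flip: p0_qscore)
        show "((\<lambda>t. w (x + t *\<^sub>R axis i 1)) has_real_derivative w' x) (at 0)" if x: "x \<in> \<Omega>" for x
        proof -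
          have "((\<lambda>t. p0 (x + t *\<^sub>R axis i 1) * \<iota> (\<Phi> i (x + t *\<^sub>R axis i 1)) y) has_real_derivative
              p0 x * (qscore i x + f0 \<bullet> \<Phi> i x) * \<iota> (\<Phi> i (x + 0 *\<^sub>R axis i 1)) y
              + \<iota> (\<Psi> i x) y * p0 (x + 0 *\<^sub>R axis i 1)) (at 0)"
            by (rule DERIV_mult[OF p0_line_deriv[OF x] kfeat1_has_derivative[OF x y]])
          moreover have "p0 x * (qscore i x + f0 \<bullet> \<Phi> i x) * \<iota> (\<Phi> i (x + 0 *\<^sub>R axis i 1)) y
              + \<iota> (\<Psi> i x) y * p0 (x + 0 *\<^sub>R axis i 1) = w' x"
            by (simp add: w'_def ev(2)[OF y] inner_add_left inner_commute[of f0] distrib_left distrib_right)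
          ultimately show ?thesis unfolding w_def by simp
        qed
        show "set_integrable lborel \<Omega> w'"
          using vi[of i] integrable_P_iff[OF wm] by (simp add: w'_def[abs_def])
        fix \<epsilon> :: real assume "0 < \<epsilon>"
        then have "0 < \<epsilon> / (norm (ev y) + 1)" by (simp add: add_nonneg_pos)
        from envelope_vanishes[OF this, of i] obtain K where "compact K \<and> K \<subseteq> \<Omega> \<and>
            (\<forall>x\<in>\<Omega> - K. p0 x * norm (\<Phi> i x) < \<epsilon> / (norm (ev y) + 1))" ..
        then have K: "compact K" "K \<subseteq> \<Omega>"
          "\<And>x. x \<in> \<Omega> - K \<Longrightarrow> p0 x * norm (\<Phi> i x) < \<epsilon> / (norm (ev y) + 1)" by simp_all
        have "\<bar>w x\<bar> < \<epsilon>" if x: "x \<in> \<Omega> - K" for x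
        proof -
          have "\<bar>w x\<bar> = p0 x * \<bar>\<Phi> i x \<bullet> ev y\<bar>" using x p0_nonneg by (simp add: w_def ev(2)[OF y] abs_mult)
          also have "\<dots> \<le> p0 x * (norm (\<Phi> i x) * (norm (ev y) + 1))"
          proof (rule mult_left_mono)
            show "\<bar>\<Phi> i x \<bullet> ev y\<bar> \<le> norm (\<Phi> i x) * (norm (ev y) + 1)"
              unfolding distrib_left using Cauchy_Schwarz_ineq2[of "\<Phi> i x" "ev y"] norm_ge_zero[of "\<Phi> i x"] by linarith
          qed (use x p0_nonneg in auto)
          also have "\<dots> < \<epsilon>" using K(3)[OF x] norm_ge_zero[of "ev y"] by (simp add: pos_less_divide_eq mult.assoc)
          finally show ?thesis .
        qed
        then show "\<exists>K. compact K \<and> K \<subseteq> \<Omega> \<and> (\<forall>x\<in>\<Omega> - K. \<bar>w x\<bar> < \<epsilon>)" using K by blast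
      qed
      then show ?thesis by (simp add: integral_P_eq[OF wm] w'_def)
    qed
    have zeta_sum: "zeta x = (\<Sum>i\<in>UNIV. ?v i x)" for x
      by (simp add: zeta_def theta_def sum.distrib)
    have "\<iota> (\<integral>x. zeta x \<partial>P) y = (\<integral>x. zeta x \<bullet> ev y \<partial>P)"
      using integrable_zeta by (simp add: ev(2)[OF y])
    also have "\<dots> = (\<integral>x. (\<Sum>i\<in>UNIV. ?v i x \<bullet> ev y) \<partial>P)" by (simp add: zeta_sum inner_sum_left)
    also have "\<dots> = (\<Sum>i\<in>UNIV. \<integral>x. ?v i x \<bullet> ev y \<partial>P)"
      by (rule Bochner_Integration.integral_sum) (use vi in \<open>simp del: inner_add_left\<close>)
    also have "\<dots> = 0" by (simp only: int0 sum.neutral_const)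
    finally show ?thesis .
  qed
  then have "\<forall>y\<in>\<Omega>. \<iota> (\<integral>x. zeta x \<partial>P) y = \<iota> 0 y" by (simp add: ev(2))
  then show ?thesis using rkhs unfolding is_rkhs_def by blast
qed


definition avg :: "nat \<Rightarrow> ((real, 'd) vec \<Rightarrow> 'h) \<Rightarrow> (nat \<Rightarrow> (real, 'd) vec) \<Rightarrow> 'h" where
  "avg n u Y = (1 / real n) *\<^sub>R (\<Sum>a=1..n. u (Y a))"

text \<open>From \<open>C r = l (f\<^sub>0 - r)\<close>, the estimator minus \<open>f\<^sub>0 - r\<close> is \<open>-(C\<^sub>n + l)\<^sup>-\<^sup>1\<close> applied to the deviation on the right,
and \<open>\<parallel>(C\<^sub>n + l)\<^sup>-\<^sup>1\<parallel> \<le> 1/l\<close>, with \<open>C\<^sub>n\<close> the empirical operator.\<close>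

lemma estimator_error_le:
  assumes l: "0 < l"
  defines "r \<equiv> tikhonov_resid CC l f0"
  shows "norm (estimate l n Y - f0)
    \<le> norm r + norm (avg n (\<lambda>x. zeta x - theta x r) Y + CC r) / l"
proof -
  let ?C = "Cn n Y" and ?\<xi> = "emp_xi \<Omega> \<iota> k q0 n Y"
  interpret E: positive_op ?C by (rule positive_emp_score_op)
  let ?T = "\<lambda>g. ?C g + l *\<^sub>R g"
  define s where "s = avg n (\<lambda>x. zeta x - theta x r) Y + CC r"
  define u where "u = inv ?T s"
  have s: "s = ?\<xi> + ?C f0 - ?C r + CC r"
    by (simp add: s_def avg_def emp_xi_eq sum_subtractf scaleR_diff_right) (simp add: emp_score_op_eq)
  have Tu: "?C u + l *\<^sub>R u = s"
    unfolding u_def using surj_f_inv_f[OF bij_is_surj[OF E.regularised(3)[OF l]], of s] .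
  have Cr: "CC r + l *\<^sub>R r = l *\<^sub>R f0" unfolding r_def by (rule C.tikhonov_resid_eq[OF l])
  have "inv ?T ?\<xi> = r - f0 + u"
  proof (rule E.regularised_inv_eqI[OF l])
    have "?C (r - f0 + u) + l *\<^sub>R (r - f0 + u) = ?C r - ?C f0 + (l *\<^sub>R r - l *\<^sub>R f0) + (?C u + l *\<^sub>R u)"
      by (simp add: E.add E.diff scaleR_add_right scaleR_diff_right)
    also have "\<dots> = ?\<xi> + (CC r + l *\<^sub>R r) - l *\<^sub>R f0" unfolding Tu s by simp
    also have "\<dots> = ?\<xi>" unfolding Cr by simp
    finally show "?C (r - f0 + u) + l *\<^sub>R (r - f0 + u) = ?\<xi>" .
  qed
  then have "estimate l n Y - f0 = - (r + u)"
    by (simp add: score_estimator_def)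
  then have "norm (estimate l n Y - f0) \<le> norm r + norm u"
    by (metis norm_minus_cancel norm_triangle_ineq)
  also have "norm u \<le> norm s / l" unfolding u_def by (rule E.regularised(4)[OF l])
  finally show ?thesis by (simp add: s_def)
qed

lemma average_tail:
  assumes "square_integrable P u" "1 \<le> n" "0 < K"
  shows "{\<omega> \<in> space M. K / sqrt n \<le> norm (avg n u (\<lambda>a. X a \<omega>) - (\<integral>x. u x \<partial>P))} \<in> sets M"
    and "emeasure M {\<omega> \<in> space M. K / sqrt n \<le> norm (avg n u (\<lambda>a. X a \<omega>) - (\<integral>x. u x \<partial>P))}
      \<le> ennreal ((\<integral>x. (norm (u x))\<^sup>2 \<partial>P) / K\<^sup>2)"
  unfolding avg_def by (rule prob_space.average_deviation[OF prob_space_M indep_X distr_X assms]; assumption)+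

text \<open>A bound on the second moment of \<open>\<zeta> - \<Theta> r\<close> that is uniform over \<open>\<parallel>r\<parallel> \<le> \<parallel>f\<^sub>0\<parallel>\<close>, hence over the regularisation
parameter.\<close>

definition noise :: real where
  "noise = 2 * (\<integral>x. (norm (zeta x))\<^sup>2 \<partial>P) + 2 * ((norm f0)\<^sup>2 * (\<integral>x. (trace_density x)\<^sup>2 \<partial>P))"

lemma noise_nonneg: "0 \<le> noise" by (simp add: noise_def)

lemma second_moment_le_noise:
  assumes "norm r \<le> norm f0"
  shows "(\<integral>x. (norm (zeta x - theta x r))\<^sup>2 \<partial>P) \<le> noise"
proof -
  have int: "integrable P (\<lambda>x. (norm (zeta x))\<^sup>2)" "integrable P (\<lambda>x. (trace_density x)\<^sup>2)"
    using square_integrable_zeta square_integrable_trace_density by (auto simp: square_integrable_def)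
  have "(\<integral>x. (norm (zeta x - theta x r))\<^sup>2 \<partial>P)
      \<le> (\<integral>x. 2 * (norm (zeta x))\<^sup>2 + 2 * ((norm f0)\<^sup>2 * (trace_density x)\<^sup>2) \<partial>P)"
  proof (rule integral_mono)
    show "integrable P (\<lambda>x. (norm (zeta x - theta x r))\<^sup>2)"
      using square_integrable_diff[OF square_integrable_zeta square_integrable_theta] by (simp add: square_integrable_def)
    show "integrable P (\<lambda>x. 2 * (norm (zeta x))\<^sup>2 + 2 * ((norm f0)\<^sup>2 * (trace_density x)\<^sup>2))" using int by simp
    fix x
    have "norm (theta x r) \<le> norm f0 * trace_density x"
      by (rule order_trans[OF norm_theta_le mult_right_mono[OF assms trace_density_nonneg]])
    then have "(norm (- theta x r))\<^sup>2 \<le> (norm f0)\<^sup>2 * (trace_density x)\<^sup>2"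
      using power_mono[OF _ norm_ge_zero, of "theta x r" "norm f0 * trace_density x" 2]
      by (simp add: power_mult_distrib)
    then show "(norm (zeta x - theta x r))\<^sup>2 \<le> 2 * (norm (zeta x))\<^sup>2 + 2 * ((norm f0)\<^sup>2 * (trace_density x)\<^sup>2)"
      using norm_add_square_le[of "zeta x" "- theta x r"] by simp
  qed
  also have "\<dots> = noise" using int by (simp add: noise_def)
  finally show ?thesis .
qed

text \<open>The event is contained in a measurable one, on which the average of \<open>\<zeta> - \<Theta> r\<close> is far from its mean. So the outer
measure is controlled although the estimator is not known to be measurable.\<close>

lemma estimator_tail:
  assumes l: "0 < l" and n: "1 \<le> n" and K: "0 < K"
    and t: "norm (tikhonov_resid CC l f0) + K / (l * sqrt n) \<le> t"
  shows "outer_measure_of M (exceeds t l n)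
    \<le> ennreal (noise / K\<^sup>2)"
proof -
  define r where "r = tikhonov_resid CC l f0"
  let ?u = "\<lambda>x. zeta x - theta x r"
  let ?E = "{\<omega> \<in> space M. K / sqrt n \<le> norm (avg n ?u (\<lambda>a. X a \<omega>) - (\<integral>x. ?u x \<partial>P))}"
  have mean: "(\<integral>x. ?u x \<partial>P) = - CC r"
    by (simp add: integrable_zeta integrable_theta integral_zeta score_op_eq)
  have sq: "square_integrable P ?u" by (intro square_integrable_diff square_integrable_zeta square_integrable_theta)
  have "norm (estimate l n (\<lambda>a. X a \<omega>) - f0) \<le> t"
    if w: "norm (avg n ?u (\<lambda>a. X a \<omega>) - (\<integral>x. ?u x \<partial>P)) < K / sqrt n" for \<omega>
  proof -
    have "norm (avg n ?u (\<lambda>a. X a \<omega>) + CC r) / l \<le> K / sqrt n / l"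
      using w l unfolding mean by (intro divide_right_mono) auto
    then show ?thesis
      using estimator_error_le[OF l, of n "\<lambda>a. X a \<omega>"] t by (simp add: r_def mult.commute)
  qed
  then have "exceeds t l n \<subseteq> ?E"
    by (auto simp: not_less[symmetric])
  then have "outer_measure_of M (exceeds t l n)
      \<le> outer_measure_of M ?E" by (rule outer_measure_of_mono)
  also have "\<dots> = emeasure M ?E" by (rule outer_measure_of_eq[OF average_tail(1)[OF sq n K]])
  also have "\<dots> \<le> ennreal ((\<integral>x. (norm (?u x))\<^sup>2 \<partial>P) / K\<^sup>2)" by (rule average_tail(2)[OF sq n K])
  also have "\<dots> \<le> ennreal (noise / K\<^sup>2)"
    using second_moment_le_noise[OF C.norm_tikhonov_resid_le[OF l, of f0]]
    by (intro ennreal_leI divide_right_mono) (auto simp: r_def)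
  finally show ?thesis .
qed

theorem consistency:
  assumes f0: "f0 \<in> closure (range CC)"
    and ls: "\<And>n. 0 < ls n" "ls \<longlonglongrightarrow> 0" and ls_sqrt: "filterlim (\<lambda>n. ls n * sqrt (real n)) at_top sequentially"
  shows "tends_to_0_in_prob M (\<lambda>n \<omega>. norm (estimate (ls n) n (\<lambda>a. X a \<omega>) - f0))"
  unfolding tends_to_0_in_prob_def
proof (intro allI impI)
  fix \<epsilon> :: real assume e: "0 < \<epsilon>"
  \<comment> \<open>Chosen so that the noise term \<open>K / (\<lambda>\<surd>n)\<close> of the tail bound is \<open>\<epsilon>/2\<close>; it diverges by the assumption on \<open>\<lambda>\<close>.\<close>
  define K where "K n = \<epsilon> / 2 * (ls n * sqrt n)" for n
  have K_top: "filterlim K at_top sequentially"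
    unfolding K_def by (rule filterlim_tendsto_pos_mult_at_top[OF tendsto_const _ ls_sqrt]) (use e in simp)
  have "filterlim (\<lambda>n. (K n)\<^sup>2) at_top sequentially" by (rule filterlim_pow_at_top[OF _ K_top]) simp
  then have "((\<lambda>n. noise / (K n)\<^sup>2) \<longlongrightarrow> 0) sequentially" by (rule real_tendsto_divide_at_top[OF tendsto_const])
  then have lim: "(\<lambda>n. ennreal (noise / (K n)\<^sup>2)) \<longlonglongrightarrow> 0"
    using tendsto_ennrealI by fastforce
  have "(\<lambda>n. norm (tikhonov_resid CC (ls n) f0)) \<longlonglongrightarrow> 0"
    by (rule tendsto_norm_zero[OF C.tikhonov_resid_tendsto_0[OF f0 ls]])
  then have "\<forall>\<^sub>F n in sequentially. norm (tikhonov_resid CC (ls n) f0) < \<epsilon> / 2"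
    by (rule order_tendstoD(2)) (use e in simp)
  then have bound: "\<forall>\<^sub>F n in sequentially. outer_measure_of M
      (exceeds \<epsilon> (ls n) n) \<le> ennreal (noise / (K n)\<^sup>2)"
    using eventually_ge_at_top[of 1]
  proof eventually_elim
    case (elim n)
    have p: "0 < ls n * sqrt n" using ls(1) elim(2) by simp
    show ?case
    proof (rule estimator_tail[OF ls(1) elim(2)])
      show "0 < K n" using p e by (simp add: K_def)
      have "K n / (ls n * sqrt n) = \<epsilon> / 2" using p unfolding K_def by (metis less_irrefl nonzero_mult_div_cancel_right)
      then show "norm (tikhonov_resid CC (ls n) f0) + K n / (ls n * sqrt n) \<le> \<epsilon>" using elim(1) by linarith
    qed
  qed
  show "(\<lambda>n. outer_measure_of M (exceeds \<epsilon> (ls n) n)) \<longlonglongrightarrow> 0"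
    by (rule tendsto_sandwich[OF _ bound tendsto_const lim]) simp
qed

lemma exists_large_divisor:
  assumes "0 \<le> V" "0 < (\<delta>::real)" obtains K where "0 < K" "V / K\<^sup>2 < \<delta>"
proof
  show "0 < sqrt ((V + 1) / \<delta>)" using assms by simp
  have "(sqrt ((V + 1) / \<delta>))\<^sup>2 = (V + 1) / \<delta>" using assms by simp
  then show "V / (sqrt ((V + 1) / \<delta>))\<^sup>2 < \<delta>" using assms by (simp add: field_simps)
qed

text \<open>The exponent of \<open>\<lambda>\<close> balances the bias \<open>\<lambda> powr min 1 \<beta>\<close> against the noise \<open>1/(\<lambda>\<surd>n)\<close>: both are exactly the stated rate.\<close>

theorem source_condition_rate:
  assumes \<beta>: "0 < \<beta>" and f0: "f0 \<in> range (op_powr CC \<beta>)"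
  shows "bigo_in_prob M
    (\<lambda>n \<omega>. norm (estimate (real n powr (- max (1/4) (1 / (2 * (\<beta> + 1))))) n (\<lambda>a. X a \<omega>) - f0))
    (\<lambda>n. real n powr (- min (1/4) (\<beta> / (2 * (\<beta> + 1)))))"
  unfolding bigo_in_prob_def
proof (intro allI impI)
  fix \<delta> :: real assume \<delta>: "0 < \<delta>"
  obtain D where D: "0 < D" "\<And>l. 0 < l \<Longrightarrow> norm (tikhonov_resid CC l f0) \<le> D * l powr (min 1 \<beta>)"
    using C.norm_tikhonov_resid_powr_le[OF \<beta> f0] by blast
  obtain K where K: "0 < K" "noise / K\<^sup>2 < \<delta>" using exists_large_divisor[OF noise_nonneg \<delta>] by blast
  let ?a = "max (1/4) (1 / (2 * (\<beta> + 1)))" and ?b = "min (1/4) (\<beta> / (2 * (\<beta> + 1)))"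
  have ab: "?a * min 1 \<beta> = ?b" "1/2 - ?a = ?b"
  proof -
    have "\<beta> / (2 * (\<beta> + 1)) = 1/2 - 1 / (2 * (\<beta> + 1))" using \<beta> by (simp add: field_simps)
    then show "1/2 - ?a = ?b" by (auto simp: min_def max_def)
    show "?a * min 1 \<beta> = ?b"
    proof (cases "\<beta> \<le> 1")
      case True
      then have "1/4 \<le> 1 / (2 * (\<beta> + 1))" "\<beta> / (2 * (\<beta> + 1)) \<le> 1/4" using \<beta> by (auto simp: field_simps)
      then show ?thesis using True by (simp add: min_def max_def)
    next
      case False
      then have "1 / (2 * (\<beta> + 1)) \<le> 1/4" "1/4 \<le> \<beta> / (2 * (\<beta> + 1))" using \<beta> by (auto simp: field_simps)
      then show ?thesis using False by (simp add: min_def max_def)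
    qed
  qed
  have "outer_measure_of M (exceeds ((D + K) * real n powr - ?b) (real n powr - ?a) n) < ennreal \<delta>" if n: "1 \<le> n" for n
  proof (rule le_less_trans[OF estimator_tail[OF _ n K(1)]])
    let ?l = "real n powr - ?a"
    show l: "0 < ?l" using n by simp
    have "?l powr min 1 \<beta> = real n powr - ?b" unfolding powr_powr by (simp only: mult_minus_left ab(1))
    moreover have "K / (?l * sqrt n) = K * real n powr - ?b"
    proof -
      have "?l * sqrt n = real n powr (1/2 - ?a)"
        using n by (simp add: powr_half_sqrt[symmetric] powr_add[symmetric])
      then have "?l * sqrt n = real n powr ?b" by (simp only: ab(2))
      then show ?thesis by (simp only: powr_minus divide_inverse)
    qed
    ultimately show "norm (tikhonov_resid CC ?l f0) + K / (?l * sqrt n) \<le> (D + K) * real n powr - ?b"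
      using D(2)[OF l] by (simp add: distrib_right)
    show "ennreal (noise / K\<^sup>2) < ennreal \<delta>" by (rule ennreal_lessI[OF \<delta> K(2)])
  qed
  moreover have "0 < D + K" using D K by simp
  ultimately show "\<exists>K>0. \<forall>\<^sub>F n in sequentially. outer_measure_of M (exceeds (K * real n powr - ?b) (real n powr - ?a) n) < ennreal \<delta>"
    unfolding eventually_sequentially by (intro exI[of _ "D + K"] conjI exI[of _ 1] allI impI)
qed

text \<open>With a lower bound \<open>c\<close> on the empirical operator, the inverse costs \<open>1/c\<close> instead of \<open>1/l\<close>, and the error is
\<open>-(C\<^sub>n + l)\<^sup>-\<^sup>1\<close> applied to the average of \<open>\<zeta>\<close> plus \<open>l f\<^sub>0\<close>.\<close>

lemma estimator_error_coercive_le: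
  assumes l: "0 \<le> l" and c: "0 < c" and coercive: "\<And>g. c * (norm g)\<^sup>2 \<le> Cn n Y g \<bullet> g"
  shows "norm (estimate l n Y - f0) \<le> (norm (avg n zeta Y) + l * norm f0) / c"
proof -
  let ?C = "Cn n Y" and ?\<xi> = "emp_xi \<Omega> \<iota> k q0 n Y"
  interpret E: positive_op ?C by (rule positive_emp_score_op)
  let ?T = "\<lambda>g. ?C g + l *\<^sub>R g"
  have T: "bounded_linear ?T"
    by (intro bounded_linear_add E.bounded_linear_axioms bounded_linear_scaleR_right)
  have co: "c * (norm g)\<^sup>2 \<le> ?T g \<bullet> g" for g
    using coercive[of g] l by (simp add: inner_add_left add_increasing2)
  define s where "s = avg n zeta Y + l *\<^sub>R f0"
  have bij: "bij ?T" by (rule coercive_bij[OF T c co])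
  have Tu: "?T (inv ?T s) = s" by (rule surj_f_inv_f[OF bij_is_surj[OF bij]])
  have s: "s = ?\<xi> + ?C f0 + l *\<^sub>R f0" by (simp add: s_def avg_def emp_xi_eq)
  have "?T (inv ?T s - f0) = ?T (inv ?T s) - ?T f0" by (simp add: E.diff scaleR_diff_right)
  also have "\<dots> = ?\<xi>" unfolding Tu unfolding s by simp
  finally have eq: "?T (inv ?T s - f0) = ?\<xi>" .
  have "inv ?T (?T (inv ?T s - f0)) = inv ?T s - f0" by (rule inv_f_f[OF bij_is_inj[OF bij]])
  then have "inv ?T ?\<xi> = inv ?T s - f0" unfolding eq .
  then have "estimate l n Y - f0 = - inv ?T s" by (simp add: score_estimator_def)
  then have "norm (estimate l n Y - f0) \<le> norm s / c"
    using coercive_norm_inv_le[OF T c co, of s] by simp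
  also have "norm s \<le> norm (avg n zeta Y) + l * norm f0"
    unfolding s_def using norm_triangle_ineq[of "avg n zeta Y" "l *\<^sub>R f0"] l by simp
  finally show ?thesis using c by (simp add: divide_right_mono)
qed

text \<open>A lower bound \<open>c\<close> for \<open>C\<close> and its finite trace bound the size of orthonormal sets. If the empirical operator is within
\<open>\<tau>\<close> of \<open>C\<close> on each vector of a finite orthonormal basis, it is within \<open>c/2\<close> in operator norm, hence bounded below
by \<open>c/2\<close>. That fails with probability \<open>O(1/n)\<close>.\<close>

theorem invertible_rate:
  assumes "boundedly_invertible CC"
  shows "bigo_in_prob M
    (\<lambda>n \<omega>. norm (estimate (real n powr (- 1/2)) n (\<lambda>a. X a \<omega>) - f0))
    (\<lambda>n. real n powr (- 1/2))"
  unfolding bigo_in_prob_def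
proof (intro allI impI)
  fix \<delta> :: real assume \<delta>: "0 < \<delta>"
  obtain c where c: "0 < c" "\<And>g. c * (norm g)\<^sup>2 \<le> CC g \<bullet> g" using C.boundedly_invertible_coercive[OF assms] by blast
  have "card E \<le> nat \<lfloor>(\<integral>x. trace_density x \<partial>P) / c\<rfloor>" if E: "finite E" "orthonormal E" for E :: "'h set"
  proof -
    have "real (card E) * c = (\<Sum>g\<in>E. c * (norm g)\<^sup>2)" using E by (simp add: orthonormal_def)
    also have "\<dots> \<le> (\<Sum>g\<in>E. CC g \<bullet> g)" by (intro sum_mono c)
    also have "\<dots> \<le> (\<integral>x. trace_density x \<partial>P)" by (rule sum_orthonormal_le_trace[OF E])
    finally have "real (card E) \<le> (\<integral>x. trace_density x \<partial>P) / c" using c by (simp add: field_simps)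
    then show ?thesis by (simp add: le_nat_floor)
  qed
  then obtain E :: "'h set" where E: "finite E" "orthonormal E" "\<And>h. h = (\<Sum>g\<in>E. (h \<bullet> g) *\<^sub>R g)"
    using finite_orthonormal_basis by blast
  \<comment> \<open>The summand \<open>1\<close> keeps the denominator positive when the space is trivial.\<close>
  define \<tau> where "\<tau> = c / (2 * (real (card E) + 1))"
  have \<tau>: "0 < \<tau>" "real (card E) * \<tau> \<le> c / 2" using c by (auto simp: \<tau>_def field_simps)
  have emp_coercive: "c / 2 * (norm h)\<^sup>2 \<le> Cn n Y h \<bullet> h"
    if close: "\<And>g. g \<in> E \<Longrightarrow> norm (avg n (\<lambda>x. theta x g) Y - CC g) \<le> \<tau>" for n Y h
  proof -
    interpret Emp: positive_op "Cn n Y" by (rule positive_emp_score_op)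
    let ?\<Delta> = "\<lambda>g. Cn n Y g - CC g"
    interpret \<Delta>: bounded_linear ?\<Delta> by (intro bounded_linear_sub Emp.bounded_linear_axioms C.bounded_linear_axioms)
    have "?\<Delta> (\<Sum>g\<in>E. (h \<bullet> g) *\<^sub>R g) = (\<Sum>g\<in>E. (h \<bullet> g) *\<^sub>R ?\<Delta> g)" by (simp only: \<Delta>.sum \<Delta>.scaleR)
    then have "?\<Delta> h = (\<Sum>g\<in>E. (h \<bullet> g) *\<^sub>R ?\<Delta> g)" unfolding E(3)[of h, symmetric] .
    then have "norm (?\<Delta> h) \<le> (\<Sum>g\<in>E. norm h * \<tau>)"
    proof (simp only:, intro sum_norm_le)
      fix g assume g: "g \<in> E"
      have "\<bar>h \<bullet> g\<bar> \<le> norm h" using Cauchy_Schwarz_ineq2[of h g] E(2) g by (simp add: orthonormal_def)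
      moreover have "norm (?\<Delta> g) \<le> \<tau>" using close[OF g] by (simp add: avg_def emp_score_op_eq)
      ultimately show "norm ((h \<bullet> g) *\<^sub>R ?\<Delta> g) \<le> norm h * \<tau>"
        unfolding norm_scaleR real_norm_def by (intro mult_mono) auto
    qed
    also have "\<dots> = norm h * (real (card E) * \<tau>)" by simp
    also have "\<dots> \<le> norm h * (c / 2)" by (intro mult_left_mono \<tau>) simp
    finally have "norm (?\<Delta> h) * norm h \<le> norm h * (c / 2) * norm h" by (rule mult_right_mono) simp
    then have "\<bar>?\<Delta> h \<bullet> h\<bar> \<le> c / 2 * (norm h)\<^sup>2"
      using Cauchy_Schwarz_ineq2[of "?\<Delta> h" h] by (simp add: power2_eq_square mult_ac)
    then have "CC h \<bullet> h - c / 2 * (norm h)\<^sup>2 \<le> Cn n Y h \<bullet> h"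
      unfolding inner_diff_left by linarith
    then show ?thesis using c(2)[of h] by simp
  qed
  define V where "V = (\<integral>x. (norm (zeta x))\<^sup>2 \<partial>P)"
  define W where "W = (\<Sum>g\<in>E. (\<integral>x. (norm (theta x g))\<^sup>2 \<partial>P))"
  have VW: "0 \<le> V" "0 \<le> W" by (auto simp: V_def W_def intro: sum_nonneg)
  obtain K where K: "0 < K" "V / K\<^sup>2 < \<delta> / 2" using exists_large_divisor[OF VW(1), of "\<delta> / 2"] \<delta> by auto
  define K' where "K' = 2 / c * (K + norm f0)"
  have "((\<lambda>n. W / \<tau>\<^sup>2 * (1 / real n)) \<longlongrightarrow> W / \<tau>\<^sup>2 * 0) sequentially"
    by (intro tendsto_intros lim_1_over_n)
  then have "\<forall>\<^sub>F n in sequentially. W / \<tau>\<^sup>2 * (1 / real n) < \<delta> / 2"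
    by (rule order_tendstoD(2)) (use \<delta> in simp)
  then have "\<forall>\<^sub>F n in sequentially. outer_measure_of M (exceeds (K' * real n powr (- 1/2)) (real n powr (- 1/2)) n) < ennreal \<delta>"
    using eventually_ge_at_top[of 1]
  proof eventually_elim
    case (elim n)
    have n: "1 \<le> n" by (rule elim(2))
    let ?l = "real n powr (- 1/2)"
    have l: "?l = 1 / sqrt n" using n by (simp add: powr_minus_divide powr_half_sqrt[symmetric])
    let ?A = "{\<omega> \<in> space M. K / sqrt n \<le> norm (avg n zeta (\<lambda>a. X a \<omega>) - (\<integral>x. zeta x \<partial>P))}"
    \<comment> \<open>The threshold is \<open>\<tau>\<close>, in the form \<open>K / sqrt n\<close> of the tail bound.\<close>
    let ?B = "\<lambda>g. {\<omega> \<in> space M. (\<tau> * sqrt n) / sqrt n \<le> norm (avg n (\<lambda>x. theta x g) (\<lambda>a. X a \<omega>) - (\<integral>x. theta x g \<partial>P))}"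
    have \<tau>n: "0 < \<tau> * sqrt n" using \<tau> n by simp
    note A = average_tail[OF square_integrable_zeta n K(1)]
    note B = average_tail[OF square_integrable_theta n \<tau>n]
    have "norm (estimate ?l n (\<lambda>a. X a \<omega>) - f0) \<le> K' * ?l"
      if w: "\<omega> \<in> space M" "\<omega> \<notin> ?A" "\<And>g. g \<in> E \<Longrightarrow> \<omega> \<notin> ?B g" for \<omega>
    proof -
      have "norm (avg n (\<lambda>x. theta x g) (\<lambda>a. X a \<omega>) - CC g) \<le> \<tau>" if "g \<in> E" for g
        using w(3)[OF that] w(1) n by (simp add: score_op_eq)
      then have co: "c / 2 * (norm h)\<^sup>2 \<le> Cn n (\<lambda>a. X a \<omega>) h \<bullet> h" for h by (rule emp_coercive)
      have "norm (estimate ?l n (\<lambda>a. X a \<omega>) - f0)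
          \<le> (norm (avg n zeta (\<lambda>a. X a \<omega>)) + ?l * norm f0) / (c / 2)"
        by (rule estimator_error_coercive_le[OF _ _ co]) (use c in auto)
      also have "\<dots> \<le> (K / sqrt n + ?l * norm f0) / (c / 2)"
        using w c by (intro divide_right_mono add_right_mono) (auto simp: integral_zeta)
      also have "\<dots> = K' * ?l"
      proof -
        have eq: "K / sqrt n + 1 / sqrt n * norm f0 = (K + norm f0) * (1 / sqrt n)" by (simp add: add_divide_distrib)
        show ?thesis unfolding l K'_def eq by (simp add: mult.commute)
      qed
      finally show ?thesis .
    qed
    then have sub: "(exceeds (K' * ?l) ?l n) \<subseteq> ?A \<union> (\<Union>g\<in>E. ?B g)"
      by (auto simp only: mem_Collect_eq abs_norm_cancel not_less[symmetric] Un_iff UN_iff)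
    have UB: "(\<Union>g\<in>E. ?B g) \<in> sets M" by (rule sets.finite_UN[OF E(1) B(1)])
    have "emeasure M (\<Union>g\<in>E. ?B g) \<le> (\<Sum>g\<in>E. emeasure M (?B g))"
      by (rule emeasure_subadditive_finite[OF E(1)]) (use B(1) in blast)
    also have "\<dots> \<le> (\<Sum>g\<in>E. ennreal ((\<integral>x. (norm (theta x g))\<^sup>2 \<partial>P) / (\<tau> * sqrt n)\<^sup>2))"
      by (intro sum_mono B(2))
    also have "\<dots> = ennreal (\<Sum>g\<in>E. (\<integral>x. (norm (theta x g))\<^sup>2 \<partial>P) / (\<tau> * sqrt n)\<^sup>2)" by (rule sum_ennreal) simp
    also have "(\<Sum>g\<in>E. (\<integral>x. (norm (theta x g))\<^sup>2 \<partial>P) / (\<tau> * sqrt n)\<^sup>2) = W / \<tau>\<^sup>2 * (1 / real n)"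
      unfolding sum_divide_distrib[symmetric] W_def[symmetric] by (simp add: power_mult_distrib)
    finally have UB_le: "emeasure M (\<Union>g\<in>E. ?B g) \<le> ennreal (W / \<tau>\<^sup>2 * (1 / real n))" .
    have "outer_measure_of M (exceeds (K' * ?l) ?l n) \<le> outer_measure_of M (?A \<union> (\<Union>g\<in>E. ?B g))"
      by (rule outer_measure_of_mono[OF sub])
    also have "\<dots> = emeasure M (?A \<union> (\<Union>g\<in>E. ?B g))" by (rule outer_measure_of_eq[OF sets.Un[OF A(1) UB]])
    also have "\<dots> \<le> emeasure M ?A + emeasure M (\<Union>g\<in>E. ?B g)" by (rule emeasure_subadditive[OF A(1) UB])
    also have "\<dots> \<le> ennreal (V / K\<^sup>2) + ennreal (W / \<tau>\<^sup>2 * (1 / real n))"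
      unfolding V_def by (rule add_mono[OF A(2) UB_le])
    also have "\<dots> = ennreal (V / K\<^sup>2 + W / \<tau>\<^sup>2 * (1 / real n))" using VW by (simp add: ennreal_plus)
    also have "\<dots> < ennreal \<delta>" by (rule ennreal_lessI[OF \<delta>]) (use elim(1) K(2) in linarith)
    finally show ?case .
  qed
  moreover have "0 < K'" using c K by (simp add: K'_def add_pos_nonneg)
  ultimately show "\<exists>K>0. \<forall>\<^sub>F n in sequentially. outer_measure_of M (exceeds (K * real n powr (- 1/2)) (real n powr (- 1/2)) n) < ennreal \<delta>" by blast
qed

end


theorem theorem5:
  fixes \<Omega> :: "(real, 'd::{finite,linorder}) vec set"
    and \<iota> :: "'h::{real_inner,banach,second_countable_topology} \<Rightarrow> (real, 'd) vec \<Rightarrow> real"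
    and k :: "(real, 'd) vec \<times> (real, 'd) vec \<Rightarrow> real"
    and q0 p0 :: "(real, 'd) vec \<Rightarrow> real"
    and f0 :: 'h
    and M :: "'w measure"
    and X :: "nat \<Rightarrow> 'w \<Rightarrow> (real, 'd) vec"
  assumes q0: "prob_density_on \<Omega> q0"
    and H: "is_rkhs \<Omega> \<iota> k"
    and f0: "f0 \<in> nat_param_space \<Omega> q0 \<iota>"
    and p0: "p0 = exp_density \<Omega> q0 \<iota> f0"
    and A: "assumption_A \<Omega>"
    and B: "assumption_B \<Omega> k p0"
    and C: "assumption_C \<Omega> k p0"
    and D: "assumption_D 2 \<Omega> k q0 p0"
    and X: "iid_sample M \<Omega> p0 X"
  shows
    "(f0 \<in> closure (range (score_op \<Omega> \<iota> k p0)) \<longrightarrow>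
       (\<forall>ls :: nat \<Rightarrow> real.
          (\<forall>n. 0 < ls n) \<and> ls \<longlonglongrightarrow> 0 \<and>
          filterlim (\<lambda>n. ls n * sqrt (real n)) at_top sequentially \<longrightarrow>
          tends_to_0_in_prob M
            (\<lambda>n \<omega>. norm (score_estimator \<Omega> \<iota> k q0 (ls n) n (\<lambda>a. X a \<omega>) - f0))))
     \<and>
     (\<forall>\<beta>>0. f0 \<in> range (op_powr (score_op \<Omega> \<iota> k p0) \<beta>) \<longrightarrow>
       bigo_in_prob M
         (\<lambda>n \<omega>. norm (score_estimator \<Omega> \<iota> k q0
            (real n powr (- max (1/4) (1 / (2 * (\<beta> + 1))))) n (\<lambda>a. X a \<omega>) - f0))
         (\<lambda>n. real n powr (- min (1/4) (\<beta> / (2 * (\<beta> + 1))))))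
     \<and>
     (boundedly_invertible (score_op \<Omega> \<iota> k p0) \<longrightarrow>
       bigo_in_prob M
         (\<lambda>n \<omega>. norm (score_estimator \<Omega> \<iota> k q0
            (real n powr (- 1/2)) n (\<lambda>a. X a \<omega>) - f0))
         (\<lambda>n. real n powr (- 1/2)))"
proof -
  interpret smooth_rkhs \<Omega> \<iota> k
  proof
    show "is_rkhs \<Omega> \<iota> k" by (rule H)
    show "open \<Omega>" using A by (simp add: assumption_A_def)
    show "iter_deriv_exists (\<Omega> \<times> \<Omega>) (kernel_dirs is is) k \<and> continuous_on (\<Omega> \<times> \<Omega>) (kderiv is is k)"
      if "sorted is" "length is \<le> 2" for "is"
      using B that unfolding assumption_B_def by blast
  qed
  interpret score_matching \<Omega> \<iota> k q0 p0 f0 M X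
  proof
    show "0 \<le> q0 x" if "x \<in> \<Omega>" for x using q0 that by (simp add: prob_density_on_def)
  qed (rule p0 B C D X)+
  show ?thesis using consistency source_condition_rate invertible_rate by blast
qed

end
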